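(* The real moduli space $\mathcal M$ (resp. the unoriented real moduli space $\mathcal M'$) is canonically isomorphic to the space of congruence classes of point pairs under the action of $SU(4)$ (resp. under the action of isometries) in the Riemannian globally symmetric space $X=SU(4)/K$.
   Context: Let $\mathcal S=\{\Lambda\in M_4(\mathbb C)\mid \Lambda=\Lambda^t,\ \Lambda^*=\Lambda^{-1}\}$ be the space of symmetric unitary matrices. It is the homogeneous space $U(4)/O(4)$, where $V\in U(4)$ acts by $\Lambda\mapsto V\Lambda V^t$. The real moduli space $\mathcal M$ is the quotient of $\mathcal S$ by the transformations $\Lambda\mapsto e^{-2i\varphi}\Lambda$ ($\varphi\in\mathbb R$) and $\Lambda\mapsto S\Lambda S^t$ ($S\in SO(4)$). The unoriented real moduli space $\mathcal M'$ is the further quotient of $\mathcal M$ by $\Lambda\mapsto\Lambda^{-1}$. Let $\theta$ be the involution of $SU(4)$ given by complex conjugation, $Z$ the center of $SU(4)$, and $K=\{u\in SU(4)\mid u^{-1}\theta(u)\in Z\}$ (the normaliser of $SO(4)$ in $SU(4)$). $X=SU(4)/K$ is a Riemannian globally symmetric space. Two point pairs $(x,y)$, $(x',y')$ of points of $X$ are congruent under a group $G$ acting on $X$ if some $g\in G$ satisfies $gx=x'$, $gy=y'$. *)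

theory Defs
  imports "HOL-Analysis.Analysis"
begin

section \<open>Quotient topologies\<close>

definition quot_topology :: "'a topology \<Rightarrow> ('a \<times> 'a) set \<Rightarrow> 'a set topology" where
  "quot_topology T r = topology (\<lambda>W. W \<subseteq> topspace T // r \<and> openin T (\<Union>W))"

text \<open>For an equivalence relation \<open>r\<close> on \<open>topspace T\<close>, the family of sets above is indeed
  a topology, and it is the quotient topology.\<close>

lemma openin_quot_topology:
  assumes "equiv (topspace T) r"
  shows "openin (quot_topology T r) W \<longleftrightarrow> W \<subseteq> topspace T // r \<and> openin T (\<Union>W)"
proof -
  have "istopology (\<lambda>W. W \<subseteq> topspace T // r \<and> openin T (\<Union>W))"
    unfolding istopology_def
  proof (intro conjI allI impI)
    fix V W
    assume V: "V \<subseteq> topspace T // r \<and> openin T (\<Union>V)"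
      and W: "W \<subseteq> topspace T // r \<and> openin T (\<Union>W)"
    show "V \<inter> W \<subseteq> topspace T // r" using V by blast
    have "\<Union>(V \<inter> W) = \<Union>V \<inter> \<Union>W"
    proof
      show "\<Union>V \<inter> \<Union>W \<subseteq> \<Union>(V \<inter> W)"
      proof
        fix x assume "x \<in> \<Union>V \<inter> \<Union>W"
        then obtain A B where "A \<in> V" "x \<in> A" "B \<in> W" "x \<in> B" by blast
        moreover from this have "A = B" using quotient_disj[OF assms] V W by blast
        ultimately show "x \<in> \<Union>(V \<inter> W)" by blast
      qed
    qed blast
    then show "openin T (\<Union>(V \<inter> W))" using V W by auto
  next
    fix \<W>
    assume *: "\<forall>W\<in>\<W>. W \<subseteq> topspace T // r \<and> openin T (\<Union>W)"
    then show "\<Union>\<W> \<subseteq> topspace T // r" by blast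
    have "\<Union>(\<Union>\<W>) = \<Union>(Union ` \<W>)" by blast
    with * show "openin T (\<Union>(\<Union>\<W>))" by auto
  qed
  then show ?thesis by (simp add: quot_topology_def topology_inverse')
qed

lemma topspace_quot_topology:
  assumes "equiv (topspace T) r"
  shows "topspace (quot_topology T r) = topspace T // r"
proof -
  have "openin (quot_topology T r) (topspace T // r)"
    by (simp add: openin_quot_topology[OF assms] Union_quotient[OF assms])
  then show ?thesis
    using openin_subset openin_topspace openin_quot_topology[OF assms] by blast
qed

lemma quotient_map_quot_topology:
  assumes "equiv (topspace T) r"
  shows "quotient_map T (quot_topology T r) (\<lambda>x. r `` {x})"
  unfolding quotient_map_def
proof (intro conjI allI impI)
  show "(\<lambda>x. r `` {x}) ` topspace T = topspace (quot_topology T r)"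
    by (auto simp: topspace_quot_topology[OF assms] quotient_def)
  fix W assume "W \<subseteq> topspace (quot_topology T r)"
  then have W: "W \<subseteq> topspace T // r" by (simp add: topspace_quot_topology[OF assms])
  have "{x \<in> topspace T. r `` {x} \<in> W} = \<Union>W"
  proof (intro equalityI subsetI)
    fix x assume "x \<in> {x \<in> topspace T. r `` {x} \<in> W}"
    then show "x \<in> \<Union>W" using equiv_class_self[OF assms] by blast
  next
    fix x assume "x \<in> \<Union>W"
    then obtain A where A: "A \<in> W" "x \<in> A" by blast
    then have "A \<in> topspace T // r" using W by blast
    then obtain y where y: "y \<in> topspace T" "A = r `` {y}" by (auto elim: quotientE)
    then have "(y, x) \<in> r" using A by simp
    then have "r `` {x} = A" "x \<in> topspace T"
      using y equiv_class_eq[OF assms] assms by (auto simp: equiv_def refl_on_def)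
    then show "x \<in> {x \<in> topspace T. r `` {x} \<in> W}" using A by simp
  qed
  then show "openin T {x \<in> topspace T. r `` {x} \<in> W} = openin (quot_topology T r) W"
    using W by (simp add: openin_quot_topology[OF assms])
qed


section \<open>Complex 4 by 4 matrices\<close>

type_synonym cmat = "complex^4^4"

definition cnj_mat :: "cmat \<Rightarrow> cmat" where
  "cnj_mat A = (\<chi> i j. cnj (A $ i $ j))"

definition adj :: "cmat \<Rightarrow> cmat" where
  "adj A = transpose (cnj_mat A)"

definition scal :: "complex \<Rightarrow> cmat \<Rightarrow> cmat" where
  "scal c A = (\<chi> i j. c * A $ i $ j)"

definition of_real_mat :: "real^4^4 \<Rightarrow> cmat" where
  "of_real_mat A = (\<chi> i j. complex_of_real (A $ i $ j))"


section \<open>The real moduli spaces\<close>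

definition sym_unitary :: "cmat set" where
  "sym_unitary = {L. transpose L = L \<and> invertible L \<and> adj L = matrix_inv L}"

text \<open>The two families of transformations are actions of groups and commute with each other, so the
  equivalence relation they generate is the orbit relation of the product group.\<close>

definition real_moduli_rel :: "(cmat \<times> cmat) set" where
  "real_moduli_rel = {(L, L'). L \<in> sym_unitary \<and> L' \<in> sym_unitary \<and>
     (\<exists>(\<phi>::real) (S::real^4^4). rotation_matrix S \<and>
        L' = scal (exp (- 2 * \<i> * complex_of_real \<phi>))
               (of_real_mat S ** L ** transpose (of_real_mat S)))}"

definition real_moduli :: "cmat set set" where
  "real_moduli = sym_unitary // real_moduli_rel"

definition real_moduli_topology :: "cmat set topology" where
  "real_moduli_topology = quot_topology (top_of_set sym_unitary) real_moduli_rel"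

text \<open>Inversion maps orbits to orbits, so it acts on \<^const>\<open>real_moduli\<close> by taking images.\<close>

definition unoriented_rel :: "(cmat set \<times> cmat set) set" where
  "unoriented_rel = {(p, q). p \<in> real_moduli \<and> q \<in> real_moduli \<and> (q = p \<or> q = matrix_inv ` p)}"

definition unoriented_moduli_topology :: "cmat set set topology" where
  "unoriented_moduli_topology = quot_topology real_moduli_topology unoriented_rel"


section \<open>The symmetric space\<close>

definition SU4 :: "cmat set" where
  "SU4 = {u. adj u ** u = mat 1 \<and> u ** adj u = mat 1 \<and> det u = 1}"

definition center_SU4 :: "cmat set" where
  "center_SU4 = {z \<in> SU4. \<forall>u\<in>SU4. z ** u = u ** z}"

definition stab_SU4 :: "cmat set" where
  "stab_SU4 = {u \<in> SU4. matrix_inv u ** cnj_mat u \<in> center_SU4}"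

definition coset :: "cmat \<Rightarrow> cmat set" where
  "coset u = (\<lambda>k. u ** k) ` stab_SU4"

definition sspace :: "cmat set set" where
  "sspace = coset ` SU4"

definition coset_rel :: "(cmat \<times> cmat) set" where
  "coset_rel = {(u, v). u \<in> SU4 \<and> v \<in> SU4 \<and> v \<in> coset u}"

text \<open>The points of this space are the elements of \<^const>\<open>sspace\<close>: the class of \<open>u\<close> under
  \<^const>\<open>coset_rel\<close> is \<^term>\<open>coset u\<close>.\<close>

definition sspace_topology :: "cmat set topology" where
  "sspace_topology = quot_topology (top_of_set SU4) coset_rel"

definition translation :: "cmat \<Rightarrow> cmat set \<Rightarrow> cmat set" where
  "translation g x = (\<lambda>h. g ** h) ` x"


subsection \<open>Smooth maps\<close>

primrec Ck_on :: "nat \<Rightarrow> 'a::real_normed_vector set \<Rightarrow> ('a \<Rightarrow> 'b::real_normed_vector) \<Rightarrow> bool" where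
  "Ck_on 0 U F \<longleftrightarrow> continuous_on U F"
| "Ck_on (Suc n) U F \<longleftrightarrow> (\<forall>x\<in>U. F differentiable (at x)) \<and>
     (\<forall>v. Ck_on n U (\<lambda>x. frechet_derivative F (at x) v))"

text \<open>The projection of \<open>SU(4)\<close> onto the symmetric space is a submersion, and \<open>SU(4)\<close> is a
  submanifold of the vector space of matrices. Hence a self-map \<open>f\<close> of the symmetric space is smooth
  iff locally \<open>u \<mapsto> f (u K)\<close> has the form \<open>u \<mapsto> F u K\<close> for a smooth map \<open>F\<close> on an open set of matrices
  that sends \<open>SU(4)\<close> to \<open>SU(4)\<close>.\<close>

definition local_lift :: "(cmat set \<Rightarrow> cmat set) \<Rightarrow> cmat set \<Rightarrow> (cmat \<Rightarrow> cmat) \<Rightarrow> bool" where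
  "local_lift f U F \<longleftrightarrow> open U \<and> (\<forall>n. Ck_on n U F) \<and>
     (\<forall>v\<in>U \<inter> SU4. F v \<in> SU4 \<and> f (coset v) = coset (F v))"

definition smooth_map :: "(cmat set \<Rightarrow> cmat set) \<Rightarrow> bool" where
  "smooth_map f \<longleftrightarrow> (\<forall>u\<in>SU4. \<exists>U F. u \<in> U \<and> local_lift f U F)"


subsection \<open>The Riemannian metric and its isometries\<close>

definition su4 :: "cmat set" where
  "su4 = {A. adj A = - A \<and> trace A = 0}"

text \<open>The component of \<open>A\<close> in the \<open>-1\<close> eigenspace \<open>\<pp>\<close> of the differential of the involution
  \<^const>\<open>cnj_mat\<close>; the \<open>+1\<close> eigenspace is the Lie algebra of \<^const>\<open>stab_SU4\<close>, so \<open>\<pp>\<close> is the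
  tangent space of the symmetric space at its base point.\<close>

definition horizontal :: "cmat \<Rightarrow> cmat" where
  "horizontal A = (1 / 2) *\<^sub>R (A - cnj_mat A)"

text \<open>The tangent space of \<open>SU(4)\<close> at \<open>u\<close> is \<open>{u A | A \<in> su(4)}\<close>. The following is the pullback to
  \<open>SU(4)\<close> of the \<open>SU(4)\<close>-invariant Riemannian metric of the symmetric space: at the base point it is
  \<open>-1/8\<close> times the Killing form on \<open>\<pp>\<close>. Invariant metrics on this space are unique up to a constant
  factor, which does not affect the isometries.\<close>

definition metric :: "cmat \<Rightarrow> cmat \<Rightarrow> cmat \<Rightarrow> real" where
  "metric u V W = - Re (trace (horizontal (matrix_inv u ** V) ** horizontal (matrix_inv u ** W)))"

definition isometry :: "(cmat set \<Rightarrow> cmat set) \<Rightarrow> bool" where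
  "isometry f \<longleftrightarrow> bij_betw f sspace sspace \<and> smooth_map f \<and> smooth_map (inv_into sspace f) \<and>
     (\<forall>U F. local_lift f U F \<longrightarrow>
        (\<forall>u\<in>U \<inter> SU4. \<forall>A\<in>su4. \<forall>B\<in>su4.
           metric (F u) (frechet_derivative F (at u) (u ** A)) (frechet_derivative F (at u) (u ** B))
           = metric u (u ** A) (u ** B)))"


subsection \<open>Congruence of point pairs\<close>

definition congruence ::
  "(cmat set \<Rightarrow> cmat set) set \<Rightarrow> ((cmat set \<times> cmat set) \<times> (cmat set \<times> cmat set)) set" where
  "congruence G = {((x, y), (x', y')). x \<in> sspace \<and> y \<in> sspace \<and> x' \<in> sspace \<and> y' \<in> sspace \<and>
     (\<exists>g\<in>G. g x = x' \<and> g y = y')}"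

definition point_pairs_topology ::
  "(cmat set \<Rightarrow> cmat set) set \<Rightarrow> (cmat set \<times> cmat set) set topology" where
  "point_pairs_topology G =
     quot_topology (prod_topology sspace_topology sspace_topology) (congruence G)"


subsection \<open>The canonical correspondence\<close>

text \<open>The symmetric space is the quotient of the space of symmetric unitary matrices by phases, with
  \<open>u K\<close> corresponding to \<open>u u\<^sup>t\<close>. Moving the first point of the pair \<open>(u K, v K)\<close> to the base
  point turns the pair into \<open>(K, u\<^sup>-\<^sup>1 v K)\<close>, whose second point is represented by this matrix.\<close>

definition pair_matrix :: "cmat \<Rightarrow> cmat \<Rightarrow> cmat" where
  "pair_matrix u v = (matrix_inv u ** v) ** transpose (matrix_inv u ** v)"

end

theory Submission
  imports Defs
begin

text \<open>
  A symmetric unitary matrix is diagonalised by a rotation, since its real and imaginary parts are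
  commuting symmetric matrices. Hence \<open>O(4)\<close> and \<open>SO(4)\<close> have the same orbits on these matrices, up
  to a phase each of them is \<open>u u\<^sup>t\<close> with \<open>u \<in> SU(4)\<close>, and \<open>u K\<close> is determined by \<open>u u\<^sup>t\<close> up to a phase.
  This gives the bijection with the classes of point pairs under \<open>SU(4)\<close>. Both sides are topological
  quotients of \<open>SU(4) \<times> SU(4)\<close>, so the bijection is a homeomorphism.

  For isometries one must show that every isometry maps a point pair to a pair that is
  \<open>SU(4)\<close>-congruent to it or to its complex conjugate. An isometry sends geodesics to geodesics: from
  the symmetry of the second derivatives of a lift one computes, as in the uniqueness proof for the
  Levi-Civita connection, that the image satisfies the geodesic equation. So the isometry is
  given by a linear isometry \<open>\<tau>\<close> of \<open>\<pp>\<close>, which preserves the vectors whose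
  exponential lies in \<open>K\<close>. The shortest nonzero ones are \<open>\<plusminus>\<i> \<pi> (w w\<^sup>t - 1/4)\<close> with \<open>w\<close> a unit vector, and
  by connectedness of the sphere the sign changes for all \<open>w\<close> or for none. Thus \<open>\<tau>\<close> or \<open>-\<tau>\<close> preserves
  rank one projections up to their trace, and therefore the spectrum. The sign \<open>-1\<close> corresponds to
  complex conjugation.
\<close>

subsection \<open>Matrix algebra\<close>

text \<open>Points of the symmetric space are handled through \<open>sq u\<close>, which a coset
  determines up to a fourth root of unity. Such a phase cannot vary along a connected curve, so
  equalities of cosets can be differentiated as equalities of matrices. This replaces charts: a lift
  of an isometry is not unique and follows a geodesic only modulo the stabiliser, but its squares
  satisfy a linear differential equation. Isometries are compared with \<open>SU4\<close> one pair
  of points at a time. The element of \<open>SU4\<close> may depend on the pair, so it suffices that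
  the differential preserves the spectrum of each vector up to one common sign. The minimal squared
  length 3/4 pi^2 arises when one eigenvalue is separated by pi from three equal ones; a split two
  against two already gives pi^2. On the topological side, \<open>pair_matrix\<close> has
  determinant one on \<open>SU4\<close> and so misses most symmetric unitary matrices; an extra
  phase makes it surjective.\<close>

lemma cnj_mat_nth [simp]: "cnj_mat A $ i $ j = cnj (A $ i $ j)"
  by (simp add: cnj_mat_def)

lemma scal_nth [simp]: "scal c A $ i $ j = c * A $ i $ j"
  by (simp add: scal_def)

lemma of_real_mat_nth [simp]: "of_real_mat A $ i $ j = complex_of_real (A $ i $ j)"
  by (simp add: of_real_mat_def)

lemma transpose_nth: "transpose A $ i $ j = A $ j $ i"
  by (simp add: transpose_def)

lemma matrix_mult_nth: "(A ** B) $ i $ j = (\<Sum>k\<in>UNIV. A $ i $ k * B $ k $ j)"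
  by (simp add: matrix_matrix_mult_def)

lemma mat_eqI:
  fixes A B :: "'a^'n^'m"
  shows "(\<And>i j. A $ i $ j = B $ i $ j) \<Longrightarrow> A = B"
  by (simp add: vec_eq_iff)

lemma mat_1_nth: "mat c $ i $ j = (if i = j then c else 0)"
  by (simp add: mat_def)

lemma cnj_mat_cnj_mat [simp]: "cnj_mat (cnj_mat A) = A"
  by (rule mat_eqI) simp

lemma cnj_mat_mult: "cnj_mat (A ** B) = cnj_mat A ** cnj_mat B"
  by (rule mat_eqI) (simp add: matrix_mult_nth)

lemma cnj_mat_mat_1 [simp]: "cnj_mat (mat 1) = mat 1"
  by (rule mat_eqI) (simp add: mat_1_nth)

lemma cnj_mat_transpose: "cnj_mat (transpose A) = transpose (cnj_mat A)"
  by (rule mat_eqI) (simp add: transpose_nth)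

lemma cnj_mat_scal: "cnj_mat (scal c A) = scal (cnj c) (cnj_mat A)"
  by (rule mat_eqI) simp

lemma cnj_mat_of_real_mat [simp]: "cnj_mat (of_real_mat A) = of_real_mat A"
  by (rule mat_eqI) simp

lemma transpose_scal: "transpose (scal c A) = scal c (transpose A)"
  by (rule mat_eqI) (simp add: transpose_nth)

lemma transpose_of_real_mat: "transpose (of_real_mat A) = of_real_mat (transpose A)"
  by (rule mat_eqI) (simp add: transpose_nth)

lemma of_real_mat_mult: "of_real_mat (A ** B) = of_real_mat A ** of_real_mat B"
  by (rule mat_eqI) (simp add: matrix_mult_nth)

lemma of_real_mat_mat_1 [simp]: "of_real_mat (mat 1) = mat 1"
  by (rule mat_eqI) (simp add: mat_1_nth)

lemma of_real_mat_inject: "of_real_mat A = of_real_mat B \<Longrightarrow> A = B"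
  by (simp add: vec_eq_iff)

lemma scal_mult_left: "scal c A ** B = scal c (A ** B)"
  by (rule mat_eqI) (simp add: matrix_mult_nth sum_distrib_left mult.assoc)

lemma scal_mult_right: "A ** scal c B = scal c (A ** B)"
  by (rule mat_eqI) (simp add: matrix_mult_nth sum_distrib_left mult_ac)

lemma scal_scal [simp]: "scal c (scal d A) = scal (c * d) A"
  by (rule mat_eqI) (simp add: mult_ac)

lemma scal_1 [simp]: "scal 1 A = A"
  by (rule mat_eqI) simp

lemma scal_cancel: "c \<noteq> 0 \<Longrightarrow> scal c A = scal c B \<Longrightarrow> A = B"
  by (simp add: vec_eq_iff)

lemma scal_mat_1_inject: "scal c (mat 1) = scal d (mat 1) \<Longrightarrow> c = d"
  by (drule arg_cong[of _ _ "\<lambda>A. A $ 1 $ 1"]) (simp add: mat_1_nth)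

lemma of_real_mat_eqI: "cnj_mat A = A \<Longrightarrow> \<exists>B. A = of_real_mat B"
  by (rule exI[of _ "\<chi> i j. Re (A $ i $ j)"]) (simp add: vec_eq_iff complex_eq_iff)

lemma adj_adj [simp]: "adj (adj A) = A"
  by (simp add: adj_def cnj_mat_transpose)

lemma adj_mult: "adj (A ** B) = adj B ** adj A"
  by (simp add: adj_def cnj_mat_mult matrix_transpose_mul)

lemma det_scal: "det (scal c A) = c ^ 4 * det A"
proof -
  have "scal c A = (\<chi> i. c *s A $ i)" by (simp add: vec_eq_iff)
  then show ?thesis using det_rows_mul[of "\<lambda>_. c" "\<lambda>i. A $ i"] by simp
qed

lemma det_cnj_mat: "det (cnj_mat A) = cnj (det A)"
  by (simp add: det_def cnj_sum cnj_prod)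

lemma det_of_real_mat: "det (of_real_mat A) = complex_of_real (det A)"
  by (simp add: det_def)

lemma det_adj: "det (adj A) = cnj (det A)"
  by (simp add: adj_def det_cnj_mat)

lemma trace_scal: "trace (scal c A) = c * trace A"
  by (simp add: trace_def sum_distrib_left)

lemma trace_cnj_mat: "trace (cnj_mat A) = cnj (trace A)"
  by (simp add: trace_def)

lemma trace_transpose: "trace (transpose A) = trace A"
  by (simp add: trace_def transpose_nth)

lemma bilinear_matrix_mult: "bilinear ((**) :: cmat \<Rightarrow> cmat \<Rightarrow> cmat)"
  unfolding bilinear_def
  by (auto intro!: linearI mat_eqI simp: matrix_mult_nth algebra_simps sum.distrib scaleR_sum_right)

lemma bounded_bilinear_matrix_mult: "bounded_bilinear ((**) :: cmat \<Rightarrow> cmat \<Rightarrow> cmat)"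
  using bilinear_matrix_mult bilinear_conv_bounded_bilinear by blast

interpretation mm: bounded_bilinear "(**) :: cmat \<Rightarrow> cmat \<Rightarrow> cmat"
  by (rule bounded_bilinear_matrix_mult)

lemma bounded_linear_transpose: "bounded_linear (transpose :: cmat \<Rightarrow> cmat)"
  unfolding linear_conv_bounded_linear[symmetric]
  by (auto intro!: linearI mat_eqI simp: transpose_nth)

lemma bounded_linear_cnj_mat: "bounded_linear cnj_mat"
  unfolding linear_conv_bounded_linear[symmetric]
  by (auto intro!: linearI mat_eqI)

lemma bounded_linear_adj: "bounded_linear adj"
  unfolding adj_def by (intro bounded_linear_compose[OF bounded_linear_transpose] bounded_linear_cnj_mat)

lemma bounded_linear_trace: "bounded_linear (trace :: cmat \<Rightarrow> complex)"
  unfolding linear_conv_bounded_linear[symmetric]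
  by (auto intro!: linearI simp: trace_def sum.distrib scaleR_sum_right)

lemma bounded_linear_scal: "bounded_linear (scal c)"
  unfolding linear_conv_bounded_linear[symmetric]
  by (auto intro!: linearI mat_eqI simp: algebra_simps)

lemma bounded_linear_horizontal: "bounded_linear horizontal"
  unfolding horizontal_def
  by (intro bounded_linear_const_scaleR bounded_linear_sub bounded_linear_ident bounded_linear_cnj_mat)

lemmas has_vector_derivative_mult_left = bounded_linear.has_vector_derivative[OF mm.bounded_linear_left]
lemmas has_vector_derivative_mult_right = bounded_linear.has_vector_derivative[OF mm.bounded_linear_right]
lemmas has_vector_derivative_transpose = bounded_linear.has_vector_derivative[OF bounded_linear_transpose]
lemmas has_vector_derivative_cnj_mat = bounded_linear.has_vector_derivative[OF bounded_linear_cnj_mat]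
lemmas has_vector_derivative_adj = bounded_linear.has_vector_derivative[OF bounded_linear_adj]
lemmas has_vector_derivative_scal = bounded_linear.has_vector_derivative[OF bounded_linear_scal]
lemmas has_vector_derivative_horizontal = bounded_linear.has_vector_derivative[OF bounded_linear_horizontal]
lemmas continuous_on_mm [continuous_intros] = mm.continuous_on
lemmas continuous_on_tp [continuous_intros] = bounded_linear.continuous_on[OF bounded_linear_transpose]
lemmas continuous_on_cn [continuous_intros] = bounded_linear.continuous_on[OF bounded_linear_cnj_mat]
lemmas continuous_on_ad [continuous_intros] = bounded_linear.continuous_on[OF bounded_linear_adj]
lemmas continuous_on_trc [continuous_intros] = bounded_linear.continuous_on[OF bounded_linear_trace]

lemma continuous_on_scal [continuous_intros]:
  "continuous_on S f \<Longrightarrow> continuous_on S g \<Longrightarrow> continuous_on S (\<lambda>x. scal (f x) (g x))"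
  unfolding scal_def by (intro continuous_intros)

lemma continuous_on_det [continuous_intros]:
  fixes f :: "'a::topological_space \<Rightarrow> cmat"
  shows "continuous_on S f \<Longrightarrow> continuous_on S (\<lambda>x. det (f x))"
  unfolding det_def by (intro continuous_intros)

subsection \<open>Unitary matrices\<close>

definition unitary :: "cmat \<Rightarrow> bool" where
  "unitary u \<longleftrightarrow> adj u ** u = mat 1"

text \<open>The last four equations match prefixes of products bracketed to the left, the form
  produced by \<open>matrix_mul_assoc\<close>, so simp can cancel adjacent factors inside long
  products.\<close>

lemma unitaryD:
  assumes "unitary u"
  shows "adj u ** u = mat 1" "u ** adj u = mat 1"
    "transpose u ** cnj_mat u = mat 1" "cnj_mat u ** transpose u = mat 1"
    "A ** adj u ** u = A" "A ** u ** adj u = A"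
    "A ** transpose u ** cnj_mat u = A" "A ** cnj_mat u ** transpose u = A"
proof -
  show 1: "adj u ** u = mat 1" using assms by (simp add: unitary_def)
  then show 2: "u ** adj u = mat 1" by (simp add: matrix_left_right_inverse)
  have "cnj_mat (adj u ** u) = mat 1" "cnj_mat (u ** adj u) = mat 1" using 1 2 by simp_all
  then show 3: "transpose u ** cnj_mat u = mat 1" and 4: "cnj_mat u ** transpose u = mat 1"
    by (simp_all add: cnj_mat_mult adj_def cnj_mat_transpose)
  show "A ** adj u ** u = A" "A ** u ** adj u = A"
    "A ** transpose u ** cnj_mat u = A" "A ** cnj_mat u ** transpose u = A"
    using 1 2 3 4 by (simp_all flip: matrix_mul_assoc)
qed

lemma unitary_mult: "unitary u \<Longrightarrow> unitary v \<Longrightarrow> unitary (u ** v)"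
  by (simp add: unitary_def adj_mult matrix_mul_assoc unitaryD)

lemma unitary_adj: "unitary u \<Longrightarrow> unitary (adj u)"
  by (simp add: unitary_def unitaryD)

lemma unitary_cnj: "unitary u \<Longrightarrow> unitary (cnj_mat u)"
  by (simp add: unitary_def unitaryD adj_def)

lemma unitary_transpose: "unitary u \<Longrightarrow> unitary (transpose u)"
  using unitary_cnj unitary_adj by (fastforce simp: adj_def)

lemma cmod_det_unitary:
  assumes "unitary u" shows "cmod (det u) = 1"
proof -
  have "det (adj u ** u) = 1" using assms by (simp add: unitary_def)
  then have "cnj (det u) * det u = 1" by (simp add: det_mul det_adj)
  then have "complex_of_real ((cmod (det u))\<^sup>2) = 1"
    by (simp only: complex_norm_square mult.commute)
  then have "(cmod (det u))\<^sup>2 = 1" by (simp only: of_real_eq_1_iff)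
  then show ?thesis by (simp add: power2_eq_1_iff) (use norm_ge_zero[of "det u"] in linarith)
qed

text \<open>\<open>matrix_inv\<close> is a Hilbert choice; a one-sided inverse of a square matrix is
  two-sided and therefore unique.\<close>

lemma matrix_inv_eqI:
  fixes A B :: "'a::field^'n^'n"
  assumes "A ** B = mat 1" shows "matrix_inv A = B"
proof -
  have inv: "A ** matrix_inv A = mat 1 \<and> matrix_inv A ** A = mat 1"
    unfolding matrix_inv_def
    by (rule someI[of _ B]) (simp add: assms matrix_left_right_inverse[THEN iffD1, OF assms])
  have "matrix_inv A = matrix_inv A ** (A ** B)" using assms by simp
  also have "\<dots> = (matrix_inv A ** A) ** B" by (rule matrix_mul_assoc)
  finally show ?thesis using inv by simp
qed

lemma matrix_inv_unitary: "unitary u \<Longrightarrow> matrix_inv u = adj u"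
  by (rule matrix_inv_eqI) (rule unitaryD)

lemma unitary_scal:
  assumes "unitary u" "cmod c = 1" shows "unitary (scal c u)"
proof -
  have "c * cnj c = 1"
    using assms(2) by (metis complex_norm_square of_real_1 one_power2)
  then show ?thesis
    using assms(1) by (simp add: unitary_def adj_def cnj_mat_scal transpose_scal scal_mult_left scal_mult_right)
qed

lemma SU4_iff: "u \<in> SU4 \<longleftrightarrow> unitary u \<and> det u = 1"
  using unitaryD by (auto simp: SU4_def unitary_def)

lemma SU4_unitary: "u \<in> SU4 \<Longrightarrow> unitary u"
  by (simp add: SU4_iff)

lemmas SU4D = unitaryD[OF SU4_unitary]

lemma SU4_mult: "u \<in> SU4 \<Longrightarrow> v \<in> SU4 \<Longrightarrow> u ** v \<in> SU4"
  by (simp add: SU4_iff unitary_mult det_mul)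

lemma SU4_adj: "u \<in> SU4 \<Longrightarrow> adj u \<in> SU4"
  by (simp add: SU4_iff unitary_adj det_adj)

lemma SU4_cnj: "u \<in> SU4 \<Longrightarrow> cnj_mat u \<in> SU4"
  by (simp add: SU4_iff unitary_cnj det_cnj_mat)

lemma SU4_transpose: "u \<in> SU4 \<Longrightarrow> transpose u \<in> SU4"
  by (simp add: SU4_iff unitary_transpose)

lemma SU4_mat_1: "mat 1 \<in> SU4"
  by (simp add: SU4_iff unitary_def adj_def)

lemma matrix_inv_SU4: "u \<in> SU4 \<Longrightarrow> matrix_inv u = adj u"
  by (simp add: matrix_inv_unitary SU4_unitary)

lemma unitary_of_real_mat: "orthogonal_matrix S \<Longrightarrow> unitary (of_real_mat S)"
  by (simp add: unitary_def adj_def transpose_of_real_mat of_real_mat_mult[symmetric] orthogonal_matrix)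

lemma SU4_of_real_mat: "rotation_matrix S \<Longrightarrow> of_real_mat S \<in> SU4"
  by (simp add: rotation_matrix_def SU4_iff unitary_of_real_mat det_of_real_mat)

lemma orthogonal_matrix_of_unitary: "unitary (of_real_mat S) \<Longrightarrow> orthogonal_matrix S"
  unfolding unitary_def adj_def orthogonal_matrix
  by (rule of_real_mat_inject) (simp add: transpose_of_real_mat of_real_mat_mult)

lemma unit_4th_root:
  assumes "cmod d = 1" shows "\<exists>c. cmod c = 1 \<and> c ^ 4 * d = 1"
proof -
  have t: "d = cis (Arg d)" using assms rcis_cmod_Arg[of d] by (simp add: rcis_def)
  show ?thesis
    by (rule exI[of _ "cis (- Arg d / 4)"], subst (2) t) (simp add: Complex.DeMoivre cis_mult)
qed

lemma unitary_scal_SU4: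
  assumes "unitary u" shows "\<exists>c. cmod c = 1 \<and> scal c u \<in> SU4"
  using unit_4th_root[OF cmod_det_unitary[OF assms]] assms
  by (auto simp: SU4_iff unitary_scal det_scal)

subsection \<open>Simultaneous diagonalisation by real orthogonal matrices\<close>

text \<open>A maximum \<open>v\<close> of the quadratic form on the unit sphere of \<open>V\<close>
  is an eigenvector: if the residual \<open>z\<close> were nonzero, moving from \<open>v\<close>
  towards \<open>z\<close> would gain to first order and lose only to second order.\<close>

lemma self_adjoint_eigenvector:
  fixes f :: "'a::euclidean_space \<Rightarrow> 'a"
  assumes V: "subspace V" "V \<noteq> {0}" and f: "linear f" "f ` V \<subseteq> V"
    and sa: "\<And>x y. f x \<bullet> y = x \<bullet> f y"
  obtains v c where "v \<in> V" "norm v = 1" "f v = c *\<^sub>R v"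
proof -
  define K where "K = sphere 0 1 \<inter> V"
  obtain w where w: "w \<in> V" "w \<noteq> 0" using V subspace_0 by blast
  have "w /\<^sub>R norm w \<in> K" using w V by (simp add: K_def subspace_scale)
  then have "K \<noteq> {}" by blast
  moreover have "compact K" unfolding K_def by (intro compact_Int_closed closed_subspace V) simp
  moreover have "continuous_on K (\<lambda>x. x \<bullet> f x)"
    using f by (intro continuous_intros linear_continuous_on linear_conv_bounded_linear[THEN iffD1])
  ultimately obtain v where v: "v \<in> K" "\<And>x. x \<in> K \<Longrightarrow> x \<bullet> f x \<le> v \<bullet> f v"
    using continuous_attains_sup by metis
  define c where "c = v \<bullet> f v"
  have vV: "v \<in> V" "v \<bullet> v = 1" using v by (auto simp: K_def dot_square_norm)
  have q: "x \<bullet> f x \<le> c * (x \<bullet> x)" if "x \<in> V" for x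
  proof (cases "x = 0")
    case False
    have "x /\<^sub>R norm x \<in> K" using that False V by (simp add: K_def subspace_scale)
    then have "(x /\<^sub>R norm x) \<bullet> f (x /\<^sub>R norm x) \<le> c" using v c_def by blast
    then have "(x \<bullet> f x) / (norm x)\<^sup>2 \<le> c"
      by (simp add: linear_cmul[OF f(1)] power2_eq_square field_simps)
    then show ?thesis using False by (simp add: dot_square_norm field_simps)
  qed simp
  define z where "z = f v - c *\<^sub>R v"
  have z: "z \<in> V" using vV f V by (auto simp: z_def intro: subspace_diff subspace_scale)
  have "z \<bullet> z = 0"
  proof (rule ccontr)
    assume nz: "z \<bullet> z \<noteq> 0"
    define b where "b = c * (z \<bullet> z) - z \<bullet> f z"
    \<comment> \<open>Any step with \<open>t * b < 2 * (z \<bullet> z)\<close> contradicts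
      maximality; adding 1 to \<open>b\<close> keeps the denominator positive.\<close>
    define t where "t = (z \<bullet> z) / (1 + b)"
    have b: "b \<ge> 0" using q[OF z] by (simp add: b_def)
    have t: "t > 0" using nz b by (simp add: t_def)
    have "v + t *\<^sub>R z \<in> V" using vV z V by (simp add: subspace_add subspace_scale)
    from q[OF this] have "(v + t *\<^sub>R z) \<bullet> (f v + t *\<^sub>R f z) \<le> c * ((v + t *\<^sub>R z) \<bullet> (v + t *\<^sub>R z))"
      by (simp add: linear_add[OF f(1)] linear_cmul[OF f(1)])
    moreover have vz: "v \<bullet> z = 0" using vV by (simp add: z_def c_def inner_diff_right)
    moreover have "z \<bullet> f v = z \<bullet> z"
    proof -
      have "f v = z + c *\<^sub>R v" by (simp add: z_def)
      then show ?thesis using vz by (simp add: inner_add_right inner_commute)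
    qed
    moreover have "v \<bullet> f z = z \<bullet> f v" using sa[of v z] by (simp add: inner_commute)
    ultimately have "2 * t * (z \<bullet> z) \<le> t * t * b"
      using vV by (simp add: b_def c_def[symmetric] algebra_simps inner_commute)
    then have "2 * (z \<bullet> z) \<le> t * b" using t by simp
    also have "t * b \<le> z \<bullet> z" using b by (simp add: t_def field_simps)
    finally show False using nz inner_ge_zero[of z] by linarith
  qed
  then show thesis using that[of v c] vV by (simp add: z_def norm_eq_1)
qed

text \<open>Since \<open>g\<close> commutes with \<open>f\<close>, it preserves each eigenspace of
  \<open>f\<close>, and an eigenvector of \<open>g\<close> is sought inside one of them.\<close>

lemma commuting_self_adjoint_eigenvector:
  fixes f g :: "'a::euclidean_space \<Rightarrow> 'a"
  assumes V: "subspace V" "V \<noteq> {0}" and f: "linear f" "f ` V \<subseteq> V" and g: "linear g" "g ` V \<subseteq> V"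
    and sa: "\<And>x y. f x \<bullet> y = x \<bullet> f y" "\<And>x y. g x \<bullet> y = x \<bullet> g y"
    and comm: "\<And>x. f (g x) = g (f x)"
  obtains v c d where "v \<in> V" "norm v = 1" "f v = c *\<^sub>R v" "g v = d *\<^sub>R v"
proof -
  obtain u c where u: "u \<in> V" "norm u = 1" "f u = c *\<^sub>R u"
    using self_adjoint_eigenvector[OF V f sa(1)] by metis
  define W where "W = {x \<in> V. f x = c *\<^sub>R x}"
  have "subspace W" using V f
    by (auto simp: W_def subspace_def linear_add linear_cmul linear_0 scaleR_add_right)
  moreover have "u \<in> W" "u \<noteq> 0" using u by (auto simp: W_def)
  moreover have "g ` W \<subseteq> W" using g comm by (auto simp: W_def linear_cmul)
  ultimately obtain v d where "v \<in> W" "norm v = 1" "g v = d *\<^sub>R v"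
    using self_adjoint_eigenvector[of W g] g(1) sa(2) by (metis singletonD)
  then show thesis using that by (auto simp: W_def)
qed

text \<open>Self-adjoint maps preserve the orthogonal complement of a common eigenvector, so the
  dimension can be lowered by one.\<close>

lemma commuting_self_adjoint_eigenbasis:
  fixes f g :: "'a::euclidean_space \<Rightarrow> 'a"
  assumes f: "linear f" and g: "linear g"
    and sa: "\<And>x y. f x \<bullet> y = x \<bullet> f y" "\<And>x y. g x \<bullet> y = x \<bullet> g y"
    and comm: "\<And>x. f (g x) = g (f x)"
  shows "subspace V \<Longrightarrow> f ` V \<subseteq> V \<Longrightarrow> g ` V \<subseteq> V \<Longrightarrow>
    \<exists>B\<subseteq>V. finite B \<and> card B = dim V \<and> pairwise orthogonal B \<and>
      (\<forall>b\<in>B. norm b = 1 \<and> (\<exists>c d. f b = c *\<^sub>R b \<and> g b = d *\<^sub>R b))"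
proof (induction "dim V" arbitrary: V)
  case 0
  then show ?case by (intro exI[of _ "{}"]) auto
next
  case (Suc n)
  then have "V \<noteq> {0}" by auto
  then obtain v c d where v: "v \<in> V" "norm v = 1" "f v = c *\<^sub>R v" "g v = d *\<^sub>R v"
    using commuting_self_adjoint_eigenvector[OF Suc(3) _ f Suc(4) g Suc(5) sa comm] by metis
  define W where "W = {y \<in> V. \<forall>x\<in>span {v}. orthogonal x y}"
  have Weq: "W = {y \<in> V. v \<bullet> y = 0}"
    by (auto simp: W_def orthogonal_def span_singleton)
  have "dim W + dim (span {v}) = dim V"
    unfolding W_def using v(1) Suc(3)
    using subspace_span span_minimal[of "{v}" V] by (intro dim_subspace_orthogonal_to_vectors) auto
  moreover have "dim (span {v}) = 1" using v(2) by (auto simp: dim_eq_card_independent)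
  ultimately have n: "n = dim W" using Suc(2) by simp
  have W: "subspace W" using Suc(3) by (auto simp: Weq subspace_def inner_add_right)
  have "f ` W \<subseteq> W" "g ` W \<subseteq> W"
    using Suc(4,5) v(3,4) sa by (auto simp: Weq sa[symmetric])
  from Suc(1)[OF n W this] obtain B where B: "B \<subseteq> W" "finite B" "card B = dim W"
    "pairwise orthogonal B" "\<forall>b\<in>B. norm b = 1 \<and> (\<exists>c d. f b = c *\<^sub>R b \<and> g b = d *\<^sub>R b)" by blast
  have "v \<notin> B" using B(1) v(2) by (auto simp: Weq norm_eq_1)
  moreover have "pairwise orthogonal (insert v B)"
    using B(1,4) by (auto simp: pairwise_insert Weq orthogonal_def inner_commute)
  ultimately show ?case
    using B v n Suc(2) by (intro exI[of _ "insert v B"]) (auto simp: Weq)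
qed

section \<open>Diagonal matrices and their conjugates by real orthogonal matrices\<close>

lemma prod_UNIV_4: "prod f (UNIV :: 4 set) = f 1 * f 2 * f 3 * (f 4 :: 'a::comm_monoid_mult)"
  unfolding UNIV_4 by (simp add: mult.assoc)

definition diagm :: "('n \<Rightarrow> 'a::zero) \<Rightarrow> 'a^'n^'n" where
  "diagm d = (\<chi> i j. if i = j then d i else 0)"

lemma diagm_nth: "diagm d $ i $ j = (if i = j then d i else 0)"
  by (simp add: diagm_def)

lemma mult_diagm_nth: "(A ** diagm d) $ i $ j = A $ i $ j * d j"
  for A :: "'a::semiring_1^'n^'m"
  by (simp add: matrix_mult_nth diagm_nth if_distrib[of "\<lambda>x. _ * x"] cong: if_cong)

lemma diagm_mult_nth: "(diagm d ** A) $ i $ j = d i * A $ i $ j"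
  for A :: "'a::semiring_1^'n^'m"
  by (simp add: matrix_mult_nth diagm_nth if_distrib[of "\<lambda>x. x * _"] cong: if_cong)

lemma diagm_mult: "diagm c ** diagm d = diagm (\<lambda>i. c i * d i :: 'a::semiring_1)"
  by (rule mat_eqI) (simp add: mult_diagm_nth diagm_nth)

lemma diagm_1: "diagm (\<lambda>_. 1) = mat 1"
  by (rule mat_eqI) (simp add: diagm_nth mat_1_nth)

lemma transpose_diagm [simp]: "transpose (diagm d) = diagm d"
  by (rule mat_eqI) (auto simp add: diagm_nth transpose_nth)

lemma cnj_mat_diagm: "cnj_mat (diagm d) = diagm (\<lambda>i. cnj (d i))"
  by (rule mat_eqI) (auto simp add: diagm_nth)

lemma scal_diagm: "scal c (diagm d) = diagm (\<lambda>i. c * d i)"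
  by (rule mat_eqI) (auto simp add: diagm_nth)

lemma trace_diagm: "trace (diagm d) = sum d UNIV"
  by (simp add: trace_def diagm_nth)

lemma det_diagm: "det (diagm d :: cmat) = prod d UNIV"
  by (subst det_diagonal) (simp_all add: diagm_nth)

text \<open>In this form transposition does nothing and complex conjugation acts on \<open>d\<close>
  alone. For orthogonal \<open>S\<close>, products and determinants reduce to those of the
  eigenvalues.\<close>

definition rdiag :: "real^4^4 \<Rightarrow> (4 \<Rightarrow> complex) \<Rightarrow> cmat" where
  "rdiag S d = of_real_mat S ** diagm d ** transpose (of_real_mat S)"

abbreviation idiag :: "real^4^4 \<Rightarrow> (4 \<Rightarrow> real) \<Rightarrow> cmat" where
  "idiag S x \<equiv> rdiag S (\<lambda>i. \<i> * complex_of_real (x i))"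

lemma orthogonal_of_real_mat:
  assumes "orthogonal_matrix S"
  shows "transpose (of_real_mat S) ** of_real_mat S = mat 1"
    "of_real_mat S ** transpose (of_real_mat S) = mat 1"
    "A ** transpose (of_real_mat S) ** of_real_mat S = A"
    "A ** of_real_mat S ** transpose (of_real_mat S) = A"
  using unitaryD[OF unitary_of_real_mat[OF assms]] by simp_all

lemma rdiag_nth: "rdiag S d $ i $ j = (\<Sum>k\<in>UNIV. of_real (S $ i $ k * S $ j $ k) * d k)"
  by (simp add: rdiag_def matrix_mult_nth[of _ "transpose _"] mult_diagm_nth transpose_nth mult_ac)

lemma rdiag_mult: "orthogonal_matrix S \<Longrightarrow> rdiag S c ** rdiag S d = rdiag S (\<lambda>i. c i * d i)"
  by (simp add: rdiag_def matrix_mul_assoc orthogonal_of_real_mat)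
     (simp add: matrix_mul_assoc[symmetric] diagm_mult[symmetric])

lemma rdiag_1: "orthogonal_matrix S \<Longrightarrow> rdiag S (\<lambda>_. 1) = mat 1"
  by (simp add: rdiag_def diagm_1 orthogonal_of_real_mat)

lemma transpose_rdiag: "transpose (rdiag S d) = rdiag S d"
  by (simp add: rdiag_def matrix_transpose_mul matrix_mul_assoc)

lemma cnj_mat_rdiag: "cnj_mat (rdiag S d) = rdiag S (\<lambda>i. cnj (d i))"
  by (simp add: rdiag_def cnj_mat_mult cnj_mat_transpose cnj_mat_diagm)

lemma scal_rdiag: "scal c (rdiag S d) = rdiag S (\<lambda>i. c * d i)"
  by (simp add: rdiag_def scal_diagm[symmetric] scal_mult_left scal_mult_right)

lemma trace_rdiag: "orthogonal_matrix S \<Longrightarrow> trace (rdiag S d) = sum d UNIV"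
  by (simp add: rdiag_def trace_mul_sym[of _ "transpose _"] matrix_mul_assoc orthogonal_of_real_mat trace_diagm)

lemma det_rdiag: "orthogonal_matrix S \<Longrightarrow> det (rdiag S d) = prod d UNIV"
proof -
  assume S: "orthogonal_matrix S"
  have "det (transpose (of_real_mat S) ** of_real_mat S) = 1"
    by (simp add: orthogonal_of_real_mat[OF S])
  then show ?thesis by (simp add: rdiag_def det_mul det_diagm mult_ac)
qed

lemma rdiag_conj:
  assumes "orthogonal_matrix S"
  shows "transpose (of_real_mat S) ** rdiag S d ** of_real_mat S = diagm d"
  using assms by (simp add: rdiag_def matrix_mul_assoc orthogonal_of_real_mat)

lemma rdiag_inject: "orthogonal_matrix S \<Longrightarrow> rdiag S c = rdiag S d \<Longrightarrow> c = d"
proof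
  fix i assume "orthogonal_matrix S" "rdiag S c = rdiag S d"
  then have "diagm c = diagm d" by (simp flip: rdiag_conj)
  then show "c i = d i" by (simp add: vec_eq_iff diagm_nth) (metis (full_types))
qed

lemma cnj_mult_self_eq_1: "cnj z * z = 1 \<longleftrightarrow> cmod z = 1"
proof -
  have "cnj z * z = complex_of_real ((cmod z)\<^sup>2)" by (simp only: complex_norm_square mult.commute)
  then have "cnj z * z = 1 \<longleftrightarrow> (cmod z)\<^sup>2 = 1" by (simp only: of_real_eq_1_iff)
  then show ?thesis using norm_ge_zero[of z] by (auto simp: power2_eq_1_iff)
qed

lemma unitary_rdiag: "orthogonal_matrix S \<Longrightarrow> unitary (rdiag S d) \<longleftrightarrow> (\<forall>i. cmod (d i) = 1)"
proof -
  assume S: "orthogonal_matrix S"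
  have "unitary (rdiag S d) \<longleftrightarrow> rdiag S (\<lambda>i. cnj (d i) * d i) = rdiag S (\<lambda>_. 1)"
    by (simp only: unitary_def adj_def cnj_mat_rdiag transpose_rdiag rdiag_mult[OF S] rdiag_1[OF S])
  also have "\<dots> \<longleftrightarrow> (\<lambda>i. cnj (d i) * d i) = (\<lambda>_. 1)" using rdiag_inject[OF S] by auto
  also have "\<dots> \<longleftrightarrow> (\<forall>i. cmod (d i) = 1)"
    by (simp add: fun_eq_iff cnj_mult_self_eq_1)
  finally show ?thesis .
qed

text \<open>Negating one column of \<open>S\<close> changes the sign of the determinant, while the
  entries of \<open>rdiag S d\<close> are quadratic in each column.\<close>

lemma rdiag_rotation:
  assumes "orthogonal_matrix S"
  obtains S' where "rotation_matrix S'" "rdiag S' = rdiag S"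
proof (cases "det S = 1")
  case True
  then show thesis using assms that[of S] by (simp add: rotation_matrix_def)
next
  case False
  then have d: "det S = -1" using det_orthogonal_matrix[OF assms] by blast
  define e :: "4 \<Rightarrow> real" where "e k = (if k = 1 then -1 else 1)" for k
  have ee: "e k * e k = 1" for k by (simp add: e_def)
  define S' where "S' = S ** diagm e"
  have "transpose S ** S = mat 1" using assms by (simp add: orthogonal_matrix)
  then have "A ** transpose S ** S = A" for A :: "real^4^4" by (simp flip: matrix_mul_assoc)
  then have "transpose S' ** S' = diagm e ** diagm e"
    by (simp add: S'_def matrix_transpose_mul matrix_mul_assoc)
  then have "orthogonal_matrix S'" by (simp add: orthogonal_matrix diagm_mult ee diagm_1)
  moreover have "det (diagm e) = -1"
    by (subst det_diagonal) (simp_all add: diagm_nth e_def prod_UNIV_4)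
  then have "det S' = 1" by (simp add: S'_def det_mul d)
  moreover have "S' $ i $ k * S' $ j $ k = S $ i $ k * S $ j $ k" for i j k
    using ee[of k] by (simp add: S'_def mult_diagm_nth mult_ac)
  then have "rdiag S' = rdiag S" by (intro ext mat_eqI) (simp add: rdiag_nth)
  ultimately show thesis using that by (simp add: rotation_matrix_def)
qed

text \<open>Assuming normality covers both uses: symmetric unitary matrices and the elements of
  \<open>pp\<close>.\<close>

theorem symmetric_normal_diagonalisation:
  assumes sym: "transpose L = L" and normal: "L ** cnj_mat L = cnj_mat L ** L"
  obtains S d where "rotation_matrix S" "L = rdiag S d"
proof -
  define A :: "real^4^4" where "A = (\<chi> i j. Re (L $ i $ j))"
  define B :: "real^4^4" where "B = (\<chi> i j. Im (L $ i $ j))"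
  have symL: "L $ i $ j = L $ j $ i" for i j using sym by (metis transpose_nth)
  have tA: "transpose A = A" "transpose B = B"
    by (rule mat_eqI, simp add: A_def B_def transpose_nth symL)+
  have sa: "(A *v x) \<bullet> y = x \<bullet> (A *v y)" "(B *v x) \<bullet> y = x \<bullet> (B *v y)" for x y
    by (metis tA dot_lmul_matrix vector_transpose_matrix inner_commute)+
  have "A ** B = B ** A"
  proof (rule mat_eqI)
    fix i j
    \<comment> \<open>With L = A + \<i> B, the imaginary parts of the two products are BA - AB and
      AB - BA.\<close>
    have "Im ((L ** cnj_mat L) $ i $ j) = Im ((cnj_mat L ** L) $ i $ j)" using normal by simp
    then show "(A ** B) $ i $ j = (B ** A) $ i $ j"
      by (simp add: matrix_mult_nth A_def B_def sum_subtractf sum.distrib sum_negf)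
  qed
  then have comm: "A *v (B *v x) = B *v (A *v x)" for x
    by (simp add: matrix_vector_mul_assoc)
  have "\<exists>E\<subseteq>UNIV. finite E \<and> card E = dim (UNIV :: (real^4) set) \<and> pairwise orthogonal E \<and>
      (\<forall>b\<in>E. norm b = 1 \<and> (\<exists>c d. A *v b = c *\<^sub>R b \<and> B *v b = d *\<^sub>R b))"
    by (rule commuting_self_adjoint_eigenbasis) (auto simp: sa comm)
  then obtain E where E: "finite E" "card E = 4" "pairwise orthogonal E"
    "\<And>b. b \<in> E \<Longrightarrow> norm b = 1 \<and> (\<exists>c d. A *v b = c *\<^sub>R b \<and> B *v b = d *\<^sub>R b)"
    by (auto simp: dim_UNIV)
  then have "card (UNIV :: 4 set) = card E" by simp
  then obtain h :: "4 \<Rightarrow> real^4" where h: "bij_betw h UNIV E"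
    using finite_same_card_bij[OF finite E(1)] by blast
  define S :: "real^4^4" where "S = transpose (\<chi> i. h i)"
  have hE: "h i \<in> E" for i using h by (auto simp: bij_betw_def)
  have orth: "orthogonal_matrix S" unfolding S_def orthogonal_matrix_transpose
    unfolding orthogonal_matrix_orthonormal_rows
  proof (intro conjI allI impI)
    show "norm (row i (\<chi> i. h i)) = 1" for i using E(4)[OF hE] by (simp add: row_def vec_nth_inverse)
    fix i j :: 4 assume "i \<noteq> j"
    then have "h i \<noteq> h j" using h by (auto simp: bij_betw_def inj_eq)
    then show "orthogonal (row i (\<chi> i. h i)) (row j (\<chi> i. h i))"
      using E(3) hE by (simp add: pairwise_def row_def vec_nth_inverse)
  qed
  obtain c where c: "\<And>i. A *v h i = c i *\<^sub>R h i"
    using E(4)[OF hE] by metis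
  obtain d where d: "\<And>i. B *v h i = d i *\<^sub>R h i"
    using E(4)[OF hE] by metis
  define z where "z i = Complex (c i) (d i)" for i
  have "L ** of_real_mat S = of_real_mat S ** diagm z"
  proof (rule mat_eqI)
    fix i j
    have "(A *v h j) $ i = (c j *\<^sub>R h j) $ i" "(B *v h j) $ i = (d j *\<^sub>R h j) $ i"
      by (simp_all only: c d)
    then show "(L ** of_real_mat S) $ i $ j = (of_real_mat S ** diagm z) $ i $ j"
      unfolding mult_diagm_nth
      by (simp add: complex_eq_iff z_def matrix_vector_mult_def matrix_mult_nth A_def B_def S_def transpose_nth mult_ac)
  qed
  then have "L = rdiag S z"
    unfolding rdiag_def by (metis orthogonal_of_real_mat(4)[OF orth])
  then show thesis using rdiag_rotation[OF orth] that by metis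
qed

subsection \<open>Cosets\<close>

text \<open>For unitary \<open>u\<close> this is \<open>u\<close> times the inverse of its complex
  conjugate, that is, the Cartan map of the symmetric space.\<close>

definition sq :: "cmat \<Rightarrow> cmat" where
  "sq u = u ** transpose u"

lemma sq_mult: "sq (a ** b) = a ** sq b ** transpose a"
  by (simp add: sq_def matrix_transpose_mul matrix_mul_assoc)

lemma sq_scal: "sq (scal c a) = scal (c * c) (sq a)"
  by (simp add: sq_def transpose_scal scal_mult_left scal_mult_right)

lemma transpose_sq [simp]: "transpose (sq u) = sq u"
  by (simp add: sq_def matrix_transpose_mul)

lemma cnj_mat_sq: "cnj_mat (sq u) = sq (cnj_mat u)"
  by (simp add: sq_def cnj_mat_mult cnj_mat_transpose)

lemma sq_SU4: "u \<in> SU4 \<Longrightarrow> sq u \<in> SU4"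
  by (simp add: sq_def SU4_mult SU4_transpose)

lemma sq_of_real_mat: "orthogonal_matrix S \<Longrightarrow> sq (of_real_mat S) = mat 1"
  by (simp add: sq_def orthogonal_of_real_mat)

text \<open>The determinant leaves only finitely many possible phases between two elements of
  \<open>SU4\<close>; \<open>phase_constant\<close> rests on this.\<close>

lemma scal_SU4_root: "a \<in> SU4 \<Longrightarrow> scal c a \<in> SU4 \<Longrightarrow> c ^ 4 = 1 \<and> cmod c = 1"
proof -
  assume "a \<in> SU4" "scal c a \<in> SU4"
  then have 1: "c ^ 4 = 1" by (simp add: SU4_iff det_scal)
  then have "cmod c ^ 4 = 1 ^ 4" by (simp flip: norm_power)
  then have "cmod c = 1" by (subst (asm) power_eq_iff_eq_base) auto
  with 1 show ?thesis by simp
qed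

text \<open>Diagonal sign matrices kill the off-diagonal entries and transposition matrices equalise
  the diagonal ones. These test matrices may have determinant -1, so commutation is extended to all
  unitary matrices by rescaling.\<close>

lemma center_SU4_scalar:
  assumes "z \<in> center_SU4" obtains c where "z = scal c (mat 1)"
proof -
  have comm: "z ** u = u ** z" if u: "unitary u" for u
  proof -
    obtain c where c: "cmod c = 1" "scal c u \<in> SU4" using unitary_scal_SU4[OF u] by blast
    then have "z ** scal c u = scal c u ** z" using assms by (simp add: center_SU4_def)
    then have "scal c (z ** u) = scal c (u ** z)" by (simp only: scal_mult_left scal_mult_right)
    then show ?thesis using c(1) scal_cancel[of c "z ** u" "u ** z"] by fastforce
  qed
  have off: "z $ i $ j = 0" if "i \<noteq> j" for i j
  proof -
    define d :: "4 \<Rightarrow> complex" where "d k = (if k = i then -1 else 1)" for k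
    have "unitary (diagm d)"
      by (simp add: unitary_def adj_def cnj_mat_diagm diagm_mult d_def if_distrib if_distribR diagm_1 cong: if_cong)
    then have "(z ** diagm d) $ i $ j = (diagm d ** z) $ i $ j" using comm by simp
    then show ?thesis using that by (simp add: mult_diagm_nth diagm_mult_nth d_def)
  qed
  have diag: "z $ i $ i = z $ j $ j" for i j
  proof -
    define p where "p = Transposition.transpose i j"
    define P :: cmat where "P = (\<chi> a b. if b = p a then 1 else 0)"
    have pp: "p (p a) = a" for a by (simp add: p_def)
    have pe: "b = p a \<longleftrightarrow> a = p b" for a b using pp by metis
    have l: "(P ** A) $ a $ b = A $ p a $ b" for A a b
      by (simp add: matrix_mult_nth P_def if_distrib[of "\<lambda>x. x * _"] cong: if_cong)
    have r: "(A ** P) $ a $ b = A $ a $ p b" for A a b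
      by (simp add: matrix_mult_nth P_def if_distrib[of "\<lambda>x. _ * x"] pe[of b] cong: if_cong)
    have "transpose (cnj_mat P) = P" by (rule mat_eqI) (auto simp: transpose_nth P_def pp)
    then have "unitary P" unfolding unitary_def adj_def
      by (intro mat_eqI) (auto simp: l, auto simp: P_def pp mat_1_nth)
    then have "(z ** P) $ i $ j = (P ** z) $ i $ j" using comm by simp
    then show ?thesis by (simp add: l r) (simp add: p_def)
  qed
  have "z = scal (z $ 1 $ 1) (mat 1)"
    by (rule mat_eqI) (use off diag in \<open>auto simp: mat_1_nth\<close>)
  then show thesis by (rule that)
qed

lemma scalar_center_SU4: "scal c (mat 1) \<in> SU4 \<Longrightarrow> scal c (mat 1) \<in> center_SU4"
  by (simp add: center_SU4_def scal_mult_left scal_mult_right)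

text \<open>That \<open>adj u ** cnj_mat u\<close> is a scalar \<open>c\<close> means that
  \<open>cnj_mat u\<close> is \<open>c\<close> times \<open>u\<close>, or equivalently that
  \<open>u ** transpose u\<close> is the scalar \<open>cnj c\<close>.\<close>

lemma stab_SU4_iff: "u \<in> stab_SU4 \<longleftrightarrow> u \<in> SU4 \<and> (\<exists>c. sq u = scal c (mat 1))"
proof (intro iffI conjI)
  assume u: "u \<in> stab_SU4"
  then show S: "u \<in> SU4" by (simp add: stab_SU4_def)
  note U = SU4D[OF S]
  from u obtain c where c: "adj u ** cnj_mat u = scal c (mat 1)"
    by (auto simp: stab_SU4_def matrix_inv_SU4[OF S] elim: center_SU4_scalar)
  have "u ** (adj u ** cnj_mat u) ** transpose u = scal c (sq u)"
    by (simp add: c sq_def scal_mult_left scal_mult_right)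
  then have 1: "mat 1 = scal c (sq u)" by (simp add: matrix_mul_assoc U)
  have "cmod c = 1" using scal_SU4_root[OF sq_SU4[OF S]] 1 SU4_mat_1 by metis
  then have "scal (cnj c) (mat 1) = sq u"
    using 1 cnj_mult_self_eq_1[of c] by simp
  then show "\<exists>c. sq u = scal c (mat 1)" by metis
next
  assume "u \<in> SU4 \<and> (\<exists>c. sq u = scal c (mat 1))"
  then obtain c where S: "u \<in> SU4" and c: "sq u = scal c (mat 1)" by blast
  note U = SU4D[OF S]
  have "cmod c = 1" using scal_SU4_root[OF SU4_mat_1] c sq_SU4[OF S] by metis
  then have cc: "cnj c * c = 1" by (simp add: cnj_mult_self_eq_1)
  have "adj u ** cnj_mat u = scal (cnj c) (adj u ** sq u ** cnj_mat u)"
    by (simp add: c scal_mult_left scal_mult_right cc)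
  also have "\<dots> = scal (cnj c) (mat 1)" by (simp add: sq_def matrix_mul_assoc U)
  finally have e: "adj u ** cnj_mat u = scal (cnj c) (mat 1)" .
  moreover have "adj u ** cnj_mat u \<in> SU4" using S by (simp add: SU4_mult SU4_adj SU4_cnj)
  ultimately show "u \<in> stab_SU4"
    using S scalar_center_SU4 by (simp add: stab_SU4_def matrix_inv_SU4)
qed

text \<open>\<open>sq (u ** k)\<close> equals \<open>u ** sq k ** transpose u\<close>, and within
  \<open>SU4\<close> the matrix \<open>sq k\<close> is scalar exactly on the stabiliser.\<close>

lemma in_coset_iff:
  assumes u: "u \<in> SU4"
  shows "v \<in> coset u \<longleftrightarrow> v \<in> SU4 \<and> (\<exists>c. sq v = scal c (sq u))"
proof (intro iffI conjI)
  assume "v \<in> coset u"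
  then obtain k where k: "k \<in> stab_SU4" "v = u ** k" by (auto simp: coset_def)
  then show "v \<in> SU4" using u by (simp add: stab_SU4_iff SU4_mult)
  from k obtain c where "sq k = scal c (mat 1)" by (auto simp: stab_SU4_iff)
  then have "sq v = scal c (sq u)"
    by (simp add: k sq_mult scal_mult_left scal_mult_right) (simp add: sq_def)
  then show "\<exists>c. sq v = scal c (sq u)" by blast
next
  note U = SU4D[OF u]
  assume "v \<in> SU4 \<and> (\<exists>c. sq v = scal c (sq u))"
  then obtain c where v: "v \<in> SU4" and c: "sq v = scal c (sq u)" by blast
  have "sq (adj u ** v) = scal c (sq (adj u ** u))"
    by (simp only: sq_mult c scal_mult_left scal_mult_right)
  then have "sq (adj u ** v) = scal c (mat 1)" by (simp add: U) (simp add: sq_def)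
  then have "adj u ** v \<in> stab_SU4" using u v by (auto simp: stab_SU4_iff SU4_mult SU4_adj)
  moreover have "v = u ** (adj u ** v)" by (simp add: matrix_mul_assoc U)
  ultimately show "v \<in> coset u" by (auto simp: coset_def)
qed

lemma coset_self: "u \<in> SU4 \<Longrightarrow> u \<in> coset u"
  by (subst in_coset_iff) (auto intro: exI[of _ 1])

lemma coset_eq_iff:
  assumes u: "u \<in> SU4" and v: "v \<in> SU4"
  shows "coset u = coset v \<longleftrightarrow> (\<exists>c. sq v = scal c (sq u))"
proof
  assume "coset u = coset v"
  then show "\<exists>c. sq v = scal c (sq u)" using coset_self[OF v] in_coset_iff[OF u] by blast
next
  assume "\<exists>c. sq v = scal c (sq u)"
  then obtain c where c: "sq v = scal c (sq u)" by blast
  have "cmod c = 1" using scal_SU4_root[OF sq_SU4[OF u]] c sq_SU4[OF v] by metis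
  then have c': "sq u = scal (cnj c) (sq v)" using cnj_mult_self_eq_1[of c] by (simp add: c)
  show "coset u = coset v"
    by (auto simp: in_coset_iff u v) (metis c c' scal_scal)+
qed

lemma coset_eq_iff_in: "u \<in> SU4 \<Longrightarrow> v \<in> SU4 \<Longrightarrow> coset u = coset v \<longleftrightarrow> v \<in> coset u"
  by (simp add: coset_eq_iff in_coset_iff)

lemma coset_mult_cong:
  assumes "u \<in> SU4" "v \<in> SU4" "g \<in> SU4" "coset u = coset v"
  shows "coset (g ** u) = coset (g ** v)"
proof -
  obtain c where "sq v = scal c (sq u)" using assms by (auto simp: coset_eq_iff)
  then show ?thesis using assms
    by (auto simp: coset_eq_iff SU4_mult sq_mult scal_mult_left scal_mult_right intro!: exI[of _ c])
qed

lemma coset_cnj_cong: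
  assumes "u \<in> SU4" "v \<in> SU4" "coset u = coset v"
  shows "coset (cnj_mat u) = coset (cnj_mat v)"
proof -
  obtain c where "sq v = scal c (sq u)" using assms by (auto simp: coset_eq_iff)
  then have "sq (cnj_mat v) = scal (cnj c) (sq (cnj_mat u))"
    by (simp flip: cnj_mat_sq add: cnj_mat_scal)
  then show ?thesis using assms by (auto simp: coset_eq_iff SU4_cnj)
qed

lemma coset_mult_of_real_mat:
  assumes "u \<in> SU4" "rotation_matrix S" shows "coset (u ** of_real_mat S) = coset u"
proof -
  have "sq (u ** of_real_mat S) = sq u"
    using assms(2) by (simp add: sq_mult sq_of_real_mat rotation_matrix_def) (simp add: sq_def)
  then show ?thesis using assms by (auto simp: coset_eq_iff SU4_mult SU4_of_real_mat intro!: exI[of _ 1])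
qed

lemma translation_coset: "translation g (coset u) = coset (g ** u)"
  by (simp add: translation_def coset_def image_image matrix_mul_assoc)

lemma cnj_mat_stab_SU4: "cnj_mat ` stab_SU4 = stab_SU4"
proof -
  have *: "cnj_mat u \<in> stab_SU4" if u: "u \<in> stab_SU4" for u
  proof -
    obtain c where "sq u = scal c (mat 1)" using u by (auto simp: stab_SU4_iff)
    then have "sq (cnj_mat u) = scal (cnj c) (mat 1)"
      by (simp flip: cnj_mat_sq add: cnj_mat_scal)
    then show ?thesis using u by (auto simp: stab_SU4_iff SU4_cnj)
  qed
  then show ?thesis by (force simp: image_iff intro!: bexI[of _ "cnj_mat _"])
qed

lemma cnj_mat_coset: "cnj_mat ` coset u = coset (cnj_mat u)"
proof -
  have "cnj_mat ` coset u = (\<lambda>k. cnj_mat u ** k) ` cnj_mat ` stab_SU4"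
    by (simp add: coset_def image_image cnj_mat_mult)
  then show ?thesis by (simp only: cnj_mat_stab_SU4 coset_def)
qed

text \<open>After a phase is divided out, \<open>w\<close> is unitary with
  \<open>w ** transpose w = mat 1\<close>, so it equals its complex conjugate and is real. Its
  determinant may be -1, hence only orthogonality of \<open>S\<close>.\<close>

lemma stab_form:
  assumes u: "u \<in> SU4" and c: "sq u = scal c (mat 1)"
  obtains b S where "cmod b = 1" "orthogonal_matrix S" "u = scal b (of_real_mat S)"
proof -
  have c1: "cmod c = 1" using scal_SU4_root[OF SU4_mat_1] c sq_SU4[OF u] by metis
  \<comment> \<open>A square root, since \<open>sq\<close> multiplies by the square of a scalar
    factor.\<close>
  define b where "b = csqrt c"
  have b: "b * b = c" by (simp add: b_def flip: power2_eq_square)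
  have b1: "cmod b = 1" using c1 by (simp add: b_def)
  define w where "w = scal (cnj b) u"
  have w: "unitary w" using u b1 by (simp add: w_def unitary_scal SU4_unitary)
  have bb: "b * cnj b = 1" "cnj b * b = 1" using cnj_mult_self_eq_1[of b] b1 by (simp_all add: mult.commute)
  have "cnj b * cnj b * c = 1" unfolding b[symmetric] using bb by (simp add: mult_ac)
  then have "w ** transpose w = mat 1"
    using c by (simp add: w_def sq_scal flip: sq_def)
  then have "transpose w ** w = mat 1" by (rule matrix_left_right_inverse[THEN iffD1])
  then have "cnj_mat w = cnj_mat w ** (transpose w ** w)" by simp
  also have "\<dots> = w" by (simp add: matrix_mul_assoc unitaryD[OF w])
  finally obtain S where S: "w = of_real_mat S" using of_real_mat_eqI by blast
  have "u = scal b (of_real_mat S)" by (simp add: S[symmetric] w_def bb)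
  moreover have "orthogonal_matrix S" using w by (simp add: S orthogonal_matrix_of_unitary)
  ultimately show thesis using that b1 by blast
qed

subsection \<open>The equivalence relation of the real moduli space\<close>

lemma sym_unitary_iff: "L \<in> sym_unitary \<longleftrightarrow> transpose L = L \<and> unitary L"
proof
  assume L: "L \<in> sym_unitary"
  then obtain B where B: "L ** B = mat 1" by (auto simp: sym_unitary_def invertible_def)
  then have "adj L = B" using L matrix_inv_eqI[OF B] by (simp add: sym_unitary_def)
  then show "transpose L = L \<and> unitary L"
    using B L by (simp add: sym_unitary_def unitary_def matrix_left_right_inverse)
next
  assume "transpose L = L \<and> unitary L"
  then show "L \<in> sym_unitary"
    using unitaryD(1,2)[of L] by (auto simp: sym_unitary_def matrix_inv_unitary invertible_def)
qed

lemma matrix_inv_sym_unitary: "L \<in> sym_unitary \<Longrightarrow> matrix_inv L = cnj_mat L"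
  by (simp add: sym_unitary_iff matrix_inv_unitary adj_def flip: cnj_mat_transpose)

lemma cnj_mat_sym_unitary: "L \<in> sym_unitary \<Longrightarrow> cnj_mat L \<in> sym_unitary"
  by (simp add: sym_unitary_iff unitary_cnj flip: cnj_mat_transpose)

lemma sq_sym_unitary: "unitary u \<Longrightarrow> sq u \<in> sym_unitary"
  by (simp add: sym_unitary_iff) (simp add: sq_def unitary_mult unitary_transpose)

lemma sym_unitary_diagonalisation:
  assumes "L \<in> sym_unitary"
  obtains S d where "rotation_matrix S" "L = rdiag S d" "\<And>i. cmod (d i) = 1"
proof -
  have "cnj_mat L = adj L" using assms by (simp add: sym_unitary_iff adj_def flip: cnj_mat_transpose)
  then have "L ** cnj_mat L = cnj_mat L ** L"
    using assms by (simp add: sym_unitary_iff unitaryD)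
  then obtain S d where S: "rotation_matrix S" "L = rdiag S d"
    using assms symmetric_normal_diagonalisation unfolding sym_unitary_iff by metis
  moreover have "cmod (d i) = 1" for i
    using assms S unitary_rdiag[of S d] by (simp add: sym_unitary_iff rotation_matrix_def)
  ultimately show thesis by (rule that)
qed

abbreviation rconj :: "real^4^4 \<Rightarrow> cmat \<Rightarrow> cmat" where
  "rconj S L \<equiv> of_real_mat S ** L ** transpose (of_real_mat S)"

lemma rdiag_mult_of_real_mat:
  "rconj S (rdiag T d) = rdiag (S ** T) d"
  by (simp add: rdiag_def of_real_mat_mult matrix_transpose_mul matrix_mul_assoc)

text \<open>To trade an orthogonal \<open>S\<close> for a rotation, write \<open>L\<close> as
  \<open>rdiag T d\<close> and choose a rotation \<open>R\<close> with
  \<open>rdiag R = rdiag (S ** T)\<close>; then the rotation \<open>R ** transpose T\<close> moves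
  \<open>L\<close> to the same matrix as \<open>S\<close> does.\<close>

lemma real_moduli_rel_iff:
  "(L, L') \<in> real_moduli_rel \<longleftrightarrow> L \<in> sym_unitary \<and> L' \<in> sym_unitary \<and>
     (\<exists>c S. cmod c = 1 \<and> orthogonal_matrix S \<and> L' = scal c (rconj S L))"
proof (intro iffI conjI)
  assume r: "(L, L') \<in> real_moduli_rel"
  then show "L \<in> sym_unitary" "L' \<in> sym_unitary" by (auto simp: real_moduli_rel_def)
  have "exp (- 2 * \<i> * complex_of_real \<phi>) = cis (- 2 * \<phi>)" for \<phi> by (simp add: cis_conv_exp mult_ac)
  then have "cmod (exp (- 2 * \<i> * complex_of_real \<phi>)) = 1" for \<phi> by simp
  then show "\<exists>c S. cmod c = 1 \<and> orthogonal_matrix S \<and> L' = scal c (rconj S L)"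
    using r unfolding real_moduli_rel_def rotation_matrix_def by blast
next
  assume r: "L \<in> sym_unitary \<and> L' \<in> sym_unitary \<and>
     (\<exists>c S. cmod c = 1 \<and> orthogonal_matrix S \<and> L' = scal c (rconj S L))"
  then obtain c S where c: "cmod c = 1" and S: "orthogonal_matrix S"
    and L': "L' = scal c (rconj S L)" by blast
  obtain T d where T: "rotation_matrix T" "L = rdiag T d"
    using r sym_unitary_diagonalisation by metis
  have To: "orthogonal_matrix T" using T by (simp add: rotation_matrix_def)
  obtain R where R: "rotation_matrix R" "rdiag R = rdiag (S ** T)"
    using rdiag_rotation[of "S ** T"] orthogonal_matrix_mul[OF S To] by blast
  have "rotation_matrix (R ** transpose T)"
    using R(1) T(1) by (simp add: rotation_matrix_def orthogonal_matrix_mul det_mul)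
  moreover have "rconj (R ** transpose T) L =
      rdiag (R ** (transpose T ** T)) d"
    by (simp add: T(2) rdiag_mult_of_real_mat matrix_mul_assoc)
  then have "rconj (R ** transpose T) L = rdiag (S ** T) d"
    using To by (simp add: orthogonal_matrix R)
  moreover have "rconj S L = rdiag (S ** T) d"
    by (simp add: T(2) rdiag_mult_of_real_mat)
  moreover have "c = exp (- 2 * \<i> * complex_of_real (- Arg c / 2))"
    using c rcis_cmod_Arg[of c] by (simp add: rcis_def cis_conv_exp)
  ultimately have "rotation_matrix (R ** transpose T) \<and>
      L' = scal (exp (- 2 * \<i> * complex_of_real (- Arg c / 2)))
        (rconj (R ** transpose T) L)"
    using L' by simp
  then show "(L, L') \<in> real_moduli_rel"
    using r unfolding real_moduli_rel_def mem_Collect_eq case_prod_conv by blast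
qed

lemma equiv_real_moduli_rel: "equiv sym_unitary real_moduli_rel"
proof (rule equivI)
  show "real_moduli_rel \<subseteq> sym_unitary \<times> sym_unitary" by (auto simp: real_moduli_rel_iff)
  show "refl_on sym_unitary real_moduli_rel"
    by (auto simp: refl_on_def real_moduli_rel_iff orthogonal_matrix_id
        intro!: exI[of _ "1::complex"] exI[of _ "mat 1 :: real^4^4"])
  show "sym real_moduli_rel"
  proof (rule symI)
    fix L L' assume "(L, L') \<in> real_moduli_rel"
    then obtain c S where c: "L \<in> sym_unitary" "L' \<in> sym_unitary" "cmod c = 1" "orthogonal_matrix S"
      "L' = scal c (rconj S L)" unfolding real_moduli_rel_iff by blast
    have "L = scal (cnj c) (transpose (of_real_mat S) ** L' ** of_real_mat S)"
      using c(3) by (simp add: c(5) scal_mult_left scal_mult_right matrix_mul_assoc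
          orthogonal_of_real_mat[OF c(4)] cnj_mult_self_eq_1[THEN iffD2])
    then show "(L', L) \<in> real_moduli_rel" unfolding real_moduli_rel_iff using c
      by (intro conjI exI[of _ "cnj c"] exI[of _ "transpose S"]) (auto simp: transpose_of_real_mat)
  qed
  show "trans real_moduli_rel"
  proof (rule transI)
    fix L L' L'' assume "(L, L') \<in> real_moduli_rel" "(L', L'') \<in> real_moduli_rel"
    then obtain c S c' S' where c: "L \<in> sym_unitary" "L'' \<in> sym_unitary"
      "cmod c = 1" "orthogonal_matrix S" "L' = scal c (rconj S L)"
      "cmod c' = 1" "orthogonal_matrix S'" "L'' = scal c' (rconj S' L')"
      unfolding real_moduli_rel_iff by blast
    then show "(L, L'') \<in> real_moduli_rel" unfolding real_moduli_rel_iff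
      by (intro conjI exI[of _ "c' * c"] exI[of _ "S' ** S"])
        (auto simp: norm_mult orthogonal_matrix_mul of_real_mat_mult matrix_transpose_mul matrix_mul_assoc
          scal_mult_left scal_mult_right)
  qed
qed

lemma real_moduli_rel_cnj:
  assumes "(L, L') \<in> real_moduli_rel" shows "(cnj_mat L, cnj_mat L') \<in> real_moduli_rel"
proof -
  obtain c S where c: "L \<in> sym_unitary" "L' \<in> sym_unitary" "cmod c = 1" "orthogonal_matrix S"
    "L' = scal c (rconj S L)"
    using assms unfolding real_moduli_rel_iff by blast
  have "cnj_mat L' = scal (cnj c) (of_real_mat S ** cnj_mat L ** transpose (of_real_mat S))"
    by (simp add: c(5) cnj_mat_scal cnj_mat_mult cnj_mat_transpose)
  then show ?thesis unfolding real_moduli_rel_iff using c(1-4) cnj_mat_sym_unitary[OF c(1)] cnj_mat_sym_unitary[OF c(2)]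
    by (intro conjI exI[of _ "cnj c"] exI[of _ S]) simp_all
qed

text \<open>On symmetric unitary matrices inversion is entrywise complex conjugation, which respects
  the relation because the matrices acting are real.\<close>

lemma matrix_inv_real_moduli_class:
  assumes L: "L \<in> sym_unitary"
  shows "matrix_inv ` (real_moduli_rel `` {L}) = real_moduli_rel `` {cnj_mat L}"
proof (intro equalityI subsetI)
  fix M assume "M \<in> matrix_inv ` (real_moduli_rel `` {L})"
  then obtain N where N: "(L, N) \<in> real_moduli_rel" "M = matrix_inv N" by auto
  then have "M = cnj_mat N" by (auto simp: real_moduli_rel_iff matrix_inv_sym_unitary)
  then show "M \<in> real_moduli_rel `` {cnj_mat L}" using N real_moduli_rel_cnj by auto
next
  fix M assume "M \<in> real_moduli_rel `` {cnj_mat L}"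
  then have M: "(cnj_mat L, M) \<in> real_moduli_rel" by auto
  then have "(L, cnj_mat M) \<in> real_moduli_rel" using real_moduli_rel_cnj by fastforce
  moreover have "M = matrix_inv (cnj_mat M)"
    using M by (simp add: real_moduli_rel_iff matrix_inv_sym_unitary cnj_mat_sym_unitary)
  ultimately show "M \<in> matrix_inv ` (real_moduli_rel `` {L})" by blast
qed

lemma real_moduli_eq: "real_moduli = (\<lambda>L. real_moduli_rel `` {L}) ` sym_unitary"
  by (auto simp: real_moduli_def quotient_def)

lemma equiv_unoriented_rel: "equiv real_moduli unoriented_rel"
proof -
  have inv: "matrix_inv ` p \<in> real_moduli \<and> matrix_inv ` matrix_inv ` p = p" if p: "p \<in> real_moduli" for p
  proof -
    obtain L where L: "L \<in> sym_unitary" "p = real_moduli_rel `` {L}" using p unfolding real_moduli_eq by blast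
    then show ?thesis
      by (simp add: matrix_inv_real_moduli_class[OF L(1)] matrix_inv_real_moduli_class[OF cnj_mat_sym_unitary]
          real_moduli_eq cnj_mat_sym_unitary del: image_image)
  qed
  define J where "J p = matrix_inv ` p" for p :: "cmat set"
  have J: "J p \<in> real_moduli" "J (J p) = p" if "p \<in> real_moduli" for p
    using inv[OF that] by (simp_all only: J_def)
  have rel: "unoriented_rel = {(p, q). p \<in> real_moduli \<and> q \<in> real_moduli \<and> (q = p \<or> q = J p)}"
    by (simp only: unoriented_rel_def J_def)
  show ?thesis unfolding rel
    by (intro equivI) (auto simp: refl_on_def J intro!: symI transI)
qed

lemma unoriented_class_eq_iff:
  assumes "L \<in> sym_unitary" "M \<in> sym_unitary"
  shows "unoriented_rel `` {real_moduli_rel `` {L}} = unoriented_rel `` {real_moduli_rel `` {M}} \<longleftrightarrow>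
    (L, M) \<in> real_moduli_rel \<or> (cnj_mat L, M) \<in> real_moduli_rel"
proof -
  have R: "real_moduli_rel `` {N} \<in> real_moduli" if "N \<in> sym_unitary" for N
    using that by (auto simp: real_moduli_eq)
  have eq: "real_moduli_rel `` {N} = real_moduli_rel `` {M} \<longleftrightarrow> (N, M) \<in> real_moduli_rel"
    if "N \<in> sym_unitary" for N
    using eq_equiv_class_iff[OF equiv_real_moduli_rel that assms(2)] .
  have "unoriented_rel `` {real_moduli_rel `` {L}} = unoriented_rel `` {real_moduli_rel `` {M}} \<longleftrightarrow>
      (real_moduli_rel `` {L}, real_moduli_rel `` {M}) \<in> unoriented_rel"
    using eq_equiv_class_iff[OF equiv_unoriented_rel R R] assms by blast
  also have "\<dots> \<longleftrightarrow> real_moduli_rel `` {L} = real_moduli_rel `` {M} \<or>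
      real_moduli_rel `` {cnj_mat L} = real_moduli_rel `` {M}"
    using R assms by (auto simp: unoriented_rel_def matrix_inv_real_moduli_class)
  finally show ?thesis using eq assms cnj_mat_sym_unitary by simp
qed

subsection \<open>Congruence under the special unitary group\<close>

lemma pair_matrix_eq: "u \<in> SU4 \<Longrightarrow> pair_matrix u v = sq (adj u ** v)"
  by (simp add: pair_matrix_def sq_def matrix_inv_SU4)

lemma pair_matrix_sym_unitary: "u \<in> SU4 \<Longrightarrow> v \<in> SU4 \<Longrightarrow> pair_matrix u v \<in> sym_unitary"
  by (simp add: pair_matrix_eq sq_sym_unitary unitary_mult unitary_adj SU4_unitary)

lemma pair_matrix_cnj: "u \<in> SU4 \<Longrightarrow> pair_matrix (cnj_mat u) (cnj_mat v) = cnj_mat (pair_matrix u v)"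
  by (simp add: pair_matrix_eq SU4_cnj cnj_mat_sq cnj_mat_mult adj_def cnj_mat_transpose)

text \<open>The point \<open>coset u\<close> determines \<open>u\<close> only up to the stabiliser,
  whose elements are phases times real orthogonal matrices. Changing \<open>u\<close> by such an
  element acts on \<open>pair_matrix u v\<close> by a phase and a real orthogonal congruence, which
  is precisely the moduli relation.\<close>

lemma congruent_iff_pair_matrix:
  assumes u: "u \<in> SU4" and v: "v \<in> SU4" and u': "u' \<in> SU4" and v': "v' \<in> SU4"
  shows "(\<exists>g\<in>SU4. coset (g ** u) = coset u' \<and> coset (g ** v) = coset v') \<longleftrightarrow>
    (pair_matrix u v, pair_matrix u' v') \<in> real_moduli_rel"
proof
  assume "\<exists>g\<in>SU4. coset (g ** u) = coset u' \<and> coset (g ** v) = coset v'"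
  then obtain g a b where g: "g \<in> SU4" and a: "sq u' = scal a (sq (g ** u))"
    and b: "sq v' = scal b (sq (g ** v))"
    using assms by (auto simp: coset_eq_iff SU4_mult)
  note U = SU4D[OF u] and G = SU4D[OF g]
  have b1: "cmod b = 1" using scal_SU4_root[OF sq_SU4] b sq_SU4 g v v' SU4_mult by metis
  \<comment> \<open>The matrix comparing two representatives of the same point, hence an element of
    the stabiliser.\<close>
  define k where "k = adj (g ** u) ** u'"
  have kS: "k \<in> SU4" using g u u' by (simp add: k_def SU4_mult SU4_adj)
  have "sq k = scal a (adj (g ** u) ** (g ** u ** transpose (g ** u)) ** cnj_mat (g ** u))"
    by (simp add: k_def sq_mult[of _ u'] a scal_mult_left scal_mult_right)
       (simp add: sq_def adj_def cnj_mat_transpose)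
  also have "\<dots> = scal a (mat 1)"
    using SU4D[OF SU4_mult[OF g u]] by (simp add: matrix_mul_assoc)
  finally obtain c S where c: "cmod c = 1" "orthogonal_matrix S" "k = scal c (of_real_mat S)"
    using stab_form[OF kS] by metis
  have "adj k ** adj u ** adj g = adj u' ** (g ** u ** adj u ** adj g)"
    by (simp add: k_def adj_mult matrix_mul_assoc)
  then have e: "adj u' = adj k ** adj u ** adj g" by (simp add: G U)
  have "pair_matrix u' v' = adj u' ** sq v' ** transpose (adj u')"
    using u' by (simp add: pair_matrix_eq sq_mult)
  also have "\<dots> = scal b (sq (adj u' ** (g ** v)))"
    by (simp add: b scal_mult_left scal_mult_right) (simp add: sq_mult)
  also have "adj u' ** (g ** v) = adj k ** (adj u ** v)"
    by (simp add: e matrix_mul_assoc G)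
  also have "sq \<dots> = adj k ** pair_matrix u v ** transpose (adj k)"
    using u by (simp add: pair_matrix_eq sq_mult[of "adj k"])
  also have "scal b \<dots> = scal (b * (cnj c * cnj c)) (rconj (transpose S) (pair_matrix u v))"
    by (simp add: c(3) adj_def cnj_mat_scal transpose_scal transpose_of_real_mat scal_mult_left scal_mult_right)
  finally have "pair_matrix u' v' = scal (b * (cnj c * cnj c)) (rconj (transpose S) (pair_matrix u v))" .
  moreover have "cmod (b * (cnj c * cnj c)) = 1" using c b1 by (simp add: norm_mult)
  moreover have "orthogonal_matrix (transpose S)" using c by simp
  ultimately show "(pair_matrix u v, pair_matrix u' v') \<in> real_moduli_rel"
    unfolding real_moduli_rel_iff using assms pair_matrix_sym_unitary by blast
next
  assume "(pair_matrix u v, pair_matrix u' v') \<in> real_moduli_rel"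
  then obtain \<phi> S where S: "rotation_matrix S"
    and p: "pair_matrix u' v' = scal (exp (- 2 * \<i> * complex_of_real \<phi>))
       (rconj S (pair_matrix u v))" (is "_ = scal ?c _")
    unfolding real_moduli_rel_def by auto
  \<comment> \<open>This makes \<open>g ** u\<close> equal to \<open>u'\<close> times a rotation, so
    the first points match; the rotation of the moduli relation then matches the second
    ones.\<close>
  define g where "g = u' ** of_real_mat S ** adj u"
  have g: "g \<in> SU4" using u u' S by (simp add: g_def SU4_mult SU4_of_real_mat SU4_adj)
  note U = SU4D[OF u] and U' = SU4D[OF u']
  have "g ** u = u' ** of_real_mat S" by (simp add: g_def U)
  then have 1: "coset (g ** u) = coset u'" using u' S by (simp add: coset_mult_of_real_mat)
  have "sq v' = u' ** sq (adj u' ** v') ** transpose u'"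
    by (simp add: sq_mult[symmetric] matrix_mul_assoc U')
  also have "\<dots> = scal ?c (sq (u' ** (of_real_mat S ** (adj u ** v))))"
    using p u u' by (simp add: pair_matrix_eq sq_mult[of u'] sq_mult[of "of_real_mat S"] scal_mult_left scal_mult_right)
  also have "u' ** (of_real_mat S ** (adj u ** v)) = g ** v" by (simp add: g_def matrix_mul_assoc)
  finally have "coset (g ** v) = coset v'" using g v v' by (auto simp: coset_eq_iff SU4_mult)
  with 1 g show "\<exists>g\<in>SU4. coset (g ** u) = coset u' \<and> coset (g ** v) = coset v'" by blast
qed

section \<open>Real-linear operations on matrices\<close>

lemma cnj_mat_linear:
  "cnj_mat (A + B) = cnj_mat A + cnj_mat B" "cnj_mat (A - B) = cnj_mat A - cnj_mat B"
  "cnj_mat (- A) = - cnj_mat A" "cnj_mat (r *\<^sub>R A) = r *\<^sub>R cnj_mat A" "cnj_mat 0 = 0"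
  by (rule mat_eqI, simp)+

lemma transpose_linear:
  fixes A B :: cmat
  shows "transpose (A + B) = transpose A + transpose B" "transpose (A - B) = transpose A - transpose B"
    "transpose (- A) = - transpose A" "transpose (r *\<^sub>R A) = r *\<^sub>R transpose A" "transpose (0 :: cmat) = 0"
  by (rule mat_eqI, simp add: transpose_nth)+

lemma adj_linear:
  "adj (A + B) = adj A + adj B" "adj (A - B) = adj A - adj B"
  "adj (- A) = - adj A" "adj (r *\<^sub>R A) = r *\<^sub>R adj A" "adj 0 = 0"
  by (simp_all add: adj_def cnj_mat_linear transpose_linear)

lemma trace_linear:
  fixes A B :: cmat
  shows "trace (A + B) = trace A + trace B" "trace (A - B) = trace A - trace B"
    "trace (- A) = - trace A" "trace (r *\<^sub>R A) = r *\<^sub>R trace A" "trace (0 :: cmat) = 0"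
  by (simp_all add: trace_def sum.distrib sum_subtractf sum_negf scaleR_sum_right)

lemma horizontal_linear:
  "horizontal (A + B) = horizontal A + horizontal B" "horizontal (A - B) = horizontal A - horizontal B"
  "horizontal (- A) = - horizontal A" "horizontal (r *\<^sub>R A) = r *\<^sub>R horizontal A" "horizontal 0 = 0"
  by (simp_all add: horizontal_def cnj_mat_linear algebra_simps)

lemma scal_linear:
  "scal c (A + B) = scal c A + scal c B" "scal c (A - B) = scal c A - scal c B"
  "scal c (- A) = - scal c A" "scal c (r *\<^sub>R A) = r *\<^sub>R scal c A" "scal c 0 = 0"
  by (rule mat_eqI, simp add: algebra_simps)+

lemmas mult_linear = mm.add_left mm.add_right mm.diff_left mm.diff_right mm.minus_left mm.minus_right
  mm.scaleR_left mm.scaleR_right mm.zero_left mm.zero_right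

subsection \<open>One-parameter subgroups\<close>

text \<open>The space \<open>\<pp>\<close> of the Cartan decomposition, that is \<open>\<i>\<close> times the traceless real symmetric matrices.\<close>

definition pp :: "cmat set" where
  "pp = {X. transpose X = X \<and> cnj_mat X = - X \<and> trace X = 0}"

lemma subspace_pp: "subspace pp"
  by (auto simp: pp_def subspace_def cnj_mat_linear transpose_linear trace_linear)

lemma subspace_su4: "subspace su4"
  by (auto simp: su4_def subspace_def adj_linear trace_linear)

lemma pp_su4: "X \<in> pp \<Longrightarrow> X \<in> su4"
  by (simp add: pp_def su4_def adj_def transpose_linear)

lemma horizontal_pp: "X \<in> pp \<Longrightarrow> horizontal X = X"
  by (simp add: pp_def horizontal_def flip: scaleR_2)

lemma su4_cnj_mat: "cnj_mat A = - transpose A" if "A \<in> su4"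
  using that by (simp add: su4_def adj_def) (metis transpose_linear(3) transpose_transpose)

lemma horizontal_su4: "A \<in> su4 \<Longrightarrow> horizontal A \<in> pp"
  by (auto simp: su4_cnj_mat horizontal_def pp_def transpose_linear cnj_mat_linear trace_linear cnj_mat_transpose
      algebra_simps trace_transpose)
     (simp_all add: su4_def)

lemma su4_transpose_add: "A \<in> su4 \<Longrightarrow> A + transpose A = 2 *\<^sub>R horizontal A"
  by (simp add: su4_cnj_mat horizontal_def)

lemma pp_rdiag:
  assumes "X \<in> pp"
  obtains S x where "rotation_matrix S" "X = idiag S x" "sum x UNIV = (0::real)"
proof -
  have "X ** cnj_mat X = cnj_mat X ** X" using assms by (simp add: pp_def mult_linear)
  then obtain S d where S: "rotation_matrix S" "X = rdiag S d"
    using assms symmetric_normal_diagonalisation unfolding pp_def by blast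
  then have So: "orthogonal_matrix S" by (simp add: rotation_matrix_def)
  have "cnj_mat X = scal (-1) X"
    using assms by (intro mat_eqI) (simp add: pp_def)
  then have "rdiag S (\<lambda>i. cnj (d i)) = rdiag S (\<lambda>i. (-1) * d i)"
    by (simp only: S cnj_mat_rdiag scal_rdiag)
  from rdiag_inject[OF So this] have "cnj (d i) = - d i" for i by (simp add: fun_eq_iff)
  then have d: "d i = \<i> * complex_of_real (Im (d i))" for i by (simp add: complex_eq_iff)
  have "trace X = 0" using assms by (simp add: pp_def)
  then have "sum d UNIV = 0" by (simp add: S trace_rdiag[OF So])
  then have "(\<Sum>i\<in>UNIV. Im (d i)) = 0" by (metis Im_sum zero_complex.sel(2))
  moreover have "d = (\<lambda>i. \<i> * complex_of_real (Im (d i)))" using d by blast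
  ultimately show thesis using that[OF S(1)] S(2) by metis
qed

lemma rdiag_pp:
  assumes "orthogonal_matrix S" "sum x UNIV = (0::real)"
  shows "idiag S x \<in> pp"
proof -
  have "rdiag S (\<lambda>i. - (\<i> * complex_of_real (x i))) = - idiag S x"
    by (rule mat_eqI) (simp add: rdiag_nth sum_negf)
  then show ?thesis
    using assms by (simp add: pp_def transpose_rdiag cnj_mat_rdiag trace_rdiag flip: sum_distrib_left of_real_sum)
qed

text \<open>The exponential of \<open>t X\<close>. It does not depend on the chosen diagonalisation of \<open>X\<close>, by
  \<open>pexp_rdiag\<close>; outside of \<open>pp\<close> its value is junk.\<close>

definition pexp :: "cmat \<Rightarrow> real \<Rightarrow> cmat" where
  "pexp X = (SOME E. \<exists>S x. rotation_matrix S \<and> X = idiag S x \<and>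
     sum x UNIV = (0::real) \<and> E = (\<lambda>t. rdiag S (\<lambda>i. cis (t * x i))))"

lemma pexp_form:
  assumes "X \<in> pp"
  obtains S x where "rotation_matrix S" "orthogonal_matrix S" "X = idiag S x"
    "sum x UNIV = (0::real)" "\<And>t. pexp X t = rdiag S (\<lambda>i. cis (t * x i))"
proof -
  obtain S x where "rotation_matrix S" "X = idiag S x" "sum x UNIV = (0::real)"
    using pp_rdiag[OF assms] .
  then have "\<exists>E S x. rotation_matrix S \<and> X = idiag S x \<and>
     sum x UNIV = (0::real) \<and> E = (\<lambda>t. rdiag S (\<lambda>i. cis (t * x i)))" by blast
  from someI_ex[OF this] show thesis
    unfolding pexp_def[symmetric] using that by (metis rotation_matrix_def)
qed

lemma pexp_0: "X \<in> pp \<Longrightarrow> pexp X 0 = mat 1"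
  by (erule pexp_form) (simp add: rdiag_1)

lemma pexp_add: "X \<in> pp \<Longrightarrow> pexp X (s + t) = pexp X s ** pexp X t"
  by (erule pexp_form) (simp add: rdiag_mult cis_mult distrib_right)

lemma transpose_pexp: "X \<in> pp \<Longrightarrow> transpose (pexp X t) = pexp X t"
  by (erule pexp_form) (simp add: transpose_rdiag)

lemma cnj_mat_pexp: "X \<in> pp \<Longrightarrow> cnj_mat (pexp X t) = pexp X (- t)"
  by (erule pexp_form) (simp add: cnj_mat_rdiag cis_cnj)

lemma adj_pexp: "X \<in> pp \<Longrightarrow> adj (pexp X t) = pexp X (- t)"
  by (simp add: adj_def cnj_mat_pexp transpose_pexp)

lemma prod_cis: "finite I \<Longrightarrow> (\<Prod>i\<in>I. cis (f i)) = cis (sum f I)"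
  by (induction I rule: finite_induct) (simp_all add: cis_mult)

lemma pexp_SU4: "X \<in> pp \<Longrightarrow> pexp X t \<in> SU4"
  by (erule pexp_form) (simp add: SU4_iff unitary_rdiag det_rdiag prod_cis flip: sum_distrib_left)

lemma sq_pexp: "X \<in> pp \<Longrightarrow> sq (pexp X t) = pexp X (2 * t)"
  by (simp add: sq_def transpose_pexp flip: pexp_add)

lemma pexp_commute: "X \<in> pp \<Longrightarrow> pexp X t ** X = X ** pexp X t"
  by (erule pexp_form) (simp add: rdiag_mult mult.commute)

lemma rdiag_sum: "rdiag S d = (\<Sum>k\<in>UNIV. scal (d k) (rdiag S (\<lambda>i. if i = k then 1 else 0)))"
  by (rule mat_eqI) (simp add: rdiag_nth if_distrib[of "\<lambda>x. _ * x"] mult.commute[of "d _"] cong: if_cong)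

lemma bounded_linear_scal_left: "bounded_linear (\<lambda>c. scal c A)"
  unfolding linear_conv_bounded_linear[symmetric]
  by (auto intro!: linearI mat_eqI simp: algebra_simps)

lemma rdiag_has_vector_derivative:
  assumes "\<And>i. ((\<lambda>t. d t i) has_vector_derivative d' i) F"
  shows "((\<lambda>t. rdiag S (d t)) has_vector_derivative rdiag S d') F"
  by (subst (1 2) rdiag_sum)
     (intro has_vector_derivative_sum bounded_linear.has_vector_derivative[OF bounded_linear_scal_left] assms)

lemma rdiag_cis_has_vector_derivative:
  assumes "orthogonal_matrix S"
  shows "((\<lambda>t. rdiag S (\<lambda>i. cis (t * x i))) has_vector_derivative
    idiag S x ** rdiag S (\<lambda>i. cis (t * x i))) (at t within T)"
proof -
  have "((\<lambda>t. cis (t * x i)) has_vector_derivative \<i> * complex_of_real (x i) * cis (t * x i)) (at t within T)" for i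
    unfolding cis_conv_exp
    by (auto intro!: derivative_eq_intros has_vector_derivative_real_field simp: algebra_simps)
  then show ?thesis
    unfolding rdiag_mult[OF assms] by (intro rdiag_has_vector_derivative)
qed

lemma pexp_has_vector_derivative:
  assumes "X \<in> pp"
  shows "(pexp X has_vector_derivative X ** pexp X t) (at t within T)"
proof -
  obtain S x where S: "orthogonal_matrix S" "X = idiag S x"
    "\<And>t. pexp X t = rdiag S (\<lambda>i. cis (t * x i))" using pexp_form[OF assms] by metis
  then have "pexp X = (\<lambda>t. rdiag S (\<lambda>i. cis (t * x i)))" by blast
  with rdiag_cis_has_vector_derivative[OF S(1)] S(2) show ?thesis by simp
qed

lemma continuous_on_pexp: "X \<in> pp \<Longrightarrow> continuous_on T (pexp X)"
  by (rule continuous_on_vector_derivative, rule pexp_has_vector_derivative)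

lemma pexp_inverse: "X \<in> pp \<Longrightarrow> pexp X t ** pexp X (- t) = mat 1"
  by (simp add: pexp_0 flip: pexp_add)

lemma pexp_minus_has_vector_derivative:
  assumes "X \<in> pp"
  shows "((\<lambda>t. pexp X (- t)) has_vector_derivative - (X ** pexp X (- t))) (at t)"
proof -
  have "((\<lambda>t. adj (pexp X t)) has_vector_derivative adj (X ** pexp X t)) (at t)"
    by (intro has_vector_derivative_adj pexp_has_vector_derivative assms)
  moreover have "adj (X ** pexp X t) = - (X ** pexp X (- t))"
    using assms pp_su4[OF assms] by (simp add: adj_mult adj_pexp su4_def mult_linear pexp_commute)
  ultimately show ?thesis using assms by (simp add: adj_pexp)
qed

text \<open>Uniqueness for G' = G X: the product \<open>G t ** pexp X (- t)\<close> has zero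
  derivative. A convex \<open>I\<close> allows the use on small intervals as well as on the whole
  line.\<close>

lemma pexp_unique_linear:
  fixes G :: "real \<Rightarrow> cmat"
  assumes X: "X \<in> pp" and I: "convex I"
    and G: "\<And>t. t \<in> I \<Longrightarrow> (G has_vector_derivative G t ** X) (at t)"
    and st: "s \<in> I" "t \<in> I"
  shows "G t = G s ** pexp X (t - s)"
proof -
  have "\<exists>C. \<forall>t\<in>I. G t ** pexp X (- t) = C"
  proof (rule has_derivative_zero_constant[OF I])
    fix t assume t: "t \<in> I"
    have "((\<lambda>t. G t ** pexp X (- t)) has_vector_derivative
        G t ** (- (X ** pexp X (- t))) + (G t ** X) ** pexp X (- t)) (at t)"
      by (intro mm.has_vector_derivative G t
          pexp_minus_has_vector_derivative X)
    then have "((\<lambda>t. G t ** pexp X (- t)) has_vector_derivative 0) (at t)"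
      by (simp add: mult_linear matrix_mul_assoc)
    then show "((\<lambda>t. G t ** pexp X (- t)) has_derivative (\<lambda>h. 0)) (at t within I)"
      by (simp add: has_vector_derivative_def has_derivative_at_withinI)
  qed
  then have "G t ** pexp X (- t) = G s ** pexp X (- s)" using st by metis
  then have "G t ** (pexp X (- t) ** pexp X (- (- t))) = G s ** (pexp X (- s) ** pexp X t)"
    by (simp only: matrix_mul_assoc minus_minus)
  then show ?thesis using X by (simp only: pexp_inverse) (simp flip: pexp_add)
qed

text \<open>Both sides solve the same linear equation with the same value at 0, so the
  diagonalisation chosen inside \<open>pexp\<close> is immaterial.\<close>

lemma pexp_rdiag:
  assumes S: "orthogonal_matrix S" and x: "sum x UNIV = (0::real)"
  shows "pexp (idiag S x) t = rdiag S (\<lambda>i. cis (t * x i))"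
proof -
  let ?X = "idiag S x"
  let ?G = "\<lambda>t. rdiag S (\<lambda>i. cis (t * x i))"
  have "?G t = ?G 0 ** pexp ?X (t - 0)"
  proof (rule pexp_unique_linear[where I = UNIV])
    show "(?G has_vector_derivative ?G t ** ?X) (at t)" for t
      using rdiag_cis_has_vector_derivative[OF S, of x t] by (simp add: rdiag_mult[OF S] mult.commute)
  qed (auto simp: rdiag_pp S x)
  then show ?thesis by (simp add: rdiag_1[OF S])
qed

text \<open>Exponentials are available only for \<open>pp\<close>. Conjugating them by unitary
  matrices provides curves in enough directions to span the Lie algebra: the horizontal part comes
  from the identity, the real antisymmetric part from the diagonal matrices below.\<close>

lemma su4_span:
  assumes V: "subspace V" and X: "\<And>X D. X \<in> pp \<Longrightarrow> unitary D \<Longrightarrow> adj D ** X ** D \<in> V"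
  shows "su4 \<subseteq> V"
proof
  fix A assume A: "A \<in> su4"
  have "horizontal A \<in> pp" by (rule horizontal_su4[OF A])
  from X[OF this, of "mat 1"] have h: "horizontal A \<in> V" by (simp add: unitary_def adj_def)
  define E :: "4 \<Rightarrow> 4 \<Rightarrow> cmat" where "E i j = (\<chi> a b. if a = i \<and> b = j then 1 else if a = j \<and> b = i then -1 else 0)"
    for i j :: 4
  have E: "E i j \<in> V" if "i \<noteq> j" for i j
  proof -
    define Y :: cmat where "Y = (\<chi> a b. if a = i \<and> b = j then \<i> else if a = j \<and> b = i then \<i> else 0)"
    \<comment> \<open>Conjugation by \<open>diagm d\<close> multiplies the entries at (i, j) and (j,
      i) by -\<i> and \<i>, turning the symmetric pair \<i>, \<i> of \<open>Y\<close> into 1,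
      -1.\<close>
    define d where "d k = (if k = j then - \<i> else 1)" for k
    have "Y \<in> pp" unfolding pp_def using that
      by (auto intro!: mat_eqI sum.neutral simp: Y_def transpose_nth trace_def)
    moreover have "unitary (diagm d)"
      by (simp add: unitary_def adj_def cnj_mat_diagm diagm_mult d_def if_distrib if_distribR diagm_1 cong: if_cong)
    moreover have "adj (diagm d) ** Y ** diagm d = E i j"
      by (rule mat_eqI)
         (use that in \<open>auto simp: adj_def cnj_mat_diagm mult_diagm_nth diagm_mult_nth Y_def d_def E_def\<close>)
    ultimately show ?thesis using X by metis
  qed
  define r where "r i j = Re (A $ i $ j)" for i j
  have r: "r j i = - r i j" for i j
  proof -
    have "cnj (A $ j $ i) = - A $ i $ j"
      using su4_cnj_mat[OF A] by (simp add: vec_eq_iff transpose_nth)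
    then show ?thesis by (simp add: r_def complex_eq_iff)
  qed
  let ?S = "\<Sum>i\<in>UNIV. \<Sum>j\<in>UNIV. r i j *\<^sub>R (if i = j then 0 else E i j)"
  \<comment> \<open>The ordered pairs (i, j) and (j, i) contribute the same matrix, hence the factor
    1/2.\<close>
  have "A - horizontal A = (1/2) *\<^sub>R ?S"
  proof (rule mat_eqI)
    fix a b
    have e: "?S $ a $ b =
      (\<Sum>i\<in>UNIV. \<Sum>j\<in>UNIV. r i j *\<^sub>R (if i = j then 0 else if a = i \<and> b = j then 1 else if a = j \<and> b = i then -1 else 0))"
      by (simp add: E_def if_distrib[of "\<lambda>x. x $ _"] cong: if_cong)
    have "\<dots> = (\<Sum>i\<in>UNIV. \<Sum>j\<in>UNIV. (if b = j then if a = i then of_real (r i j) else 0 else 0)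
       - (if a = j then if b = i then of_real (r i j) else 0 else 0))"
      using r[of a a] by (intro sum.cong refl) (auto simp: scaleR_conv_of_real)
    also have "\<dots> = of_real (r a b - r b a)" by (simp add: sum_subtractf)
    finally have "((1/2) *\<^sub>R ?S) $ a $ b = of_real (r a b)"
      unfolding vector_scaleR_component e by (simp add: r[of a b] scaleR_conv_of_real)
    then show "(A - horizontal A) $ a $ b = ((1/2) *\<^sub>R ?S) $ a $ b"
      by (simp add: horizontal_def r_def complex_eq_iff)
  qed
  moreover have "\<dots> \<in> V" using E subspace_0[OF V]
    by (intro subspace_scale[OF V] subspace_sum[OF V]) auto
  ultimately have "A - horizontal A \<in> V" by simp
  then have "horizontal A + (A - horizontal A) \<in> V" by (rule subspace_add[OF V h])
  then show "A \<in> V" by simp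
qed

subsection \<open>Curves in the special unitary group\<close>

text \<open>A nonidentity permutation moves at least two indices, so at the identity matrix its
  product still contains a zero after one factor has been differentiated. Only the diagonal term
  survives.\<close>

lemma det_has_derivative_at_mat_1:
  fixes h :: "real \<Rightarrow> cmat"
  assumes h: "(h has_vector_derivative A) (at t)" and 1: "h t = mat 1"
  shows "((\<lambda>s. det (h s)) has_vector_derivative trace A) (at t)"
proof -
  have comp: "((\<lambda>s. h s $ i $ j) has_derivative (\<lambda>x. x *\<^sub>R A $ i $ j)) (at t)" for i j
    using bounded_linear.has_vector_derivative[OF bounded_linear_compose[OF bounded_linear_vec_nth bounded_linear_vec_nth] h]
    by (simp add: has_vector_derivative_def)
  let ?d = "\<lambda>p y. \<Sum>i\<in>UNIV. y *\<^sub>R A $ i $ p i * (\<Prod>j\<in>UNIV - {i}. h t $ j $ p j)"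
  have deriv: "((\<lambda>s. det (h s)) has_derivative (\<lambda>y. \<Sum>p\<in>{p. p permutes UNIV}. of_int (sign p) * ?d p y)) (at t)"
    unfolding det_def
    by (intro has_derivative_sum has_derivative_mult_right has_derivative_prod comp)
  have d: "?d p y = (if p = id then y *\<^sub>R trace A else 0)" if p: "p permutes UNIV" for p y
  proof (cases "p = id")
    case True
    have "(\<Prod>j\<in>UNIV - {i}. h t $ j $ j) = 1" for i by (simp add: 1 mat_1_nth)
    then show ?thesis using True by (simp add: trace_def scaleR_sum_right)
  next
    case False
    have "(\<Prod>j\<in>UNIV - {i}. h t $ j $ p j) = 0" for i
    proof (rule ccontr)
      assume "(\<Prod>j\<in>UNIV - {i}. h t $ j $ p j) \<noteq> 0"
      then have *: "p j = j" if "j \<noteq> i" for j using that by (auto simp: 1 mat_1_nth split: if_splits)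
      then have "p i = i" using permutes_inj[OF p] by (metis injD)
      with * have "p j = j" for j by (cases "j = i") auto
      with False show False by (auto simp: fun_eq_iff)
    qed
    then show ?thesis using False by (simp del: prod_zero_iff)
  qed
  have "(\<Sum>p\<in>{p. p permutes UNIV}. of_int (sign p) * ?d p y) =
      (\<Sum>p\<in>{p :: 4 \<Rightarrow> 4. p permutes UNIV}. if p = id then y *\<^sub>R trace A else 0)" for y
  proof (rule sum.cong[OF refl])
    fix p :: "4 \<Rightarrow> 4" assume "p \<in> {p. p permutes UNIV}"
    then have p: "p permutes UNIV" by simp
    show "of_int (sign p) * ?d p y = (if p = id then y *\<^sub>R trace A else 0)"
      unfolding d[OF p] by (simp add: sign_id)
  qed
  then have "(\<Sum>p\<in>{p. p permutes UNIV}. of_int (sign p) * ?d p y) = y *\<^sub>R trace A" for y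
    by (simp add: permutes_id finite_permutations)
  with deriv show ?thesis by (simp only: has_vector_derivative_def)
qed

lemma SU4_curve_tangent:
  assumes g: "(g has_vector_derivative g') (at t)" and S: "open S" "t \<in> S" "\<And>s. s \<in> S \<Longrightarrow> g s \<in> SU4"
  shows "adj (g t) ** g' \<in> su4"
proof -
  note U = SU4D[OF S(3)[OF S(2)]]
  let ?A = "adj (g t) ** g'"
  have "((\<lambda>s. adj (g s) ** g s) has_vector_derivative adj (g t) ** g' + adj g' ** g t) (at t)"
    by (intro mm.has_vector_derivative g
        has_vector_derivative_adj)
  moreover have "((\<lambda>s. adj (g s) ** g s) has_vector_derivative 0) (at t)"
    by (rule has_vector_derivative_transform_within_open[OF has_vector_derivative_const S(1,2), of "mat 1"])
       (simp add: S(3) SU4_unitary unitaryD)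
  ultimately have "?A + adj ?A = 0"
    using vector_derivative_unique_at by (fastforce simp: adj_mult)
  then have 1: "adj ?A = - ?A" by (metis add_eq_0_iff)
  \<comment> \<open>Left translation by the adjoint brings the curve to the identity at time
    \<open>t\<close>, where the derivative of the determinant is the trace.\<close>
  have "((\<lambda>s. det (adj (g t) ** g s)) has_vector_derivative trace ?A) (at t)"
    by (intro det_has_derivative_at_mat_1 has_vector_derivative_mult_right g U)
  moreover have "((\<lambda>s. det (adj (g t) ** g s)) has_vector_derivative 0) (at t)"
    using S by (intro has_vector_derivative_transform_within_open[OF has_vector_derivative_const S(1,2), of 1])
       (auto simp: SU4_iff det_mul det_adj)
  ultimately have "trace ?A = 0" using vector_derivative_unique_at by blast
  with 1 show ?thesis by (simp add: su4_def)
qed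

text \<open>Squaring forgets the vertical part of the velocity, so the squares record the motion in
  the symmetric space only.\<close>

lemma sq_has_vector_derivative:
  assumes g: "(g has_vector_derivative g t ** B) (at t)" and B: "B \<in> su4"
  shows "((\<lambda>s. sq (g s)) has_vector_derivative 2 *\<^sub>R (g t ** horizontal B ** transpose (g t))) (at t)"
proof -
  have "((\<lambda>s. sq (g s)) has_vector_derivative
      g t ** transpose (g t ** B) + (g t ** B) ** transpose (g t)) (at t)"
    unfolding sq_def by (intro mm.has_vector_derivative g
        has_vector_derivative_transpose)
  moreover have "g t ** transpose (g t ** B) + (g t ** B) ** transpose (g t) = g t ** (B + transpose B) ** transpose (g t)"
    by (simp add: matrix_transpose_mul mult_linear matrix_mul_assoc)
  ultimately show ?thesis by (simp add: su4_transpose_add[OF B] mult_linear)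
qed

text \<open>The phase is continuous and takes values among the fourth roots of unity, so it is
  constant on a connected set.\<close>

lemma phase_constant:
  fixes P Q :: "real \<Rightarrow> cmat"
  assumes I: "connected I" and c: "continuous_on I P" "continuous_on I Q"
    and PQ: "\<And>t. t \<in> I \<Longrightarrow> P t \<in> SU4" "\<And>t. t \<in> I \<Longrightarrow> Q t \<in> SU4" "\<And>t. t \<in> I \<Longrightarrow> \<exists>c. P t = scal c (Q t)"
  shows "\<exists>c. \<forall>t\<in>I. P t = scal c (Q t)"
proof -
  \<comment> \<open>Since \<open>P t ** adj (Q t)\<close> is the phase times the identity, any
    diagonal entry recovers the phase and shows its continuity.\<close>
  define z where "z t = (P t ** adj (Q t)) $ 1 $ 1" for t
  have z: "P t = scal (z t) (Q t) \<and> z t ^ 4 = 1" if t: "t \<in> I" for t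
  proof -
    obtain c where c: "P t = scal c (Q t)" using PQ t by blast
    then have "z t = c"
      by (simp add: z_def scal_mult_left SU4D[OF PQ(2)[OF t]] mat_1_nth)
    then show ?thesis using c scal_SU4_root PQ(1,2)[OF t] by metis
  qed
  have "continuous_on I z" unfolding z_def
    by (intro continuous_intros c)
  moreover have "finite (z ` I)"
    by (rule finite_subset[of _ "{z. z ^ 4 = 1}"]) (use z in \<open>auto simp: finite_roots_unity\<close>)
  ultimately have "z constant_on I" by (rule continuous_finite_range_constant[OF I])
  then show ?thesis using z by (metis constant_on_def)
qed

subsection \<open>Local lifts\<close>

abbreviation fder :: "(cmat \<Rightarrow> cmat) \<Rightarrow> cmat \<Rightarrow> cmat \<Rightarrow> cmat" where
  "fder F u \<equiv> frechet_derivative F (at u)"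

text \<open>The differential of \<open>F\<close> in the left trivialisations of the tangent bundle at \<open>u\<close> and \<open>F u\<close>.\<close>

definition lder :: "(cmat \<Rightarrow> cmat) \<Rightarrow> cmat \<Rightarrow> cmat \<Rightarrow> cmat" where
  "lder F u A = adj (F u) ** fder F u (u ** A)"

lemma local_liftD:
  assumes "local_lift f U F"
  shows "open U" "\<And>n. Ck_on n U F" "\<And>v. v \<in> U \<Longrightarrow> v \<in> SU4 \<Longrightarrow> F v \<in> SU4"
    "\<And>v. v \<in> U \<Longrightarrow> v \<in> SU4 \<Longrightarrow> f (coset v) = coset (F v)"
  using assms by (auto simp: local_lift_def)

lemma local_lift_has_derivative:
  assumes "local_lift f U F" "u \<in> U" shows "(F has_derivative fder F u) (at u)"
proof -
  have "Ck_on 1 U F" using local_liftD(2)[OF assms(1)] .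
  then show ?thesis using assms(2) by (simp add: frechet_derivative_works[symmetric])
qed

lemma linear_fder: "local_lift f U F \<Longrightarrow> u \<in> U \<Longrightarrow> linear (fder F u)"
  using local_lift_has_derivative has_derivative_linear by blast

lemma local_lift_curve:
  assumes "local_lift f U F" "c t \<in> U" "(c has_vector_derivative c') (at t)"
  shows "((\<lambda>s. F (c s)) has_vector_derivative fder F (c t) c') (at t)"
proof -
  have "((F \<circ> c) has_derivative (fder F (c t) \<circ> (\<lambda>x. x *\<^sub>R c'))) (at t)"
    by (rule diff_chain_at[OF assms(3)[unfolded has_vector_derivative_def] local_lift_has_derivative[OF assms(1,2)]])
  moreover have "fder F (c t) \<circ> (\<lambda>x. x *\<^sub>R c') = (\<lambda>x. x *\<^sub>R fder F (c t) c')"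
    using linear_fder[OF assms(1,2)] by (auto simp: linear_cmul)
  ultimately show ?thesis by (simp add: has_vector_derivative_def o_def)
qed

lemma lder_linear:
  assumes "local_lift f U F" "u \<in> U"
  shows "linear (lder F u)"
proof -
  have "linear (\<lambda>A. adj (F u) ** fder F u (u ** A))"
    using linear_fder[OF assms] by (auto intro!: linearI simp: mult_linear linear_add linear_cmul)
  then show ?thesis by (simp add: lder_def[abs_def])
qed

lemma SU4_conj_pexp:
  assumes "u \<in> SU4" "unitary D" "X \<in> pp"
  shows "u ** (adj D ** pexp X t ** D) \<in> SU4"
proof -
  have "det (adj D) * det D = 1"
    by (metis assms(2) det_I det_mul unitary_def)
  then show ?thesis
    using assms pexp_SU4[OF assms(3), of t] by (auto simp: SU4_iff unitary_mult unitary_adj det_mul)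
qed

lemma conj_pexp_has_vector_derivative:
  fixes u :: cmat
  assumes "X \<in> pp" "unitary D"
  shows "((\<lambda>s. u ** (adj D ** pexp X s ** D)) has_vector_derivative
     (u ** (adj D ** pexp X t ** D)) ** (adj D ** X ** D)) (at t)"
proof -
  have "((\<lambda>s. u ** (adj D ** pexp X s ** D)) has_vector_derivative
     u ** (adj D ** (X ** pexp X t) ** D)) (at t)"
    using bounded_linear.has_vector_derivative[OF bounded_linear_compose[OF bounded_linear_compose[OF
        mm.bounded_linear_right mm.bounded_linear_left] mm.bounded_linear_right] pexp_has_vector_derivative[OF assms(1)]] .
  then show ?thesis
    by (simp add: pexp_commute[OF assms(1), symmetric] matrix_mul_assoc unitaryD[OF assms(2)])
qed

text \<open>Every element of \<open>su(4)\<close> is a combination of the velocities of these curves, so linear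
  statements about the derivative of a lift need only be checked along them.\<close>

lemma local_lift_conj_pexp:
  assumes l: "local_lift f U F" "u \<in> U" and u: "u \<in> SU4" and D: "unitary D" and X: "X \<in> pp"
  defines "c \<equiv> \<lambda>s. u ** (adj D ** pexp X s ** D)"
  obtains e where "e > 0" "c 0 = u" "\<forall>s. c s \<in> SU4" "continuous_on UNIV c" "\<forall>s\<in>ball 0 e. c s \<in> U"
    "((\<lambda>s. F (c s)) has_vector_derivative F u ** lder F u (adj D ** X ** D)) (at 0)"
proof -
  have c0: "c 0 = u" using X by (simp add: c_def pexp_0 unitaryD[OF D])
  have dc: "(c has_vector_derivative c t ** (adj D ** X ** D)) (at t)" for t
    unfolding c_def by (rule conj_pexp_has_vector_derivative[OF X D])
  have cc: "continuous_on UNIV c"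
    by (rule continuous_on_vector_derivative) (rule dc)
  have "((\<lambda>s. F (c s)) has_vector_derivative F u ** lder F u (adj D ** X ** D)) (at 0)"
    using local_lift_curve[OF l(1) _ dc, of 0] l(2) c0 SU4D[OF local_liftD(3)[OF l u]]
    by (simp add: lder_def matrix_mul_assoc)
  moreover have "open (c -` U)"
    using cc local_liftD(1)[OF l(1)] by (simp add: open_vimage)
  then obtain e where "e > 0" "ball 0 e \<subseteq> c -` U"
    using c0 l(2) open_contains_ball[of "c -` U"] by (metis vimageI)
  moreover have "c s \<in> SU4" for s unfolding c_def by (rule SU4_conj_pexp[OF u D X])
  ultimately show thesis using that[of e] c0 cc by blast
qed

lemma lder_su4:
  assumes l: "local_lift f U F" and u: "u \<in> U" "u \<in> SU4" and A: "A \<in> su4"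
  shows "lder F u A \<in> su4"
proof -
  have "su4 \<subseteq> {A. lder F u A \<in> su4}"
  proof (rule su4_span)
    show "subspace {A. lder F u A \<in> su4}"
      using linear_subspace_vimage[OF lder_linear[OF l u(1)] subspace_su4] by (simp add: vimage_def)
    fix X D assume X: "X \<in> pp" and D: "unitary D"
    obtain e c where e: "e > 0" "c 0 = u" "\<forall>s. c s \<in> SU4" "continuous_on UNIV c"
      "\<forall>s\<in>ball 0 e. c s \<in> U"
      "((\<lambda>s. F (c s)) has_vector_derivative F u ** lder F u (adj D ** X ** D)) (at 0)"
      by (rule local_lift_conj_pexp[OF l u D X], rule that)
    have "adj (F (c 0)) ** (F u ** lder F u (adj D ** X ** D)) \<in> su4"
      by (rule SU4_curve_tangent[OF e(6), of "ball 0 e"]) (use e local_liftD(3)[OF l] in auto)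
    then show "adj D ** X ** D \<in> {A. lder F u A \<in> su4}"
      using SU4D[OF local_liftD(3)[OF l u]] by (simp add: e(2) matrix_mul_assoc)
  qed
  with A show ?thesis by blast
qed

lemma metric_lder:
  assumes "local_lift f U F" "u \<in> U" "u \<in> SU4"
  shows "metric (F u) (fder F u (u ** A)) (fder F u (u ** B)) =
    - Re (trace (horizontal (lder F u A) ** horizontal (lder F u B)))"
  using matrix_inv_SU4[OF local_liftD(3)[OF assms]] by (simp add: metric_def lder_def)

lemma metric_SU4:
  assumes "u \<in> SU4"
  shows "metric u (u ** A) (u ** B) = - Re (trace (horizontal A ** horizontal B))"
  using SU4D[OF assms] by (simp add: metric_def matrix_inv_SU4[OF assms] matrix_mul_assoc)

lemma su4_conj:
  assumes "A \<in> su4" "unitary D" shows "adj D ** A ** D \<in> su4"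
proof -
  have "trace (adj D ** A ** D) = trace (D ** adj D ** A)"
    by (subst trace_mul_sym) (simp add: matrix_mul_assoc)
  then show ?thesis
    using assms by (simp add: su4_def adj_mult matrix_mul_assoc mult_linear unitaryD)
qed

text \<open>Two lifts of the same map differ by elements of the stabiliser, under which the metric is
  invariant.\<close>

lemma metric_lift_independent:
  assumes F: "local_lift f U F" "u \<in> U" and G: "local_lift f V G" "u \<in> V" and u: "u \<in> SU4"
    and AB: "A \<in> su4" "B \<in> su4"
  shows "metric (F u) (fder F u (u ** A)) (fder F u (u ** B)) = metric (G u) (fder G u (u ** A)) (fder G u (u ** B))"
proof -
  let ?f = "F u" and ?g = "G u"
  have S: "?f \<in> SU4" "?g \<in> SU4" using local_liftD(3)[OF F u] local_liftD(3)[OF G u] by blast+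
  note UF = SU4D[OF S(1)] and UG = SU4D[OF S(2)]
  have "coset ?g = coset ?f" using local_liftD(4)[OF F u] local_liftD(4)[OF G u] by simp
  then obtain z where z: "sq ?f = scal z (sq ?g)" using S by (auto simp: coset_eq_iff)
  have z1: "cmod z = 1" using scal_SU4_root[OF sq_SU4[OF S(2)]] z sq_SU4[OF S(1)] by metis
  \<comment> \<open>The equation in \<open>V'\<close> is half the derivative of the relation between
    \<open>sq\<close> of \<open>F\<close> and \<open>sq\<close> of \<open>G\<close>, with the phase
    held at its value \<open>z\<close> at \<open>u\<close>.\<close>
  define V' where "V' = {A. ?f ** horizontal (lder F u A) ** transpose ?f =
     scal z (?g ** horizontal (lder G u A) ** transpose ?g)}"
  have "su4 \<subseteq> V'"
  proof (rule su4_span)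
    have lin: "linear (lder F u)" "linear (lder G u)" using lder_linear F G by blast+
    show "subspace V'" unfolding V'_def subspace_def
      by (simp add: linear_0[OF lin(1)] linear_0[OF lin(2)] linear_add[OF lin(1)] linear_add[OF lin(2)]
        linear_cmul[OF lin(1)] linear_cmul[OF lin(2)] mult_linear scal_linear horizontal_linear)
    fix X D assume X: "X \<in> pp" and D: "unitary D"
    let ?c = "\<lambda>s. u ** (adj D ** pexp X s ** D)" and ?A = "adj D ** X ** D"
    have A: "?A \<in> su4" by (rule su4_conj[OF pp_su4[OF X] D])
    obtain e where e: "e > 0" "?c 0 = u" "\<forall>s. ?c s \<in> SU4" "continuous_on UNIV ?c"
      "\<forall>s\<in>ball 0 e. ?c s \<in> U"
      "((\<lambda>s. F (?c s)) has_vector_derivative F u ** lder F u ?A) (at 0)"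
      by (rule local_lift_conj_pexp[OF F u D X], rule that)
    obtain e' where e': "e' > 0" "\<forall>s\<in>ball 0 e'. ?c s \<in> V"
      "((\<lambda>s. G (?c s)) has_vector_derivative G u ** lder G u ?A) (at 0)"
      by (rule local_lift_conj_pexp[OF G u D X], rule that)
    define I where "I = ball (0::real) (min e e')"
    have I: "open I" "0 \<in> I" "connected I" "\<And>s. s \<in> I \<Longrightarrow> ?c s \<in> U \<and> ?c s \<in> V"
      using e e' by (auto simp: I_def)
    have co: "continuous_on I (\<lambda>s. F (?c s))" "continuous_on I (\<lambda>s. G (?c s))"
      using continuous_on_compose2[of U F I ?c] continuous_on_compose2[of V G I ?c]
        local_liftD(2)[OF F(1), of 0] local_liftD(2)[OF G(1), of 0] continuous_on_subset[OF e(4)] I by auto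
    have "\<exists>b. \<forall>s\<in>I. sq (F (?c s)) = scal b (sq (G (?c s)))"
    proof (rule phase_constant[OF I(3)])
      show "continuous_on I (\<lambda>s. sq (F (?c s)))" "continuous_on I (\<lambda>s. sq (G (?c s)))"
        unfolding sq_def by (intro continuous_intros co)+
      fix s assume s: "s \<in> I"
      have cs: "?c s \<in> U" "?c s \<in> V" "?c s \<in> SU4" using I(4)[OF s] e(3) by blast+
      have FG: "F (?c s) \<in> SU4" "G (?c s) \<in> SU4"
        using local_liftD(3)[OF F(1) cs(1,3)] local_liftD(3)[OF G(1) cs(2,3)] by blast+
      then show "sq (F (?c s)) \<in> SU4" "sq (G (?c s)) \<in> SU4" by (simp_all add: sq_SU4)
      have "coset (G (?c s)) = coset (F (?c s))"
        using local_liftD(4)[OF F(1) cs(1,3)] local_liftD(4)[OF G(1) cs(2,3)] by simp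
      then show "\<exists>b. sq (F (?c s)) = scal b (sq (G (?c s)))" using FG by (simp add: coset_eq_iff)
    qed
    then obtain b where b: "\<And>s. s \<in> I \<Longrightarrow> sq (F (?c s)) = scal b (sq (G (?c s)))" by blast
    have "b = z"
    proof -
      have "scal b (sq ?g ** adj (sq ?g)) = scal z (sq ?g ** adj (sq ?g))"
        using b[OF I(2)] z by (metis e(2) scal_mult_left)
      then show ?thesis using SU4D[OF sq_SU4[OF S(2)]] scal_mat_1_inject by metis
    qed
    have "((\<lambda>s. sq (F (?c s))) has_vector_derivative 2 *\<^sub>R (?f ** horizontal (lder F u ?A) ** transpose ?f)) (at 0)"
      using sq_has_vector_derivative[of "\<lambda>s. F (?c s)" 0] e(2,6) lder_su4[OF F u A] by simp
    moreover have "((\<lambda>s. scal z (sq (G (?c s)))) has_vector_derivative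
        scal z (2 *\<^sub>R (?g ** horizontal (lder G u ?A) ** transpose ?g))) (at 0)"
      using sq_has_vector_derivative[of "\<lambda>s. G (?c s)" 0] e(2) e'(3) lder_su4[OF G u A]
      by (intro has_vector_derivative_scal) simp
    then have "((\<lambda>s. sq (F (?c s))) has_vector_derivative
        scal z (2 *\<^sub>R (?g ** horizontal (lder G u ?A) ** transpose ?g))) (at 0)"
      by (rule has_vector_derivative_transform_within_open[OF _ I(1,2)]) (simp add: b \<open>b = z\<close>)
    ultimately show "?A \<in> V'"
      using vector_derivative_unique_at by (fastforce simp: V'_def scal_linear)
  qed
  then have *: "horizontal (lder F u A) = scal z (adj ?f ** ?g ** horizontal (lder G u A) ** transpose ?g ** cnj_mat ?f)"
    if "A \<in> su4" for A
  proof -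
    have "adj ?f ** (?f ** horizontal (lder F u A) ** transpose ?f) ** cnj_mat ?f =
      adj ?f ** scal z (?g ** horizontal (lder G u A) ** transpose ?g) ** cnj_mat ?f"
      using that \<open>su4 \<subseteq> V'\<close> by (auto simp: V'_def)
    then show ?thesis by (simp add: UF matrix_mul_assoc scal_mult_left scal_mult_right)
  qed
  have "transpose ?g ** cnj_mat (sq ?f) ** ?g = scal (cnj z) (transpose ?g ** cnj_mat ?g ** (adj ?g ** ?g))"
    by (simp add: z cnj_mat_scal scal_mult_left scal_mult_right)
       (simp add: sq_def cnj_mat_mult adj_def cnj_mat_transpose matrix_mul_assoc)
  then have k: "transpose ?g ** cnj_mat ?f ** adj ?f ** ?g = scal (cnj z) (mat 1)"
    by (simp add: UG) (simp add: sq_def cnj_mat_mult adj_def cnj_mat_transpose matrix_mul_assoc)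
  let ?a = "horizontal (lder G u A)" and ?b = "horizontal (lder G u B)"
  have kk: "M ** transpose ?g ** cnj_mat ?f ** adj ?f ** ?g = scal (cnj z) M" for M :: cmat
  proof -
    have "M ** transpose ?g ** cnj_mat ?f ** adj ?f ** ?g = M ** (transpose ?g ** cnj_mat ?f ** adj ?f ** ?g)"
      by (simp add: matrix_mul_assoc)
    then show ?thesis by (simp add: k scal_mult_right)
  qed
  \<comment> \<open>By cyclicity of the trace, the factors between \<open>?a\<close> and
    \<open>?b\<close> collapse at both ends. Each collapse yields \<open>cnj z\<close>, and together
    they cancel \<open>z * z\<close>.\<close>
  have "trace (horizontal (lder F u A) ** horizontal (lder F u B)) =
    trace (scal (z * z) ((adj ?f ** ?g ** ?a ** transpose ?g ** cnj_mat ?f) ** (adj ?f ** ?g ** ?b ** transpose ?g ** cnj_mat ?f)))"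
    by (simp add: * AB scal_mult_left scal_mult_right)
  also have "\<dots> = z * z * cnj z * trace ((adj ?f ** ?g) ** (?a ** ?b ** transpose ?g ** cnj_mat ?f))"
    by (simp add: trace_scal matrix_mul_assoc kk scal_mult_left scal_mult_right)
  also have "\<dots> = z * z * cnj z * trace (?a ** ?b ** transpose ?g ** cnj_mat ?f ** adj ?f ** ?g)"
    by (subst trace_mul_sym) (simp add: matrix_mul_assoc)
  also have "\<dots> = (cnj z * z) * (cnj z * z) * trace (?a ** ?b)"
    by (simp add: kk trace_scal mult_ac)
  also have "\<dots> = trace (?a ** ?b)" using z1 cnj_mult_self_eq_1[of z] by simp
  finally show ?thesis unfolding metric_lder[OF F u] metric_lder[OF G u] by simp
qed

subsection \<open>Isometries induced by real-linear maps\<close>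

lemma Ck_on_const: "Ck_on n U (\<lambda>x. c)"
  by (induction n arbitrary: c) auto

lemma Ck_on_linear: "bounded_linear \<rho> \<Longrightarrow> Ck_on n U \<rho>"
proof (cases n)
  case (Suc m)
  assume "bounded_linear \<rho>"
  then have d: "(\<rho> has_derivative \<rho>) (at x)" for x by (rule bounded_linear_imp_has_derivative)
  then have "frechet_derivative \<rho> (at x) = \<rho>" for x using frechet_derivative_at by metis
  then show ?thesis using d Suc Ck_on_const by (auto simp: differentiable_def)
qed (simp add: linear_continuous_on)

lemma local_lift_linear:
  assumes "bounded_linear \<rho>" "\<And>v. v \<in> SU4 \<Longrightarrow> \<rho> v \<in> SU4" "\<And>v. v \<in> SU4 \<Longrightarrow> f (coset v) = coset (\<rho> v)"
  shows "local_lift f UNIV \<rho>"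
  using assms Ck_on_linear by (auto simp: local_lift_def)

text \<open>A real-linear map of the matrix space is its own derivative and serves as a global lift.
  The definition of \<open>isometry\<close> quantifies over all local lifts;
  \<open>metric_lift_independent\<close> carries the metric condition from this lift to every
  other.\<close>

lemma isometry_linear:
  assumes \<rho>: "bounded_linear \<rho>" "\<And>v. v \<in> SU4 \<Longrightarrow> \<rho> v \<in> SU4" "\<And>v. v \<in> SU4 \<Longrightarrow> f (coset v) = coset (\<rho> v)"
    and \<rho>': "bounded_linear \<rho>'" "\<And>v. v \<in> SU4 \<Longrightarrow> \<rho>' v \<in> SU4"
    and inv: "\<And>v. v \<in> SU4 \<Longrightarrow> \<rho> (\<rho>' v) = v" "\<And>v. v \<in> SU4 \<Longrightarrow> \<rho>' (\<rho> v) = v"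
    and cong: "\<And>u v. u \<in> SU4 \<Longrightarrow> v \<in> SU4 \<Longrightarrow> coset u = coset v \<Longrightarrow> coset (\<rho>' u) = coset (\<rho>' v)"
    and metric: "\<And>u A B. u \<in> SU4 \<Longrightarrow> A \<in> su4 \<Longrightarrow> B \<in> su4 \<Longrightarrow>
      metric (\<rho> u) (\<rho> (u ** A)) (\<rho> (u ** B)) = metric u (u ** A) (u ** B)"
  shows "isometry f"
proof -
  have l: "local_lift f UNIV \<rho>" by (rule local_lift_linear[OF \<rho>])
  have inj: "inj_on f sspace"
  proof (rule inj_onI)
    fix x y assume "x \<in> sspace" "y \<in> sspace" "f x = f y"
    then obtain u v where uv: "u \<in> SU4" "v \<in> SU4" "x = coset u" "y = coset v" "coset (\<rho> u) = coset (\<rho> v)"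
      using \<rho>(3) by (auto simp: sspace_def)
    then have "coset (\<rho>' (\<rho> u)) = coset (\<rho>' (\<rho> v))" using cong \<rho>(2) by blast
    then show "x = y" using uv inv by simp
  qed
  have surj: "f ` sspace = sspace"
  proof (intro equalityI subsetI)
    fix x assume "x \<in> sspace"
    then obtain u where u: "u \<in> SU4" "x = coset u" by (auto simp: sspace_def)
    then have "x = f (coset (\<rho>' u))" using \<rho>(3)[OF \<rho>'(2)] inv by simp
    then show "x \<in> f ` sspace" using u \<rho>'(2) by (auto simp: sspace_def)
  qed (use \<rho> in \<open>auto simp: sspace_def\<close>)
  have "inv_into sspace f (coset v) = coset (\<rho>' v)" if "v \<in> SU4" for v
    using that \<rho>(3)[OF \<rho>'(2)[OF that]] inv \<rho>'(2) by (intro inv_into_f_eq[OF inj]) (auto simp: sspace_def)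
  then have l': "local_lift (inv_into sspace f) UNIV \<rho>'" by (intro local_lift_linear \<rho>')
  have d: "fder \<rho> u = \<rho>" for u
    using bounded_linear_imp_has_derivative[OF \<rho>(1)] frechet_derivative_at by metis
  show ?thesis unfolding isometry_def
  proof (intro conjI allI impI ballI)
    show "bij_betw f sspace sspace" using inj surj by (simp add: bij_betw_def)
    show "smooth_map f" "smooth_map (inv_into sspace f)" using l l' unfolding smooth_map_def by blast+
    fix U F u A B assume F: "local_lift f U F" and u: "u \<in> U \<inter> SU4" and AB: "A \<in> su4" "B \<in> su4"
    then show "metric (F u) (fder F u (u ** A)) (fder F u (u ** B)) = metric u (u ** A) (u ** B)"
      using metric_lift_independent[OF F _ l, of u A B] metric by (simp add: d)
  qed
qed

lemma isometry_translation:
  assumes g: "g \<in> SU4" shows "isometry (translation g)"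
proof (rule isometry_linear[of "\<lambda>v. g ** v" _ "\<lambda>v. adj g ** v"])
  show "metric (g ** u) (g ** (u ** A)) (g ** (u ** B)) = metric u (u ** A) (u ** B)" if "u \<in> SU4" for u A B
    using metric_SU4[OF SU4_mult[OF g that]] metric_SU4[OF that] by (simp add: matrix_mul_assoc)
  show "coset (adj g ** u) = coset (adj g ** v)" if "u \<in> SU4" "v \<in> SU4" "coset u = coset v" for u v
    using coset_mult_cong[OF that(1,2) SU4_adj[OF g] that(3)] .
qed (simp_all add: mm.bounded_linear_right SU4_mult g SU4_adj translation_coset matrix_mul_assoc
       SU4D[OF g])

lemma isometry_cnj:
  assumes g: "g \<in> SU4" shows "isometry (\<lambda>x. translation g (cnj_mat ` x))"
proof (rule isometry_linear[of "\<lambda>v. g ** cnj_mat v" _ "\<lambda>v. cnj_mat (adj g ** v)"])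
  have h: "horizontal (cnj_mat A) = cnj_mat (horizontal A)" for A
    by (simp add: horizontal_def cnj_mat_linear)
  show "metric (g ** cnj_mat u) (g ** cnj_mat (u ** A)) (g ** cnj_mat (u ** B)) = metric u (u ** A) (u ** B)"
    if "u \<in> SU4" for u A B
    using metric_SU4[OF SU4_mult[OF g SU4_cnj[OF that]], of "cnj_mat A" "cnj_mat B"] metric_SU4[OF that]
    by (simp add: matrix_mul_assoc h cnj_mat_mult[of u] trace_cnj_mat flip: cnj_mat_mult[of "horizontal A"])
  show "coset (cnj_mat (adj g ** u)) = coset (cnj_mat (adj g ** v))"
    if "u \<in> SU4" "v \<in> SU4" "coset u = coset v" for u v
    using coset_mult_cong[OF that(1,2) SU4_adj[OF g] that(3)] that g
    by (intro coset_cnj_cong) (auto simp: SU4_mult SU4_adj)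
  show "bounded_linear (\<lambda>v. g ** cnj_mat v)"
    by (rule bounded_linear_compose[OF mm.bounded_linear_right bounded_linear_cnj_mat])
  show "bounded_linear (\<lambda>v. cnj_mat (adj g ** v))"
    by (rule bounded_linear_compose[OF bounded_linear_cnj_mat mm.bounded_linear_right])
qed (simp_all add: SU4_mult g SU4_adj SU4_cnj translation_coset cnj_mat_coset matrix_mul_assoc
       SU4D[OF g])

subsection \<open>Symmetry of second derivatives\<close>

abbreviation fder2 :: "('a::real_normed_vector \<Rightarrow> 'b::real_normed_vector) \<Rightarrow> 'a \<Rightarrow> 'a \<Rightarrow> 'a \<Rightarrow> 'b" where
  "fder2 F v w x \<equiv> frechet_derivative (\<lambda>y. frechet_derivative F (at y) v) (at x) w"

text \<open>The mean value theorem is applied in direction \<open>v\<close> to a difference in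
  direction \<open>w\<close>, and afterwards in direction \<open>w\<close>. Pairing with
  \<open>b\<close> makes the functions real-valued.\<close>

lemma second_difference_mean_value:
  fixes F :: "'a::real_normed_vector \<Rightarrow> 'b::real_inner"
  assumes F: "\<And>x. x \<in> U \<Longrightarrow> F differentiable (at x)"
    and F2: "\<And>x. x \<in> U \<Longrightarrow> (\<lambda>y. frechet_derivative F (at y) v) differentiable (at x)"
    and h: "h > 0" and sq: "\<And>s t. 0 \<le> s \<Longrightarrow> s \<le> h \<Longrightarrow> 0 \<le> t \<Longrightarrow> t \<le> h \<Longrightarrow> u + s *\<^sub>R v + t *\<^sub>R w \<in> U"
  obtains s t where "0 < s" "s < h" "0 < t" "t < h"
    "(F (u + h *\<^sub>R v + h *\<^sub>R w) - F (u + h *\<^sub>R v) - F (u + h *\<^sub>R w) + F u) \<bullet> b =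
       h * h * (fder2 F v w (u + s *\<^sub>R v + t *\<^sub>R w) \<bullet> b)"
proof -
  let ?x = "\<lambda>s t. u + s *\<^sub>R v + t *\<^sub>R w"
  define D where "D x = frechet_derivative F (at x) v" for x
  have d1: "((\<lambda>s. F (?x s t) \<bullet> b) has_real_derivative D (?x s t) \<bullet> b) (at s)"
    if "0 \<le> s" "s \<le> h" "0 \<le> t" "t \<le> h" for s t
  proof -
    have d: "(F has_derivative frechet_derivative F (at (?x s t))) (at (?x s t))"
      using F[OF sq[OF that]] frechet_derivative_works by blast
    have "((\<lambda>s. ?x s t) has_derivative (\<lambda>r. r *\<^sub>R v)) (at s)"
      by (auto intro!: derivative_eq_intros)
    from has_derivative_inner_left[OF has_derivative_compose[OF this d], of b]
    show ?thesis
      using linear_cmul[OF has_derivative_linear[OF d]]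
      by (simp add: has_field_derivative_def D_def o_def mult_commute_abs)
  qed
  have "\<exists>s>0. s < h \<and> (F (?x h h) \<bullet> b - F (?x h 0) \<bullet> b)
      - (F (?x 0 h) \<bullet> b - F (?x 0 0) \<bullet> b) =
      (h - 0) * (D (?x s h) \<bullet> b - D (?x s 0) \<bullet> b)"
    by (rule MVT2[OF h]) (intro DERIV_diff d1; use h in simp)
  then obtain s where s: "0 < s" "s < h"
    "(F (?x h h) \<bullet> b - F (u + h *\<^sub>R v) \<bullet> b) - (F (u + h *\<^sub>R w) \<bullet> b - F u \<bullet> b) =
      h * (D (?x s h) \<bullet> b - D (?x s 0) \<bullet> b)" by auto
  have d2: "((\<lambda>t. D (?x s t) \<bullet> b) has_real_derivative fder2 F v w (?x s t) \<bullet> b) (at t)"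
    if "0 \<le> t" "t \<le> h" for t
  proof -
    have d: "(D has_derivative frechet_derivative D (at (?x s t))) (at (?x s t))"
      unfolding D_def[abs_def] using F2[OF sq] that s frechet_derivative_works by (metis less_imp_le)
    have "((\<lambda>t. ?x s t) has_derivative (\<lambda>r. r *\<^sub>R w)) (at t)"
      by (auto intro!: derivative_eq_intros)
    from has_derivative_inner_left[OF has_derivative_compose[OF this d], of b]
    show ?thesis
      using linear_cmul[OF has_derivative_linear[OF d]]
      by (simp add: has_field_derivative_def D_def[abs_def] o_def mult_commute_abs)
  qed
  have "\<exists>t>0. t < h \<and> D (?x s h) \<bullet> b - D (?x s 0) \<bullet> b =
      (h - 0) * (fder2 F v w (?x s t) \<bullet> b)"
    by (rule MVT2[OF h]) (rule d2)
  then obtain t where "0 < t" "t < h" "D (?x s h) \<bullet> b - D (?x s 0) \<bullet> b =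
      h * (fder2 F v w (?x s t) \<bullet> b)" by auto
  then show thesis using s that by (simp add: inner_diff_left inner_add_left algebra_simps)
qed

text \<open>The second difference over a parallelogram is symmetric in \<open>v\<close> and
  \<open>w\<close>, and it equals a value of either mixed derivative near \<open>u\<close>;
  continuity at \<open>u\<close> concludes.\<close>

theorem symmetric_second_derivative:
  fixes F :: "'a::real_normed_vector \<Rightarrow> 'b::euclidean_space"
  assumes U: "open U" "u \<in> U" and C2: "Ck_on 2 U F"
  shows "fder2 F v w u = fder2 F w v u"
proof (rule euclidean_eqI)
  fix b :: 'b
  have "Ck_on (Suc (Suc 0)) U F" using C2 by (simp add: numeral_2_eq_2)
  then have F: "\<And>x. x \<in> U \<Longrightarrow> F differentiable (at x)"
    and F2: "\<And>v x. x \<in> U \<Longrightarrow> (\<lambda>y. frechet_derivative F (at y) v) differentiable (at x)"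
    and c: "\<And>v w. continuous_on U (fder2 F v w)" by auto
  show "fder2 F v w u \<bullet> b = fder2 F w v u \<bullet> b"
  proof (rule ccontr)
    let ?a = "\<lambda>x. fder2 F v w x \<bullet> b" and ?c = "\<lambda>x. fder2 F w v x \<bullet> b"
    assume ne: "?a u \<noteq> ?c u"
    \<comment> \<open>Half the gap: values within \<epsilon> of two different limits cannot
      coincide.\<close>
    define \<epsilon> where "\<epsilon> = \<bar>?a u - ?c u\<bar> / 2"
    have \<epsilon>: "\<epsilon> > 0" using ne by (simp add: \<epsilon>_def)
    have "continuous_on U ?a" "continuous_on U ?c" by (intro continuous_intros c)+
    then have "isCont ?a u" "isCont ?c u" using U by (auto simp: continuous_on_eq_continuous_at)
    then obtain d1 d2 where d: "d1 > 0" "d2 > 0"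
      "\<And>x. dist x u < d1 \<Longrightarrow> dist (?a x) (?a u) < \<epsilon>" "\<And>x. dist x u < d2 \<Longrightarrow> dist (?c x) (?c u) < \<epsilon>"
      using \<epsilon> unfolding continuous_at_eps_delta by (metis dist_norm)
    obtain d3 where d3: "d3 > 0" "ball u d3 \<subseteq> U" using U open_contains_ball by blast
    define d where "d = min d1 (min d2 d3)"
    \<comment> \<open>Small enough to keep the whole parallelogram strictly within distance
      \<open>d\<close> of \<open>u\<close>; the summand 1 covers vanishing \<open>v\<close> and
      \<open>w\<close>.\<close>
    define h where "h = d / (1 + norm v + norm w) / 2"
    have dp: "d > 0" using d d3 by (simp add: d_def)
    have np: "1 + norm v + norm w > 0" by (simp add: add_pos_nonneg)
    have h: "h > 0" using dp np by (simp add: h_def)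
    have "h * (1 + norm v + norm w) = d / 2" using np by (simp add: h_def field_simps)
    then have hd: "h * norm v + h * norm w < d" using dp h by (simp add: algebra_simps)
    let ?x = "\<lambda>s t. u + s *\<^sub>R v + t *\<^sub>R w"
    have close: "dist (?x s t) u < d" if "0 \<le> s" "s \<le> h" "0 \<le> t" "t \<le> h" for s t
    proof -
      have "dist (?x s t) u = norm (s *\<^sub>R v + t *\<^sub>R w)" by (simp add: dist_norm add.assoc)
      also have "\<dots> \<le> s * norm v + t * norm w" using that by (intro norm_triangle_le) simp
      also have "\<dots> \<le> h * norm v + h * norm w" using that by (intro add_mono mult_right_mono) auto
      finally show ?thesis using hd by simp
    qed
    then have sqU: "?x s t \<in> U" if "0 \<le> s" "s \<le> h" "0 \<le> t" "t \<le> h" for s t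
      using that d3 by (force simp: d_def dist_commute)
    obtain s t where 1: "0 < s" "s < h" "0 < t" "t < h"
      "(F (u + h *\<^sub>R v + h *\<^sub>R w) - F (u + h *\<^sub>R v) - F (u + h *\<^sub>R w) + F u) \<bullet> b = h * h * ?a (?x s t)"
      using second_difference_mean_value[where U = U and u = u and v = v and w = w and b = b, OF F F2 h sqU] by blast
    have sqU': "u + s *\<^sub>R w + t *\<^sub>R v \<in> U" if "0 \<le> s" "s \<le> h" "0 \<le> t" "t \<le> h" for s t
      using sqU[OF that(3,4,1,2)] by (simp add: algebra_simps)
    obtain s' t' where 2: "0 < s'" "s' < h" "0 < t'" "t' < h"
      "(F (u + h *\<^sub>R w + h *\<^sub>R v) - F (u + h *\<^sub>R w) - F (u + h *\<^sub>R v) + F u) \<bullet> b = h * h * ?c (u + s' *\<^sub>R w + t' *\<^sub>R v)"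
      using second_difference_mean_value[where U = U and u = u and v = w and w = v and b = b, OF F F2 h sqU'] by blast
    have "h * h * ?a (?x s t) = h * h * ?c (?x t' s')"
      using 1(5) 2(5) by (simp add: algebra_simps)
    then have "?a (?x s t) = ?c (?x t' s')" using h by simp
    moreover have "dist (?a (?x s t)) (?a u) < \<epsilon>"
      by (intro d(3) order.strict_trans2[OF close]) (use 1 in \<open>auto simp: d_def\<close>)
    moreover have "dist (?c (?x t' s')) (?c u) < \<epsilon>"
      by (intro d(4) order.strict_trans2[OF close]) (use 2 in \<open>auto simp: d_def\<close>)
    ultimately show False by (auto simp: dist_real_def \<epsilon>_def abs_if split: if_splits)
  qed
qed

lemma fder_linear_sum:
  fixes F :: "'a::euclidean_space \<Rightarrow> 'b::real_normed_vector"
  assumes "F differentiable (at x)"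
  shows "frechet_derivative F (at x) m = (\<Sum>b\<in>Basis. (m \<bullet> b) *\<^sub>R frechet_derivative F (at x) b)"
proof -
  have l: "linear (frechet_derivative F (at x))" using assms by (simp add: linear_frechet_derivative)
  have "frechet_derivative F (at x) m = frechet_derivative F (at x) (\<Sum>b\<in>Basis. (m \<bullet> b) *\<^sub>R b)"
    by (simp add: euclidean_representation)
  then show ?thesis by (simp add: linear_sum[OF l] linear_cmul[OF l])
qed

text \<open>\<open>Ck_on\<close> differentiates the derivative of \<open>F\<close> only in a fixed
  direction. Expanding the moving direction \<open>m\<close> in a basis reduces to that
  case.\<close>

lemma fder_curve_has_vector_derivative:
  fixes F :: "'a::euclidean_space \<Rightarrow> 'b::real_normed_vector" and c m :: "real \<Rightarrow> 'a"
  assumes U: "open U" "c t \<in> U" and C2: "Ck_on 2 U F"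
    and c: "(c has_vector_derivative c') (at t)" and m: "(m has_vector_derivative m') (at t)"
  shows "((\<lambda>s. frechet_derivative F (at (c s)) (m s)) has_vector_derivative
    fder2 F (m t) c' (c t) + frechet_derivative F (at (c t)) m') (at t)"
proof -
  have "Ck_on (Suc (Suc 0)) U F" using C2 by (simp add: numeral_2_eq_2)
  then have F: "\<And>x. x \<in> U \<Longrightarrow> F differentiable (at x)"
    and F2: "\<And>v x. x \<in> U \<Longrightarrow> (\<lambda>y. frechet_derivative F (at y) v) differentiable (at x)" by auto
  have D2: "((\<lambda>y. frechet_derivative F (at y) v) has_derivative (\<lambda>w. fder2 F v w (c t))) (at (c t))" for v
    using F2[OF U(2)] frechet_derivative_works by blast
  have "((\<lambda>y. frechet_derivative F (at y) v) has_derivative (\<lambda>w. \<Sum>b\<in>Basis. (v \<bullet> b) *\<^sub>R fder2 F b w (c t))) (at (c t))" for v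
  proof (rule has_derivative_transform_within_open[OF _ U])
    show "((\<lambda>y. \<Sum>b\<in>Basis. (v \<bullet> b) *\<^sub>R frechet_derivative F (at y) b) has_derivative
        (\<lambda>w. \<Sum>b\<in>Basis. (v \<bullet> b) *\<^sub>R fder2 F b w (c t))) (at (c t))"
      by (intro has_derivative_sum has_derivative_scaleR_right D2)
  qed (metis fder_linear_sum F)
  from has_derivative_unique[OF this D2]
  have lin: "fder2 F v w (c t) = (\<Sum>b\<in>Basis. (v \<bullet> b) *\<^sub>R fder2 F b w (c t))" for v w
    by (metis (no_types, lifting))
  have D2c: "((\<lambda>s. frechet_derivative F (at (c s)) b) has_vector_derivative fder2 F b c' (c t)) (at t)" for b
  proof -
    have "((\<lambda>s. frechet_derivative F (at (c s)) b) has_derivative (\<lambda>x. fder2 F b (x *\<^sub>R c') (c t))) (at t)"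
      by (rule has_derivative_compose[OF c[unfolded has_vector_derivative_def] D2])
    then show ?thesis
      using linear_cmul[OF has_derivative_linear[OF D2]] by (simp add: has_vector_derivative_def)
  qed
  have mb: "((\<lambda>s. m s \<bullet> b) has_vector_derivative m' \<bullet> b) (at t)" for b
    by (rule bounded_linear.has_vector_derivative[OF bounded_linear_inner_left m])
  have "((\<lambda>s. \<Sum>b\<in>Basis. (m s \<bullet> b) *\<^sub>R frechet_derivative F (at (c s)) b) has_vector_derivative
    (\<Sum>b\<in>Basis. (m t \<bullet> b) *\<^sub>R fder2 F b c' (c t) + (m' \<bullet> b) *\<^sub>R frechet_derivative F (at (c t)) b)) (at t)"
    by (intro has_vector_derivative_sum bounded_bilinear.has_vector_derivative[OF bounded_bilinear_scaleR] mb D2c)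
  moreover have "(\<Sum>b\<in>Basis. (m t \<bullet> b) *\<^sub>R fder2 F b c' (c t) + (m' \<bullet> b) *\<^sub>R frechet_derivative F (at (c t)) b) =
     fder2 F (m t) c' (c t) + frechet_derivative F (at (c t)) m'"
    using lin[of "m t" c'] fder_linear_sum[OF F[OF U(2)], of m'] by (simp add: sum.distrib)
  ultimately have d: "((\<lambda>s. \<Sum>b\<in>Basis. (m s \<bullet> b) *\<^sub>R frechet_derivative F (at (c s)) b) has_vector_derivative
     fder2 F (m t) c' (c t) + frechet_derivative F (at (c t)) m') (at t)" by simp
  have "isCont c t" using c has_vector_derivative_continuous by blast
  then obtain S where S: "open S" "t \<in> S" "\<And>s. s \<in> S \<Longrightarrow> c s \<in> U"
    using U unfolding continuous_at_open by metis
  show ?thesis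
    by (rule has_vector_derivative_transform_within_open[OF d S(1,2)]) (metis fder_linear_sum F S(3))
qed

subsection \<open>Isometries preserve geodesics\<close>

text \<open>Minus the inner product of the Riemannian metric, hence negative definite on \<^const>\<open>pp\<close>.\<close>

definition ip :: "cmat \<Rightarrow> cmat \<Rightarrow> real" where
  "ip X Y = Re (trace (X ** Y))"

lemma bounded_bilinear_ip: "bounded_bilinear ip"
  unfolding bilinear_conv_bounded_bilinear[symmetric] bilinear_def
  by (auto intro!: linearI simp: ip_def mult_linear trace_linear)

interpretation ip: bounded_bilinear ip
  by (rule bounded_bilinear_ip)

lemma ip_commute: "ip X Y = ip Y X"
  unfolding ip_def by (subst trace_mul_sym) simp

lemma ip_cyclic: "ip (X ** Y) Z = ip Y (Z ** X)"
proof -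
  have "trace (X ** Y ** Z) = trace (X ** (Y ** Z))" by (simp add: matrix_mul_assoc)
  also have "\<dots> = trace (Y ** Z ** X)" by (rule trace_mul_sym)
  finally show ?thesis by (simp add: ip_def matrix_mul_assoc)
qed

lemma scaleR_scal: "r *\<^sub>R A = scal (complex_of_real r) A"
  by (rule mat_eqI) (simp add: complex_eq_iff)

text \<open>The entries are symmetric and purely imaginary, so the product of opposite entries is
  minus a squared modulus.\<close>

lemma ip_pp_self: "X \<in> pp \<Longrightarrow> ip X X = - (\<Sum>i\<in>UNIV. \<Sum>j\<in>UNIV. (cmod (X $ i $ j))\<^sup>2)"
proof -
  assume X: "X \<in> pp"
  have "X $ i $ j * X $ j $ i = - complex_of_real ((cmod (X $ i $ j))\<^sup>2)" for i j
  proof -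
    have "transpose X $ i $ j = X $ i $ j" "(- cnj_mat X) $ i $ j = X $ i $ j"
      using X by (simp_all add: pp_def)
    then have t: "X $ j $ i = X $ i $ j" and e: "X $ i $ j = - cnj (X $ i $ j)"
      by (simp_all add: transpose_nth)
    have "X $ i $ j * X $ j $ i = X $ i $ j * - cnj (X $ i $ j)"
      by (subst t, subst (2) e, rule refl)
    then show ?thesis by (simp only: complex_norm_square mult_minus_right)
  qed
  then have "trace (X ** X) = - complex_of_real (\<Sum>i\<in>UNIV. \<Sum>j\<in>UNIV. (cmod (X $ i $ j))\<^sup>2)"
    by (simp add: trace_def matrix_mult_nth sum_negf)
  then show ?thesis by (simp add: ip_def)
qed

lemma ip_pp_definite: "X \<in> pp \<Longrightarrow> ip X X = 0 \<Longrightarrow> X = 0"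
  by (rule mat_eqI) (simp add: ip_pp_self sum_nonneg_eq_0_iff sum_nonneg)

lemma pexp_scaleR: "X \<in> pp \<Longrightarrow> pexp (r *\<^sub>R X) t = pexp X (r * t)"
proof (erule pexp_form)
  fix S x assume S: "orthogonal_matrix S" "X = idiag S x"
    and x: "sum x UNIV = (0::real)" and e: "\<And>t. pexp X t = rdiag S (\<lambda>i. cis (t * x i))"
  have "r *\<^sub>R X = rdiag S (\<lambda>i. \<i> * complex_of_real (r * x i))"
    by (simp add: S scaleR_scal scal_rdiag mult_ac)
  moreover have "(\<Sum>i\<in>UNIV. r * x i) = 0" using x by (simp flip: sum_distrib_left)
  ultimately show ?thesis using pexp_rdiag[OF S(1), of "\<lambda>i. r * x i" t] by (simp add: e mult_ac)
qed

lemma vanishing_has_vector_derivative: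
  assumes L: "bounded_linear L" and f: "(f has_vector_derivative f') (at t)"
    and S: "open S" "t \<in> S" "\<And>s. s \<in> S \<Longrightarrow> L (f s) = 0"
  shows "L f' = 0"
proof (rule vector_derivative_unique_at)
  show "((\<lambda>s. L (f s)) has_vector_derivative L f') (at t)"
    by (rule bounded_linear.has_vector_derivative[OF L f])
  show "((\<lambda>s. L (f s)) has_vector_derivative 0) (at t)"
    by (rule has_vector_derivative_transform_within_open[OF has_vector_derivative_const S(1,2)]) (simp add: S(3))
qed

lemma pp_has_vector_derivative:
  assumes f: "(f has_vector_derivative f') (at t)" and S: "open S" "t \<in> S" "\<And>s. s \<in> S \<Longrightarrow> f s \<in> pp"
  shows "f' \<in> pp"
proof -
  have "transpose f' - f' = 0"
    by (rule vanishing_has_vector_derivative[where L = "\<lambda>A. transpose A - A", OF _ f S(1,2)])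
      (use S(3) in \<open>auto simp: pp_def intro: bounded_linear_sub bounded_linear_transpose bounded_linear_ident\<close>)
  moreover have "cnj_mat f' + f' = 0"
    by (rule vanishing_has_vector_derivative[where L = "\<lambda>A. cnj_mat A + A", OF _ f S(1,2)])
      (use S(3) in \<open>auto simp: pp_def intro: bounded_linear_add bounded_linear_cnj_mat bounded_linear_ident\<close>)
  moreover have "trace f' = 0"
    by (rule vanishing_has_vector_derivative[OF bounded_linear_trace f S(1,2)]) (use S(3) in \<open>auto simp: pp_def\<close>)
  ultimately show ?thesis by (simp add: pp_def eq_neg_iff_add_eq_0)
qed

lemma isometry_ip:
  assumes f: "isometry f" and F: "local_lift f U F" "u \<in> U" and u: "u \<in> SU4" and AB: "A \<in> su4" "B \<in> su4"
  shows "ip (horizontal (lder F u A)) (horizontal (lder F u B)) = ip (horizontal A) (horizontal B)"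
proof -
  have "metric (F u) (fder F u (u ** A)) (fder F u (u ** B)) = metric u (u ** A) (u ** B)"
    using f F u AB unfolding isometry_def by blast
  then show ?thesis using metric_lder[OF F u] metric_SU4[OF u] by (simp add: ip_def)
qed

text \<open>Preservation of a definite form gives injectivity on \<open>pp\<close>, and equality of
  dimensions gives surjectivity.\<close>

lemma isometry_horizontal_surj:
  assumes f: "isometry f" and F: "local_lift f U F" "u \<in> U" and u: "u \<in> SU4"
  shows "(\<lambda>X. horizontal (lder F u X)) ` pp = pp"
proof -
  let ?h = "\<lambda>X. horizontal (lder F u X)"
  have lin: "linear ?h" using lder_linear[OF F]
    by (auto intro!: linearI simp: linear_add linear_cmul horizontal_linear)
  have sub: "?h ` pp \<subseteq> pp" using lder_su4[OF F u] pp_su4 horizontal_su4 by blast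
  have "inj_on ?h (span pp)"
  proof (subst linear_inj_on_iff_eq_0[OF lin])
    show "subspace (span pp)" by simp
    show "\<forall>x\<in>span pp. ?h x = 0 \<longrightarrow> x = 0"
    proof (intro ballI impI)
      fix X assume "X \<in> span pp" and 0: "?h X = 0"
      then have X: "X \<in> pp" using span_eq_iff subspace_pp by blast
      have "ip X X = ip (?h X) (?h X)"
        using isometry_ip[OF f F u pp_su4[OF X] pp_su4[OF X]] by (simp add: horizontal_pp[OF X])
      then show "X = 0" using 0 ip_pp_definite[OF X] by (simp add: ip.zero_left)
    qed
  qed
  then have "dim (?h ` pp) = dim pp" by (rule dim_image_eq[OF lin])
  then show ?thesis
    using subspace_dim_equal[OF linear_subspace_image[OF lin subspace_pp] subspace_pp sub] by simp
qed

text \<open>For \<open>u\<close> in \<open>SU4\<close> and \<open>B\<close> in \<open>pp\<close>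
  this is the derivative of \<open>lder F\<close> applied to \<open>A\<close> in the direction
  \<open>u ** B\<close>. The subtracted product comes from differentiating \<open>adj (F u)\<close>,
  since \<open>lder F u B\<close> is skew-adjoint.\<close>

definition lder2 :: "(cmat \<Rightarrow> cmat) \<Rightarrow> cmat \<Rightarrow> cmat \<Rightarrow> cmat \<Rightarrow> cmat" where
  "lder2 F u A B = adj (F u) ** (fder2 F (u ** A) (u ** B) u + fder F u (u ** B ** A)) - lder F u B ** lder F u A"

lemma lder_has_vector_derivative:
  assumes F: "local_lift f U F" "u ** pexp B t \<in> U" and u: "u \<in> SU4" and B: "B \<in> pp"
  shows "((\<lambda>s. lder F (u ** pexp B s) A) has_vector_derivative lder2 F (u ** pexp B t) A B) (at t)"
proof -
  let ?c = "\<lambda>s. u ** pexp B s"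
  have cS: "?c t \<in> SU4" using u B by (simp add: SU4_mult pexp_SU4)
  note FU = SU4D[OF local_liftD(3)[OF F cS]]
  have c: "(?c has_vector_derivative ?c t ** B) (at t)"
    using has_vector_derivative_mult_right[OF pexp_has_vector_derivative[OF B], of u t UNIV]
    by (simp add: pexp_commute[OF B, symmetric] matrix_mul_assoc)
  have Fc: "((\<lambda>s. F (?c s)) has_vector_derivative F (?c t) ** lder F (?c t) B) (at t)"
    using local_lift_curve[OF F c] by (simp add: lder_def matrix_mul_assoc FU)
  have "((\<lambda>s. fder F (?c s) (?c s ** A)) has_vector_derivative
      fder2 F (?c t ** A) (?c t ** B) (?c t) + fder F (?c t) (?c t ** B ** A)) (at t)"
    by (rule fder_curve_has_vector_derivative[OF local_liftD(1)[OF F(1)] F(2) local_liftD(2)[OF F(1)] c])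
       (rule has_vector_derivative_mult_left[OF c])
  from mm.has_vector_derivative[OF
      has_vector_derivative_adj[OF Fc] this]
  have "((\<lambda>s. lder F (?c s) A) has_vector_derivative
      adj (F (?c t)) ** (fder2 F (?c t ** A) (?c t ** B) (?c t) + fder F (?c t) (?c t ** B ** A)) +
      adj (F (?c t) ** lder F (?c t) B) ** fder F (?c t) (?c t ** A)) (at t)"
    by (simp only: lder_def)
  moreover have "adj (F (?c t) ** lder F (?c t) B) ** fder F (?c t) (?c t ** A) = - (lder F (?c t) B ** lder F (?c t) A)"
    using lder_su4[OF F cS pp_su4[OF B]]
    by (simp add: adj_mult su4_def mult_linear) (simp add: lder_def matrix_mul_assoc)
  ultimately show ?thesis by (simp add: lder2_def)
qed

lemma local_lift_neighbourhood:
  assumes F: "local_lift f U F" "u ** pexp B t \<in> U" and B: "B \<in> pp"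
  obtains e where "e > 0" "\<forall>s\<in>ball t e. u ** pexp B s \<in> U"
proof -
  have "continuous_on UNIV (\<lambda>s. u ** pexp B s)" by (intro continuous_intros continuous_on_pexp B)
  then have "open ((\<lambda>s. u ** pexp B s) -` U)" using local_liftD(1)[OF F(1)] by (simp add: open_vimage)
  then obtain e where "e > 0" "ball t e \<subseteq> (\<lambda>s. u ** pexp B s) -` U"
    using F(2) open_contains_ball by (metis vimageI)
  then show thesis using that by blast
qed

text \<open>Differentiating the isometry condition along \<open>B\<close>; the uniqueness of the Levi-Civita connection
  follows from this identity and the symmetry of second derivatives.\<close>

lemma isometry_lder2_skew:
  assumes f: "isometry f" and F: "local_lift f U F" "u \<in> U" and u: "u \<in> SU4"
    and A: "A \<in> pp" "A' \<in> pp" and B: "B \<in> pp"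
  shows "ip (horizontal (lder2 F u A B)) (horizontal (lder F u A')) +
    ip (horizontal (lder F u A)) (horizontal (lder2 F u A' B)) = 0"
proof -
  let ?c = "\<lambda>s. u ** pexp B s"
  have c0: "?c 0 = u" using B by (simp add: pexp_0)
  obtain e where e: "e > 0" "\<forall>s\<in>ball 0 e. ?c s \<in> U"
    using local_lift_neighbourhood[of f U F u B 0] F B c0 by metis
  have T: "((\<lambda>s. horizontal (lder F (?c s) A)) has_vector_derivative horizontal (lder2 F u A B)) (at 0)" for A
    using has_vector_derivative_horizontal[OF
      lder_has_vector_derivative[OF F(1) _ u B, of 0 A]] F(2) c0 by simp
  have "((\<lambda>s. ip (horizontal (lder F (?c s) A)) (horizontal (lder F (?c s) A'))) has_vector_derivative
    ip (horizontal (lder F (?c 0) A)) (horizontal (lder2 F u A' B)) +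
    ip (horizontal (lder2 F u A B)) (horizontal (lder F (?c 0) A'))) (at 0)"
    by (intro ip.has_vector_derivative T)
  moreover have "((\<lambda>s. ip (horizontal (lder F (?c s) A)) (horizontal (lder F (?c s) A'))) has_vector_derivative 0) (at 0)"
    by (rule has_vector_derivative_transform_within_open[OF has_vector_derivative_const open_ball, of 0 0 e "ip (horizontal A) (horizontal A')"])
       (use e isometry_ip[OF f F(1) _ SU4_mult[OF u pexp_SU4[OF B]] pp_su4[OF A(1)] pp_su4[OF A(2)]] in auto)
  ultimately show ?thesis using vector_derivative_unique_at by (fastforce simp: c0 add.commute)
qed

text \<open>Vertical vectors are null for the pulled-back metric, while \<open>ip\<close> is
  definite on \<open>pp\<close>.\<close>

lemma isometry_lder_vertical:
  assumes f: "isometry f" and F: "local_lift f U F" "u \<in> U" and u: "u \<in> SU4"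
    and C: "C \<in> su4" "horizontal C = 0"
  shows "horizontal (lder F u C) = 0"
proof (rule ip_pp_definite)
  show "horizontal (lder F u C) \<in> pp" using horizontal_su4 lder_su4[OF F u C(1)] by blast
  show "ip (horizontal (lder F u C)) (horizontal (lder F u C)) = 0"
    using isometry_ip[OF f F u C(1) C(1)] C(2) by (simp add: ip.zero_left)
qed

text \<open>The geodesic equation for the image curve in the left trivialisation, where \<sigma> is
  the vertical part of its velocity. The defect \<open>d\<close> lies in \<open>pp\<close> and is
  orthogonal to the horizontal images of all \<open>Y\<close> in \<open>pp\<close>; these fill
  \<open>pp\<close>, so \<open>d\<close> vanishes.\<close>

lemma isometry_covariant_derivative:
  assumes f: "isometry f" and F: "local_lift f U F" "u \<in> U" and u: "u \<in> SU4" and X: "X \<in> pp"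
  defines "p \<equiv> horizontal (lder F u X)"
  defines "\<sigma> \<equiv> lder F u X - p"
  shows "horizontal (lder2 F u X X) = p ** \<sigma> - \<sigma> ** p"
proof -
  let ?T = "lder F u" and ?N = "lder2 F u"
  have TX: "?T X = \<sigma> + p" by (simp add: \<sigma>_def)
  have p: "p \<in> pp" unfolding p_def using horizontal_su4 lder_su4[OF F u pp_su4[OF X]] by blast
  have real: "cnj_mat (A - horizontal A) = A - horizontal A" for A
    by (rule mat_eqI) (simp add: horizontal_def complex_eq_iff)
  have \<sigma>: "cnj_mat \<sigma> = \<sigma>" unfolding \<sigma>_def p_def by (rule real)
  have hp: "horizontal (M ** N) = M ** N" "horizontal (N ** M) = N ** M" if "cnj_mat M = M" "cnj_mat N = - N" for M N
    by (simp_all add: horizontal_def cnj_mat_mult that mult_linear flip: scaleR_2)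
  have h0: "horizontal (M ** N) = 0" if "cnj_mat M = M" "cnj_mat N = N" for M N
    by (simp add: horizontal_def cnj_mat_mult that)
  have h0': "horizontal (M ** N) = 0" if "cnj_mat M = - M" "cnj_mat N = - N" for M N
    by (simp add: horizontal_def cnj_mat_mult that mult_linear)
  have cp: "cnj_mat M = - M" "transpose M = M" "adj M = - M" if "M \<in> pp" for M
    using that pp_su4[OF that] by (simp_all add: pp_def su4_def)
  define d where "d = horizontal (?N X X) - (p ** \<sigma> - \<sigma> ** p)"
  have test: "ip d (horizontal (?T Y)) = 0" if Y: "Y \<in> pp" for Y
  proof -
    define q where "q = horizontal (?T Y)"
    define \<tau> where "\<tau> = ?T Y - q"
    have q: "q \<in> pp" unfolding q_def using horizontal_su4 lder_su4[OF F u pp_su4[OF Y]] by blast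
    have \<tau>: "cnj_mat \<tau> = \<tau>" unfolding \<tau>_def q_def by (rule real)
    have TY: "?T Y = \<tau> + q" by (simp add: \<tau>_def)
    \<comment> \<open>The commutator measures the failure of \<open>lder2\<close> to be symmetric.
      For two elements of \<open>pp\<close> it is vertical, so its image has no horizontal
      part.\<close>
    let ?C = "X ** Y - Y ** X"
    have "?C \<in> su4" using X Y
      by (simp add: su4_def adj_linear adj_mult cp mult_linear trace_linear trace_mul_sym[of X])
    moreover have "horizontal ?C = 0" using X Y by (simp add: horizontal_linear h0' cp)
    ultimately have C: "horizontal (?T ?C) = 0" by (rule isometry_lder_vertical[OF f F u])
    have "fder2 F (u ** Y) (u ** X) u = fder2 F (u ** X) (u ** Y) u"
      by (rule symmetric_second_derivative[OF local_liftD(1)[OF F(1)] F(2) local_liftD(2)[OF F(1)]])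
    moreover have "fder F u (u ** X ** Y) = fder F u (u ** Y ** X) + fder F u (u ** ?C)"
      by (simp add: mult_linear matrix_mul_assoc linear_diff[OF linear_fder[OF F]])
    ultimately have "?N Y X = ?N X Y + ?T ?C + ?T Y ** ?T X - ?T X ** ?T Y"
      by (simp add: lder2_def) (simp add: lder_def mult_linear)
    then have "horizontal (?N Y X) = horizontal (?N X Y) + horizontal (?T Y ** ?T X - ?T X ** ?T Y)"
      using C by (simp add: horizontal_linear)
    also have "horizontal (?T Y ** ?T X - ?T X ** ?T Y) = \<tau> ** p + q ** \<sigma> - \<sigma> ** q - p ** \<tau>"
      using \<sigma> \<tau> cp[OF p] cp[OF q]
      by (simp add: TX TY mult_linear horizontal_linear hp h0 h0')
    finally have NYX: "horizontal (?N Y X) = horizontal (?N X Y) + (\<tau> ** p + q ** \<sigma> - \<sigma> ** q - p ** \<tau>)" .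
    \<comment> \<open>The skew identity along \<open>X\<close> moves the second derivative onto
      \<open>Y\<close>; by symmetry it is replaced by the one along \<open>Y\<close>, where
      constancy of the length of the image of \<open>X\<close> makes its pairing with
      \<open>p\<close> vanish.\<close>
    have "ip (horizontal (?N X X)) q = - ip p (horizontal (?N Y X))"
      using isometry_lder2_skew[OF f F u X Y X] unfolding p_def q_def by simp
    moreover have "ip p (horizontal (?N X Y)) = 0"
      using isometry_lder2_skew[OF f F u X X Y] ip_commute[of p] unfolding p_def by simp
    moreover have "ip p (\<tau> ** p) = ip p (p ** \<tau>)"
      by (metis ip_commute ip_cyclic)
    moreover have "ip p (q ** \<sigma>) = ip (\<sigma> ** p) q" "ip p (\<sigma> ** q) = ip (p ** \<sigma>) q"
      by (metis ip_commute ip_cyclic)+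
    ultimately have "ip (horizontal (?N X X)) q = ip (p ** \<sigma>) q - ip (\<sigma> ** p) q"
      by (simp add: NYX ip.add_right ip.diff_right)
    then show ?thesis by (simp add: d_def q_def ip.diff_left)
  qed
  have "d \<in> pp"
  proof -
    let ?c = "\<lambda>s. u ** pexp X s"
    have c0: "?c 0 = u" using X by (simp add: pexp_0)
    obtain e where e: "e > 0" "\<forall>s\<in>ball 0 e. ?c s \<in> U"
      using local_lift_neighbourhood[of f U F u X 0] F X c0 by metis
    have "((\<lambda>s. horizontal (lder F (?c s) X)) has_vector_derivative horizontal (?N X X)) (at 0)"
      using has_vector_derivative_horizontal[OF
        lder_has_vector_derivative[OF F(1) _ u X, of 0 X]] F(2) c0 by simp
    then have "horizontal (?N X X) \<in> pp"
      by (rule pp_has_vector_derivative[OF _ open_ball, of _ _ 0 0 e])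
         (use e lder_su4[OF F(1) _ SU4_mult[OF u pexp_SU4[OF X]] pp_su4[OF X]] in \<open>auto intro: horizontal_su4\<close>)
    moreover have "transpose \<sigma> = - \<sigma>"
    proof -
      have "transpose (?T X) = - cnj_mat (?T X)"
        using su4_cnj_mat[OF lder_su4[OF F u pp_su4[OF X]]] by simp
      then show ?thesis using cp[OF p] \<sigma> by (simp add: TX transpose_linear cnj_mat_linear)
    qed
    then have "p ** \<sigma> - \<sigma> ** p \<in> pp"
      using cp[OF p] \<sigma> by (simp add: pp_def transpose_linear matrix_transpose_mul cnj_mat_linear cnj_mat_mult
        mult_linear trace_linear trace_mul_sym[of p])
    ultimately show ?thesis unfolding d_def by (rule subspace_diff[OF subspace_pp])
  qed
  moreover from this obtain Y where "Y \<in> pp" "horizontal (?T Y) = d"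
    using isometry_horizontal_surj[OF f F u] by (metis imageE)
  ultimately have "d = 0" using ip_pp_definite test by metis
  then show ?thesis by (simp add: d_def)
qed

lemma sq_geodesic: "Y \<in> pp \<Longrightarrow> sq (g ** pexp Y t) = g ** pexp Y (2 * t) ** transpose g"
  by (simp add: sq_mult sq_pexp)

text \<open>The lifted curve \<open>g\<close> may drift along the stabiliser, so the explicit
  solution is obtained for \<open>sq (g s)\<close> instead: the geodesic equation says that its
  logarithmic derivative is constant.\<close>

lemma isometry_local_geodesic:
  assumes f: "isometry f" and F: "local_lift f U F" and u: "u \<in> SU4" and X: "X \<in> pp" and U: "u ** pexp X t0 \<in> U"
  defines "g0 \<equiv> F (u ** pexp X t0)" and "P \<equiv> horizontal (lder F (u ** pexp X t0) X)"
  obtains e where "e > 0" "g0 \<in> SU4" "P \<in> pp"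
    "\<forall>t\<in>ball t0 e. f (coset (u ** pexp X t)) = coset (g0 ** pexp P (t - t0))"
proof -
  let ?c = "\<lambda>s. u ** pexp X s"
  obtain e where e: "e > 0" "\<forall>s\<in>ball t0 e. ?c s \<in> U"
    using local_lift_neighbourhood[OF F U X] .
  let ?I = "ball t0 e"
  have cS: "?c s \<in> SU4" for s using u X by (simp add: SU4_mult pexp_SU4)
  have t0: "t0 \<in> ?I" using e by simp
  define g where "g s = F (?c s)" for s
  define p where "p s = horizontal (lder F (?c s) X)" for s
  have gS: "g s \<in> SU4" if "s \<in> ?I" for s using local_liftD(3)[OF F] cS e that by (simp add: g_def)
  have pP: "p s \<in> pp" if "s \<in> ?I" for s
    using horizontal_su4[OF lder_su4[OF F _ cS pp_su4[OF X]]] e that by (simp add: p_def)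
  have g': "(g has_vector_derivative g s ** lder F (?c s) X) (at s)" if s: "s \<in> ?I" for s
  proof -
    have "(?c has_vector_derivative ?c s ** X) (at s)"
      using has_vector_derivative_mult_right[OF pexp_has_vector_derivative[OF X], of u s UNIV]
      by (simp add: pexp_commute[OF X, symmetric] matrix_mul_assoc)
    from local_lift_curve[OF F _ this] e s
    have "(g has_vector_derivative fder F (?c s) (?c s ** X)) (at s)" by (simp add: g_def[abs_def])
    moreover have "g s ** lder F (?c s) X = fder F (?c s) (?c s ** X)"
      using SU4D[OF gS[OF s]] by (simp add: lder_def matrix_mul_assoc g_def)
    ultimately show ?thesis by simp
  qed
  \<comment> \<open>Half of the left logarithmic derivative of \<open>sq (g s)\<close>; its
    constancy is conservation of momentum.\<close>
  define a where "a s = cnj_mat (g s) ** p s ** transpose (g s)" for s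
  have a': "(a has_vector_derivative 0) (at s)" if s: "s \<in> ?I" for s
  proof -
    define T where "T = lder F (?c s) X"
    define \<sigma> where "\<sigma> = T - p s"
    have T: "T = \<sigma> + p s" by (simp add: \<sigma>_def)
    have Ts: "T \<in> su4" unfolding T_def by (rule lder_su4[OF F _ cS pp_su4[OF X]]) (use e s in blast)
    have \<sigma>: "cnj_mat \<sigma> = \<sigma>"
      unfolding \<sigma>_def p_def T_def[symmetric] by (rule mat_eqI) (simp add: horizontal_def complex_eq_iff)
    have cT: "cnj_mat T = \<sigma> - p s" using \<sigma> pP[OF s] by (simp add: T cnj_mat_linear pp_def)
    have "transpose T = - cnj_mat T" using su4_cnj_mat[OF Ts] by simp
    with cT have tT: "transpose T = p s - \<sigma>" by simp
    have "horizontal (lder2 F (?c s) X X) = p s ** \<sigma> - \<sigma> ** p s"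
      using isometry_covariant_derivative[OF f F _ cS X] e s unfolding p_def \<sigma>_def T_def by blast
    then have p': "(p has_vector_derivative p s ** \<sigma> - \<sigma> ** p s) (at s)"
      using has_vector_derivative_horizontal[OF
        lder_has_vector_derivative[OF F _ u X, of s X]] e s by (simp add: p_def[abs_def])
    have "(a has_vector_derivative (cnj_mat (g s) ** p s) ** transpose (g s ** T) +
       (cnj_mat (g s) ** (p s ** \<sigma> - \<sigma> ** p s) + cnj_mat (g s ** T) ** p s) ** transpose (g s)) (at s)"
      unfolding a_def[abs_def] T_def
      by (intro mm.has_vector_derivative p'
        has_vector_derivative_cnj_mat
        has_vector_derivative_transpose g'[OF s])
    moreover have "(cnj_mat (g s) ** p s) ** transpose (g s ** T) +
       (cnj_mat (g s) ** (p s ** \<sigma> - \<sigma> ** p s) + cnj_mat (g s ** T) ** p s) ** transpose (g s) = 0"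
      by (simp add: matrix_transpose_mul cnj_mat_mult cT tT mult_linear matrix_mul_assoc)
    ultimately show ?thesis by simp
  qed
  have "\<exists>C. \<forall>s\<in>?I. a s = C"
    by (rule has_derivative_zero_constant[OF convex_ball])
       (use a' in \<open>auto simp: has_vector_derivative_def has_derivative_at_withinI\<close>)
  then have a: "a s = a t0" if "s \<in> ?I" for s using that t0 by metis
  have g0: "g t0 = g0" "p t0 = P" by (simp_all add: g_def g0_def p_def P_def)
  have gg: "g0 \<in> SU4" "P \<in> pp" using gS[OF t0] pP[OF t0] by (simp_all add: g0)
  note G0 = SU4D[OF gg(1)]
  \<comment> \<open>Multiplying by \<open>cnj_mat g0\<close> conjugates the constant coefficient
    \<open>a t0\<close> into the element \<open>P\<close> of \<open>pp\<close>, for which the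
    exponential is available.\<close>
  define G where "G s = sq (g s) ** cnj_mat g0" for s
  have G': "(G has_vector_derivative G s ** (2 *\<^sub>R P)) (at s)" if s: "s \<in> ?I" for s
  proof -
    note GU = SU4D[OF gS[OF s]]
    have "((\<lambda>s. sq (g s)) has_vector_derivative 2 *\<^sub>R (g s ** p s ** transpose (g s))) (at s)"
      unfolding p_def by (rule sq_has_vector_derivative[OF g'[OF s]])
        (rule lder_su4[OF F _ cS pp_su4[OF X]], use e s in blast)
    then have "(G has_vector_derivative 2 *\<^sub>R (g s ** p s ** transpose (g s)) ** cnj_mat g0) (at s)"
      unfolding G_def[abs_def] by (rule has_vector_derivative_mult_left)
    moreover have "g s ** p s ** transpose (g s) = sq (g s) ** a s"
      by (simp add: a_def sq_def matrix_mul_assoc GU)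
    then have "2 *\<^sub>R (g s ** p s ** transpose (g s)) ** cnj_mat g0 = G s ** (2 *\<^sub>R P)"
      using a[OF s] by (simp add: a_def[of t0] g0 G_def mult_linear matrix_mul_assoc G0)
    ultimately show ?thesis by simp
  qed
  have "f (coset (?c t)) = coset (g0 ** pexp P (t - t0))" if t: "t \<in> ?I" for t
  proof -
    have "G t = G t0 ** pexp (2 *\<^sub>R P) (t - t0)"
      by (rule pexp_unique_linear[OF _ convex_ball G' t0 t]) (simp_all add: subspace_scale[OF subspace_pp] gg)
    then have "G t ** transpose g0 = g0 ** pexp P (2 * (t - t0)) ** transpose g0"
      by (simp add: G_def[of t0] g0 pexp_scaleR gg) (simp add: sq_def matrix_mul_assoc G0)
    then have "sq (g t) = sq (g0 ** pexp P (t - t0))"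
      by (simp add: G_def matrix_mul_assoc G0 sq_geodesic gg)
    then have "coset (g t) = coset (g0 ** pexp P (t - t0))"
      using gS[OF t] gg by (auto simp: coset_eq_iff SU4_mult pexp_SU4 intro!: exI[of _ 1])
    then show ?thesis using local_liftD(4)[OF F _ cS] e t by (simp add: g_def)
  qed
  then show thesis using that e gg by blast
qed

text \<open>Along a geodesic the squares have a constant logarithmic derivative. Agreement up to a
  constant phase on an open interval makes the two constants equal, and uniqueness for the linear
  equation extends the agreement to all times.\<close>

lemma geodesic_identity:
  assumes g: "g \<in> SU4" "h \<in> SU4" and YW: "Y \<in> pp" "W \<in> pp" and I: "open I" "connected I" "I \<noteq> {}"
    and eq: "\<And>t. t \<in> I \<Longrightarrow> coset (g ** pexp Y t) = coset (h ** pexp W t)"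
  shows "coset (g ** pexp Y t) = coset (h ** pexp W t)"
proof -
  let ?P = "\<lambda>t. sq (g ** pexp Y t)" and ?Q = "\<lambda>t. sq (h ** pexp W t)"
  note G = SU4D[OF g(1)] and H = SU4D[OF g(2)]
  have S: "g ** pexp Y t \<in> SU4" "h ** pexp W t \<in> SU4" for t using g YW by (simp_all add: SU4_mult pexp_SU4)
  have "\<exists>c. \<forall>t\<in>I. ?Q t = scal c (?P t)"
  proof (rule phase_constant[OF I(2)])
    show "continuous_on I ?P" "continuous_on I ?Q"
      unfolding sq_def by (intro continuous_intros continuous_on_pexp YW)+
    show "\<exists>c. ?Q t = scal c (?P t)" if "t \<in> I" for t using eq[OF that] S by (simp add: coset_eq_iff)
  qed (simp_all add: S sq_SU4)
  then obtain c where c: "\<And>t. t \<in> I \<Longrightarrow> ?Q t = scal c (?P t)" by blast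
  have d: "((\<lambda>s. sq (k ** pexp V s)) has_vector_derivative sq (k ** pexp V t) ** (cnj_mat k ** (2 *\<^sub>R V) ** transpose k)) (at t)"
    if "k \<in> SU4" "V \<in> pp" for k V t
  proof -
    have "((\<lambda>s. k ** pexp V s) has_vector_derivative (k ** pexp V t) ** V) (at t)"
      using has_vector_derivative_mult_right[OF pexp_has_vector_derivative[OF that(2)], of k t UNIV]
      by (simp add: pexp_commute[OF that(2), symmetric] matrix_mul_assoc)
    from sq_has_vector_derivative[OF this pp_su4[OF that(2)]]
    have "((\<lambda>s. sq (k ** pexp V s)) has_vector_derivative 2 *\<^sub>R (k ** pexp V t ** V ** transpose (k ** pexp V t))) (at t)"
      by (simp add: horizontal_pp[OF that(2)])
    moreover have "k ** pexp V t ** V ** transpose (k ** pexp V t) = sq (k ** pexp V t) ** (cnj_mat k ** V ** transpose k)"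
    proof -
      have "M ** V ** pexp V t = M ** pexp V t ** V" for M :: cmat
        by (simp add: pexp_commute[OF that(2)] flip: matrix_mul_assoc)
      then show ?thesis
        by (simp add: sq_def matrix_transpose_mul transpose_pexp[OF that(2)] matrix_mul_assoc
            SU4D[OF that(1)])
    qed
    ultimately show ?thesis by (simp add: mult_linear)
  qed
  obtain t1 where t1: "t1 \<in> I" using I by blast
  let ?a = "cnj_mat g ** (2 *\<^sub>R Y) ** transpose g" and ?b = "cnj_mat h ** (2 *\<^sub>R W) ** transpose h"
  have "((\<lambda>s. scal c (?P s)) has_vector_derivative scal c (?P t1 ** ?a)) (at t1)"
    by (intro has_vector_derivative_scal d g YW)
  then have "(?Q has_vector_derivative scal c (?P t1 ** ?a)) (at t1)"
    by (rule has_vector_derivative_transform_within_open[OF _ I(1) t1]) (simp add: c)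
  then have "scal c (?P t1 ** ?a) = ?Q t1 ** ?b"
    using vector_derivative_unique_at d g YW by blast
  then have "?Q t1 ** ?a = ?Q t1 ** ?b" by (simp only: c[OF t1] scal_mult_left)
  then have "adj (?Q t1) ** (?Q t1 ** ?a) = adj (?Q t1) ** (?Q t1 ** ?b)" by simp
  then have ab: "?a = ?b"
    using SU4D[OF sq_SU4[OF S(2)[of t1]]] by (simp only: matrix_mul_assoc matrix_mul_lid)
  have ag: "?a ** cnj_mat g = cnj_mat g ** (2 *\<^sub>R Y)" by (simp add: G)
  have sol: "K t ** cnj_mat g = K t1 ** cnj_mat g ** pexp (2 *\<^sub>R Y) (t - t1)"
    if K: "\<And>t. (K has_vector_derivative K t ** ?a) (at t)" for K :: "real \<Rightarrow> cmat"
  proof (rule pexp_unique_linear[of _ UNIV])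
    show "((\<lambda>t. K t ** cnj_mat g) has_vector_derivative K t ** cnj_mat g ** (2 *\<^sub>R Y)) (at t)" for t
    proof -
      have "K t ** ?a ** cnj_mat g = K t ** cnj_mat g ** (2 *\<^sub>R Y)"
        by (subst matrix_mul_assoc[symmetric], subst ag) (simp only: matrix_mul_assoc)
      then show ?thesis
        using has_vector_derivative_mult_left[OF K, of "cnj_mat g" t] by simp
    qed
  qed (simp_all add: subspace_scale[OF subspace_pp] YW)
  have "?Q t ** cnj_mat g = ?Q t1 ** cnj_mat g ** pexp (2 *\<^sub>R Y) (t - t1)"
    by (rule sol) (unfold ab, rule d, auto simp: g YW)
  also have "\<dots> = scal c (?P t1 ** cnj_mat g ** pexp (2 *\<^sub>R Y) (t - t1))"
    by (simp only: c[OF t1] scal_mult_left)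
  also have "\<dots> = scal c (?P t ** cnj_mat g)"
    by (subst sol[of ?P, symmetric]) (rule d, auto simp: g YW)
  finally have "?Q t ** cnj_mat g ** transpose g = scal c (?P t) ** cnj_mat g ** transpose g"
    by (simp only: scal_mult_left)
  then have "?Q t = scal c (?P t)" by (simp only: G)
  then show ?thesis using S by (auto simp: coset_eq_iff)
qed

text \<open>Continuation along the line: the times near which image curve and geodesic agree form an
  open set by definition, and a closed one because two geodesics that agree on an interval agree
  everywhere.\<close>

theorem isometry_geodesic:
  assumes f: "isometry f" and F: "local_lift f U F" and u: "u \<in> SU4" "u \<in> U" and X: "X \<in> pp"
  shows "f (coset (u ** pexp X t)) = coset (F u ** pexp (horizontal (lder F u X)) t)"
proof -
  define Y where "Y = horizontal (lder F u X)"
  let ?c = "\<lambda>t. f (coset (u ** pexp X t))" and ?\<gamma> = "\<lambda>t. coset (F u ** pexp Y t)"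
  have Fu: "F u \<in> SU4" and Y: "Y \<in> pp"
    using local_liftD(3)[OF F u(2,1)] horizontal_su4[OF lder_su4[OF F u(2,1) pp_su4[OF X]]] by (simp_all add: Y_def)
  define A where "A = {t0. \<exists>e>0. \<forall>t\<in>ball t0 e. ?c t = ?\<gamma> t}"
  have "0 \<in> A"
  proof -
    have c0: "u ** pexp X 0 = u" using X by (simp add: pexp_0)
    obtain e where "e > 0" "\<forall>t\<in>ball 0 e. ?c t = coset (F u ** pexp Y (t - 0))"
      by (rule isometry_local_geodesic[OF f F u(1) X, of 0, unfolded c0, folded Y_def]) (use u(2) in blast)+
    then show ?thesis by (auto simp: A_def)
  qed
  moreover have "open A"
    unfolding open_contains_ball
  proof
    fix t0 assume "t0 \<in> A"
    then obtain e where e: "e > 0" "\<forall>t\<in>ball t0 e. ?c t = ?\<gamma> t" by (auto simp: A_def)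
    have "ball t0 e \<subseteq> A"
    proof
      fix s assume "s \<in> ball t0 e"
      then obtain d where "d > 0" "ball s d \<subseteq> ball t0 e" by (meson open_ball open_contains_ball)
      then show "s \<in> A" using e by (auto simp: A_def)
    qed
    then show "\<exists>e>0. ball t0 e \<subseteq> A" using e by blast
  qed
  moreover have "closed A"
    unfolding closed_def open_contains_ball
  proof
    fix t0 assume t0: "t0 \<in> - A"
    \<comment> \<open>The lift near \<open>t0\<close> may be unrelated to \<open>F\<close>. It
      provides a geodesic with its own initial data, to be compared with the given one through
      \<open>geodesic_identity\<close>.\<close>
    obtain V H where V: "u ** pexp X t0 \<in> V" "local_lift f V H"
      using f SU4_mult[OF u(1) pexp_SU4[OF X]] unfolding isometry_def smooth_map_def by blast
    obtain g P e where e: "e > 0" "g \<in> SU4" "P \<in> pp" "\<forall>t\<in>ball t0 e. ?c t = coset (g ** pexp P (t - t0))"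
      using isometry_local_geodesic[OF f V(2) u(1) X V(1)] by metis
    have shift: "g ** pexp P (t - t0) = (g ** pexp P (- t0)) ** pexp P t" for t
      using e(3) by (simp add: matrix_mul_assoc[symmetric] flip: pexp_add)
    have "ball t0 e \<subseteq> - A"
    proof (rule ccontr)
      assume "\<not> ball t0 e \<subseteq> - A"
      then obtain s where s: "s \<in> ball t0 e" "s \<in> A" by blast
      then obtain d where d: "d > 0" "\<forall>t\<in>ball s d. ?c t = ?\<gamma> t" by (auto simp: A_def)
      obtain d' where d': "d' > 0" "ball s d' \<subseteq> ball t0 e" using s(1) by (meson open_ball open_contains_ball)
      have "coset ((g ** pexp P (- t0)) ** pexp P t) = ?\<gamma> t" for t
      proof (rule geodesic_identity[where I = "ball s (min d d')"])
        show "coset (g ** pexp P (- t0) ** pexp P t) = ?\<gamma> t" if "t \<in> ball s (min d d')" for t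
        proof -
          have "t \<in> ball s d" "t \<in> ball t0 e" using that d' by auto
          then show ?thesis using d(2) e(4) shift by metis
        qed
      qed (use d d' e Fu Y in \<open>auto simp: SU4_mult pexp_SU4\<close>)
      then have "t0 \<in> A" using e(1,4) shift by (auto simp: A_def)
      then show False using t0 by blast
    qed
    then show "\<exists>e>0. ball t0 e \<subseteq> - A" using e by blast
  qed
  ultimately have "A = UNIV" using clopen[of A] by blast
  then have "t \<in> A" by blast
  then show ?thesis by (auto simp: A_def Y_def)
qed

subsection \<open>The shortest closed geodesics\<close>

text \<open>The matrix \<open>\<i> \<pi> (w w\<^sup>t - 1/4)\<close>. For a unit vector \<open>w\<close> its eigenvalues differ by \<open>\<i> \<pi>\<close> or \<open>0\<close>, so
  its exponential lies in the stabiliser.\<close>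

definition rk1 :: "real^4 \<Rightarrow> cmat" where
  "rk1 w = (\<chi> a b. \<i> * complex_of_real (pi * (w $ a * w $ b - (if a = b then 1/4 else 0))))"

lemma rk1_nth: "rk1 w $ a $ b = \<i> * complex_of_real (pi * (w $ a * w $ b - (if a = b then 1/4 else 0)))"
  by (simp add: rk1_def)

lemma orthogonal_matrix_row_sum:
  fixes S :: "real^4^4"
  assumes "orthogonal_matrix S" shows "(\<Sum>i\<in>UNIV. S $ a $ i * S $ b $ i) = (if a = b then 1 else 0)"
proof -
  have "(S ** transpose S) $ a $ b = (mat 1 :: real^4^4) $ a $ b"
    using assms by (simp add: orthogonal_matrix_def)
  then show ?thesis by (simp add: matrix_mult_nth transpose_nth mat_1_nth)
qed

lemma rk1_rdiag:
  assumes S: "orthogonal_matrix S"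
  shows "rk1 (column k S) = idiag S (\<lambda>i. pi * ((if i = k then 1 else 0) - 1/4))"
proof (rule mat_eqI)
  fix a b
  let ?d = "\<lambda>i. pi * ((if i = k then 1 else 0) - 1/4)"
  have "(\<Sum>i\<in>UNIV. S $ a $ i * S $ b $ i * ?d i) =
      (\<Sum>i\<in>UNIV. (if i = k then pi * (S $ a $ i * S $ b $ i) else 0) - pi / 4 * (S $ a $ i * S $ b $ i))"
    by (intro sum.cong refl) (simp add: algebra_simps)
  also have "\<dots> = pi * (S $ a $ k * S $ b $ k - (if a = b then 1/4 else 0))"
    by (simp only: sum_subtractf sum_distrib_left[symmetric] orthogonal_matrix_row_sum[OF S])
       (simp add: right_diff_distrib)
  finally have "(\<Sum>i\<in>UNIV. complex_of_real (S $ a $ i * S $ b $ i * ?d i)) =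
      complex_of_real (pi * (S $ a $ k * S $ b $ k - (if a = b then 1/4 else 0)))"
    by (simp only: of_real_sum[symmetric])
  then have "\<i> * (\<Sum>i\<in>UNIV. complex_of_real (S $ a $ i * S $ b $ i * ?d i)) =
      rk1 (column k S) $ a $ b"
    by (simp only: rk1_nth column_def vec_lambda_beta)
  moreover have "idiag S ?d $ a $ b =
    \<i> * (\<Sum>i\<in>UNIV. complex_of_real (S $ a $ i * S $ b $ i * ?d i))"
    unfolding rdiag_nth sum_distrib_left by (intro sum.cong refl) simp
  ultimately show "rk1 (column k S) $ a $ b = idiag S ?d $ a $ b"
    by simp
qed

lemma unit_vector_column:
  fixes w :: "real^4"
  assumes "norm w = 1" obtains S where "orthogonal_matrix S" "w = column 1 S"
proof -
  obtain S where "orthogonal_matrix S" "S *v axis 1 1 = w"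
    using orthogonal_matrix_exists_basis[OF assms] by blast
  then show thesis using that by (simp add: matrix_vector_mult_basis)
qed

lemma sum_delta_quarter: "(\<Sum>i\<in>UNIV. pi * ((if i = (k::4) then 1 else 0) - 1/4)) = 0"
  by (simp add: sum_subtractf flip: sum_distrib_left)

lemma rk1_pp:
  assumes "norm w = 1" shows "rk1 w \<in> pp"
proof -
  obtain S where S: "orthogonal_matrix S" "w = column 1 S" using unit_vector_column[OF assms] .
  show ?thesis unfolding S(2) rk1_rdiag[OF S(1)] by (rule rdiag_pp[OF S(1) sum_delta_quarter])
qed

lemma ip_rk1: "ip (rk1 v) (rk1 w) = - pi\<^sup>2 * ((v \<bullet> w)\<^sup>2 - (v \<bullet> v) / 4 - (w \<bullet> w) / 4 + 1/4)"
proof -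
  have "trace (rk1 v ** rk1 w) = complex_of_real (- pi\<^sup>2 *
    (\<Sum>a\<in>UNIV. \<Sum>b\<in>UNIV. (v $ a * v $ b - (if a = b then 1/4 else 0)) * (w $ b * w $ a - (if b = a then 1/4 else 0))))"
    by (simp add: trace_def matrix_mult_nth rk1_nth sum_distrib_left power2_eq_square mult_ac sum_negf)
  moreover have "(\<Sum>a\<in>UNIV. \<Sum>b\<in>UNIV. (v $ a * v $ b - (if a = b then 1/4 else 0)) * (w $ b * w $ a - (if b = a then 1/4 else 0))) =
    (v \<bullet> w)\<^sup>2 - (v \<bullet> v) / 4 - (w \<bullet> w) / 4 + 1/4"
    by (simp add: inner_vec_def sum_4) algebra
  ultimately show ?thesis by (simp add: ip_def)
qed

text \<open>The squared length is 3/4 pi^2 up to the sign convention of \<open>ip\<close>, and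
  orthogonality of \<open>v\<close> and \<open>w\<close> can be read off from the value.\<close>

lemma ip_rk1_unit: "norm v = 1 \<Longrightarrow> norm w = 1 \<Longrightarrow> ip (rk1 v) (rk1 w) = - pi\<^sup>2 * ((v \<bullet> w)\<^sup>2 - 1/4)"
  by (simp add: ip_rk1 dot_square_norm)

lemma sq_pexp_rk1:
  assumes "norm w = 1" shows "\<exists>c. sq (pexp (rk1 w) 1) = scal c (mat 1)"
proof -
  obtain S where S: "orthogonal_matrix S" "w = column 1 S" using unit_vector_column[OF assms] .
  \<comment> \<open>The two doubled angles 3 pi / 2 and - pi / 2 give the same phase.\<close>
  have "cis (2 * (pi * ((if i = 1 then 1 else 0) - 1 / 4))) = cis (- pi / 2)" for i :: 4
    by (auto simp: cis.ctr complex_eq_iff algebra_simps cos_diff sin_diff)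
  then have "pexp (rk1 w) (2 * 1) = scal (cis (- pi / 2)) (rdiag S (\<lambda>_. 1))"
    unfolding S(2) rk1_rdiag[OF S(1)] scal_rdiag
    by (simp only: pexp_rdiag[OF S(1) sum_delta_quarter] mult_1_right)
  then show ?thesis using rk1_pp[OF assms] by (auto simp: sq_pexp rdiag_1[OF S(1)])
qed

text \<open>An invariant of odd degree is needed to distinguish \<open>rk1 w\<close> from the
  negatives of such matrices; the trace of the cube does so without reference to
  \<open>w\<close>.\<close>

lemma trace_rk1_cube:
  assumes "norm w = 1" shows "trace (rk1 w ** rk1 w ** rk1 w) = - \<i> * complex_of_real (3 / 8 * pi ^ 3)"
proof -
  obtain S where S: "orthogonal_matrix S" "w = column 1 S" using unit_vector_column[OF assms] .
  show ?thesis
    by (simp add: S(2) rk1_rdiag[OF S(1)] rdiag_mult[OF S(1)] trace_rdiag[OF S(1)] sum_4)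
       (simp add: power3_eq_cube field_simps)
qed

text \<open>For the four integers 0, a, b, c this is the sum of the squared pairwise differences.
  The value 3 means that one of them differs by 1 from the other three, which coincide.\<close>

lemma sum_differences_eq_3:
  fixes a b c :: int
  assumes "a\<^sup>2 + b\<^sup>2 + c\<^sup>2 + (a - b)\<^sup>2 + (a - c)\<^sup>2 + (b - c)\<^sup>2 = 3"
  shows "\<exists>e\<in>{1, -1}. (a, b, c) \<in> {(e, 0, 0), (0, e, 0), (0, 0, e), (e, e, e)}"
proof -
  have "\<bar>x\<bar> \<le> 1" if "x\<^sup>2 \<le> 3" for x :: int
  proof (rule ccontr)
    assume "\<not> \<bar>x\<bar> \<le> 1"
    then have "2\<^sup>2 \<le> \<bar>x\<bar>\<^sup>2" by (intro power_mono) auto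
    then show False using that by simp
  qed
  moreover have "a\<^sup>2 \<le> 3" "b\<^sup>2 \<le> 3" "c\<^sup>2 \<le> 3"
    using assms zero_le_power2[of a] zero_le_power2[of b] zero_le_power2[of c]
      zero_le_power2[of "a - b"] zero_le_power2[of "a - c"] zero_le_power2[of "b - c"] by linarith+
  ultimately have "\<bar>a\<bar> \<le> 1" "\<bar>b\<bar> \<le> 1" "\<bar>c\<bar> \<le> 1" by blast+
  then have "a = -1 \<or> a = 0 \<or> a = 1" "b = -1 \<or> b = 0 \<or> b = 1" "c = -1 \<or> c = 0 \<or> c = 1" by auto
  then show ?thesis using assms by (elim disjE) simp_all
qed

text \<open>No nonzero element of \<open>pp\<close> with exponential in the stabiliser is shorter than these.\<close>

lemma shortest_closed_geodesic:
  assumes Y: "Y \<in> pp" and len: "ip Y Y = - (3/4) * pi\<^sup>2" and c: "sq (pexp Y 1) = scal c (mat 1)"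
  obtains \<epsilon> w where "\<epsilon> = 1 \<or> \<epsilon> = (-1::real)" "norm w = 1" "Y = \<epsilon> *\<^sub>R rk1 w"
proof -
  obtain S y where S: "orthogonal_matrix S" and Yd: "Y = idiag S y"
    and y0: "sum y UNIV = (0::real)" and e: "\<And>t. pexp Y t = rdiag S (\<lambda>i. cis (t * y i))"
    using pexp_form[OF Y] by metis
  have "scal c (mat 1) = rdiag S (\<lambda>i. c * 1)"
    by (simp only: rdiag_1[OF S, symmetric] scal_rdiag)
  then have "rdiag S (\<lambda>i. cis (2 * y i)) = rdiag S (\<lambda>i. c * 1)"
    using c sq_pexp[OF Y, of 1] by (simp add: e)
  from rdiag_inject[OF S this] have cis: "cis (2 * y i) = c" for i by (simp add: fun_eq_iff)
  \<comment> \<open>Taking \<open>sq\<close> doubles the angles, so the \<open>2 * y i\<close> agree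
    modulo 2 pi and the \<open>y i\<close> modulo pi.\<close>
  have "\<exists>n::int. y i - y 1 = pi * of_int n" for i
  proof -
    have "cis (2 * y i - 2 * y 1) = 1" using cis[of i] cis[of 1] by (simp flip: cis_divide) (metis cis_neq_zero)
    then have "cos (2 * y i - 2 * y 1) = 1" by (simp add: complex_eq_iff)
    then obtain n :: int where "2 * y i - 2 * y 1 = of_int n * 2 * pi" using cos_one_2pi_int by auto
    then show ?thesis by (intro exI[of _ n]) (simp add: algebra_simps)
  qed
  then obtain n :: "4 \<Rightarrow> int" where n: "\<And>i. y i - y 1 = pi * of_int (n i)" by metis
  have ipY: "ip Y Y = - (\<Sum>i\<in>UNIV. (y i)\<^sup>2)"
    by (simp add: ip_def Yd rdiag_mult[OF S] trace_rdiag[OF S] power2_eq_square sum_negf)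
  have yi: "y 2 = y 1 + pi * of_int (n 2)" "y 3 = y 1 + pi * of_int (n 3)" "y 4 = y 1 + pi * of_int (n 4)"
    using n[of 2] n[of 3] n[of 4] by simp_all
  have y1: "y 1 = - pi * (of_int (n 2) + of_int (n 3) + of_int (n 4)) / 4"
    using y0 by (simp add: sum_4 yi algebra_simps)
  \<comment> \<open>Four times the sum of squares of four numbers with sum zero is the sum of their
    squared pairwise differences.\<close>
  have "4 * (\<Sum>i\<in>UNIV. (y i)\<^sup>2) = pi\<^sup>2 * ((of_int (n 2))\<^sup>2 + (of_int (n 3))\<^sup>2 + (of_int (n 4))\<^sup>2 +
     (of_int (n 2) - of_int (n 3))\<^sup>2 + (of_int (n 2) - of_int (n 4))\<^sup>2 + (of_int (n 3) - of_int (n 4))\<^sup>2)"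
    unfolding sum_4 yi unfolding y1 by (simp add: power2_eq_square field_simps)
  moreover have "4 * (\<Sum>i\<in>UNIV. (y i)\<^sup>2) = pi\<^sup>2 * 3" using ipY len by simp
  ultimately have "real_of_int ((n 2)\<^sup>2 + (n 3)\<^sup>2 + (n 4)\<^sup>2 + (n 2 - n 3)\<^sup>2 + (n 2 - n 4)\<^sup>2 + (n 3 - n 4)\<^sup>2) = real_of_int 3"
    by simp
  then have "(n 2)\<^sup>2 + (n 3)\<^sup>2 + (n 4)\<^sup>2 + (n 2 - n 3)\<^sup>2 + (n 2 - n 4)\<^sup>2 + (n 3 - n 4)\<^sup>2 = 3"
    by (simp only: of_int_eq_iff)
  from sum_differences_eq_3[OF this] obtain e where
    e: "e = 1 \<or> e = -1" "(n 2, n 3, n 4) \<in> {(e, 0, 0), (0, e, 0), (0, 0, e), (e, e, e)}" by blast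
  have "\<exists>k \<epsilon>. (\<epsilon> = 1 \<or> \<epsilon> = -1) \<and> (\<forall>i. y i = \<epsilon> * (pi * ((if i = k then 1 else 0) - 1/4)))"
  proof -
    consider "(n 2, n 3, n 4) = (e, 0, 0)" | "(n 2, n 3, n 4) = (0, e, 0)" | "(n 2, n 3, n 4) = (0, 0, e)"
      | "(n 2, n 3, n 4) = (e, e, e)" using e(2) by blast
    then show ?thesis
    proof cases
      case 1 then show ?thesis using e(1)
        by (intro exI[of _ 2] exI[of _ "real_of_int e"]) (auto simp: forall_4 yi y1 field_simps)
    next
      case 2 then show ?thesis using e(1)
        by (intro exI[of _ 3] exI[of _ "real_of_int e"]) (auto simp: forall_4 yi y1 field_simps)
    next
      case 3 then show ?thesis using e(1)
        by (intro exI[of _ 4] exI[of _ "real_of_int e"]) (auto simp: forall_4 yi y1 field_simps)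
    next
      \<comment> \<open>Here the exceptional eigenvalue is the reference \<open>y 1\<close>, from
        which the other three differ by \<open>e\<close>; this reverses the sign.\<close>
      case 4 then show ?thesis using e(1)
        by (intro exI[of _ 1] exI[of _ "- real_of_int e"]) (auto simp: forall_4 yi y1 field_simps)
    qed
  qed
  then obtain k \<epsilon> where \<epsilon>: "\<epsilon> = 1 \<or> \<epsilon> = -1" "\<And>i. y i = \<epsilon> * (pi * ((if i = k then 1 else 0) - 1/4))" by blast
  have "Y = \<epsilon> *\<^sub>R rk1 (column k S)"
    by (simp add: Yd rk1_rdiag[OF S] scaleR_scal scal_rdiag \<epsilon>(2) mult_ac)
  moreover have "norm (column k S) = 1" using S orthogonal_matrix_orthonormal_columns by blast
  ultimately show thesis using that \<epsilon>(1) by blast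
qed

text \<open>The spectral decomposition; the multiples of the identity inside \<open>rk1\<close>
  cancel because the eigenvalues sum to zero.\<close>

lemma rdiag_sum_rk1:
  assumes "sum x UNIV = (0::real)"
  shows "idiag S x = (\<Sum>i\<in>UNIV. (x i / pi) *\<^sub>R rk1 (column i S))"
proof (rule mat_eqI)
  fix a b
  have "(\<Sum>i\<in>UNIV. (x i / pi) *\<^sub>R rk1 (column i S)) $ a $ b = (\<Sum>i\<in>UNIV. complex_of_real (x i / pi) * rk1 (column i S) $ a $ b)"
    by (simp add: scaleR_scal)
  also have "\<dots> = (\<Sum>i\<in>UNIV. of_real (S $ a $ i * S $ b $ i) * (\<i> * complex_of_real (x i))
      - \<i> * complex_of_real (if a = b then 1/4 else 0) * complex_of_real (x i))"
    by (intro sum.cong refl) (simp add: rk1_nth column_def field_simps)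
  also have "\<dots> = idiag S x $ a $ b"
    using assms by (simp add: sum_subtractf rdiag_nth flip: sum_distrib_left of_real_sum)
  finally show "idiag S x $ a $ b = (\<Sum>i\<in>UNIV. (x i / pi) *\<^sub>R rk1 (column i S)) $ a $ b"
    by simp
qed

subsection \<open>The differential of an isometry\<close>

text \<open>The images of the \<open>rk1\<close> matrices of an orthonormal basis are, up to one
  common sign, those of another orthonormal basis. The rotation \<open>R\<close> may vary with
  \<open>S\<close> and \<open>x\<close>, which suffices for pairs of points.\<close>

lemma lattice_preserving_spectrum:
  assumes lin: "linear \<tau>" and pp: "\<And>X. X \<in> pp \<Longrightarrow> \<tau> X \<in> pp"
    and ip: "\<And>X Y. X \<in> pp \<Longrightarrow> Y \<in> pp \<Longrightarrow> ip (\<tau> X) (\<tau> Y) = ip X Y"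
    and lattice: "\<And>X c. X \<in> pp \<Longrightarrow> sq (pexp X 1) = scal c (mat 1) \<Longrightarrow> \<exists>c. sq (pexp (\<tau> X) 1) = scal c (mat 1)"
  obtains \<epsilon> where "\<epsilon> = 1 \<or> \<epsilon> = (-1::real)"
    "\<forall>S x. orthogonal_matrix S \<longrightarrow> sum x UNIV = (0::real) \<longrightarrow>
      (\<exists>R. rotation_matrix R \<and> \<tau> (idiag S x) = idiag R (\<lambda>i. \<epsilon> * x i))"
proof -
  have ex: "\<exists>\<epsilon> w'. (\<epsilon> = 1 \<or> \<epsilon> = (-1::real)) \<and> norm w' = 1 \<and> \<tau> (rk1 w) = \<epsilon> *\<^sub>R rk1 w'" if w: "norm w = 1" for w
  proof -
    have p: "rk1 w \<in> pp" by (rule rk1_pp[OF w])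
    obtain c where "sq (pexp (\<tau> (rk1 w)) 1) = scal c (mat 1)"
      using lattice[OF p] sq_pexp_rk1[OF w] by blast
    moreover have "ip (\<tau> (rk1 w)) (\<tau> (rk1 w)) = - (3/4) * pi\<^sup>2"
      using ip[OF p p] ip_rk1_unit[OF w w] w by (simp add: dot_square_norm)
    ultimately show ?thesis using shortest_closed_geodesic[OF pp[OF p]] by metis
  qed
  \<comment> \<open>The vector \<open>w'\<close> is determined only up to sign and is not chosen
    continuously. This cubic function is continuous and still detects the sign \<epsilon>.\<close>
  define \<phi> where "\<phi> w = Im (trace (\<tau> (rk1 w) ** \<tau> (rk1 w) ** \<tau> (rk1 w)))" for w
  have \<phi>: "\<phi> w = - \<epsilon> * (3 / 8 * pi ^ 3)"
    if "\<epsilon> = 1 \<or> \<epsilon> = (-1::real)" "norm w' = 1" "\<tau> (rk1 w) = \<epsilon> *\<^sub>R rk1 w'" for w \<epsilon> w'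
    using that(1) trace_rk1_cube[OF that(2)]
    by (auto simp: \<phi>_def that(3) mult_linear trace_linear)
  have "continuous_on (sphere 0 1) rk1" unfolding rk1_def by (intro continuous_intros)
  moreover have "continuous_on UNIV \<tau>"
    using lin by (simp add: linear_continuous_on linear_conv_bounded_linear)
  ultimately have "continuous_on (sphere 0 1) (\<lambda>w. \<tau> (rk1 w))"
    using continuous_on_compose2[of UNIV \<tau> "sphere 0 1" rk1] by simp
  then have "continuous_on (sphere 0 1) \<phi>" unfolding \<phi>_def by (intro continuous_intros)
  moreover have "connected (sphere (0::real^4) 1)" by (rule connected_sphere) simp
  moreover have "\<phi> ` sphere 0 1 \<subseteq> {3 / 8 * pi ^ 3, - (3 / 8 * pi ^ 3)}"
    using ex \<phi> by fastforce
  then have "finite (\<phi> ` sphere 0 1)" by (rule finite_subset) simp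
  ultimately have "\<phi> constant_on sphere 0 1" by (intro continuous_finite_range_constant)
  then obtain b where b: "\<And>w. norm w = 1 \<Longrightarrow> \<phi> w = b" unfolding constant_on_def by auto
  define \<epsilon> where "\<epsilon> = - b / (3 / 8 * pi ^ 3)"
  have key: "\<exists>w'. norm w' = 1 \<and> \<tau> (rk1 w) = \<epsilon> *\<^sub>R rk1 w'" and \<epsilon>w: "\<epsilon> = 1 \<or> \<epsilon> = -1" if w: "norm w = 1" for w
  proof -
    obtain d w' where d: "d = 1 \<or> d = (-1::real)" "norm w' = 1" "\<tau> (rk1 w) = d *\<^sub>R rk1 w'" using ex[OF w] by blast
    have "b = - d * (3 / 8 * pi ^ 3)" using b[OF w] \<phi>[OF d] by simp
    then have "\<epsilon> = d" by (simp add: \<epsilon>_def)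
    with d show "\<exists>w'. norm w' = 1 \<and> \<tau> (rk1 w) = \<epsilon> *\<^sub>R rk1 w'" "\<epsilon> = 1 \<or> \<epsilon> = -1" by blast+
  qed
  have \<epsilon>: "\<epsilon> = 1 \<or> \<epsilon> = -1" by (rule \<epsilon>w[of "axis 1 1"]) simp
  have "\<exists>R. rotation_matrix R \<and> \<tau> (idiag S x) = idiag R (\<lambda>i. \<epsilon> * x i)"
    if S: "orthogonal_matrix S" and x: "sum x UNIV = (0::real)" for S x
  proof -
    have cols: "norm (column i S) = 1" for i using S orthogonal_matrix_orthonormal_columns by blast
    have orth: "column i S \<bullet> column j S = 0" if "i \<noteq> j" for i j
      using S that unfolding orthogonal_matrix_orthonormal_columns orthogonal_def by blast
    obtain w where w: "\<And>i. norm (w i) = 1" "\<And>i. \<tau> (rk1 (column i S)) = \<epsilon> *\<^sub>R rk1 (w i)"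
      using key[OF cols] by metis
    define T :: "real^4^4" where "T = (\<chi> a i. w i $ a)"
    have colT: "column i T = w i" for i by (simp add: T_def column_def vec_eq_iff)
    \<comment> \<open>The squared scalar product is recovered from \<open>ip\<close>, which \<tau>
      preserves; the common sign enters twice and drops out.\<close>
    have "w i \<bullet> w j = 0" if "i \<noteq> j" for i j
    proof -
      have "ip (\<epsilon> *\<^sub>R rk1 (w i)) (\<epsilon> *\<^sub>R rk1 (w j)) = ip (rk1 (column i S)) (rk1 (column j S))"
        unfolding w(2)[symmetric] by (intro ip rk1_pp cols)
      then have "ip (rk1 (w i)) (rk1 (w j)) = ip (rk1 (column i S)) (rk1 (column j S))"
        using \<epsilon> by (auto simp: ip.scaleR_left ip.scaleR_right ip.minus_left ip.minus_right)
      then have "- pi\<^sup>2 * ((w i \<bullet> w j)\<^sup>2 - 1/4) = - pi\<^sup>2 * (0\<^sup>2 - 1/4)"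
        unfolding ip_rk1_unit[OF w(1) w(1)] ip_rk1_unit[OF cols cols] orth[OF that] .
      then have "(w i \<bullet> w j)\<^sup>2 - 1/4 = 0\<^sup>2 - 1/4" unfolding mult_cancel_left by simp
      then show ?thesis by simp
    qed
    then have T: "orthogonal_matrix T"
      by (simp add: orthogonal_matrix_orthonormal_columns colT w(1) orthogonal_def)
    have "\<tau> (idiag S x) = (\<Sum>i\<in>UNIV. (x i / pi) *\<^sub>R (\<epsilon> *\<^sub>R rk1 (column i T)))"
      by (simp add: rdiag_sum_rk1[OF x] linear_sum[OF lin] linear_cmul[OF lin] w(2) colT)
    also have "\<dots> = (\<Sum>i\<in>UNIV. (\<epsilon> * x i / pi) *\<^sub>R rk1 (column i T))"
      by (intro sum.cong refl) (simp add: mult.commute)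
    also have "\<dots> = idiag T (\<lambda>i. \<epsilon> * x i)"
      using x by (intro rdiag_sum_rk1[symmetric]) (simp flip: sum_distrib_left)
    finally show ?thesis using rdiag_rotation[OF T] by metis
  qed
  then show thesis using that[OF \<epsilon>] by blast
qed

lemma coset_mult_eq_iff:
  assumes "g \<in> SU4" "a \<in> SU4" "b \<in> SU4"
  shows "coset (g ** a) = coset (g ** b) \<longleftrightarrow> coset a = coset b"
proof
  assume "coset (g ** a) = coset (g ** b)"
  then have "coset (adj g ** (g ** a)) = coset (adj g ** (g ** b))"
    using assms SU4_mult SU4_adj by (rule_tac coset_mult_cong) auto
  then show "coset a = coset b" using SU4D[OF assms(1)] by (simp add: matrix_mul_assoc)
qed (use coset_mult_cong[OF assms(2,3,1)] in simp)

lemma coset_eq_mat_1_iff: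
  assumes "k \<in> SU4" shows "coset k = coset (mat 1) \<longleftrightarrow> (\<exists>c. sq k = scal c (mat 1))"
proof -
  have "sq (mat 1) = mat 1" by (simp add: sq_def)
  then show ?thesis using coset_eq_iff[OF SU4_mat_1 assms] by auto
qed

text \<open>Every point is joined to the base point by a geodesic: halve the angles of the
  eigenvalues of \<open>sq m\<close>.\<close>

lemma coset_eq_coset_pexp:
  assumes m: "m \<in> SU4"
  obtains S x where "rotation_matrix S" "sum x UNIV = (0::real)"
    "coset m = coset (rdiag S (\<lambda>i. cis (x i)))" "rdiag S (\<lambda>i. cis (x i)) \<in> SU4"
proof -
  obtain S d where S: "rotation_matrix S" "sq m = rdiag S d" "\<And>i. cmod (d i) = 1"
    using sym_unitary_diagonalisation[OF sq_sym_unitary[OF SU4_unitary[OF m]]] by metis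
  have So: "orthogonal_matrix S" using S by (simp add: rotation_matrix_def)
  define \<theta> where "\<theta> i = Arg (d i)" for i
  have d: "d i = cis (\<theta> i)" for i using rcis_cmod_Arg[of "d i"] by (simp add: rcis_def S(3) \<theta>_def)
  \<comment> \<open>The angles sum to a multiple of 2 pi, not necessarily to 0. Subtracting their
    mean makes the trace vanish and changes the square only by a phase.\<close>
  define \<mu> where "\<mu> = sum \<theta> UNIV / 4"
  define x where "x i = (\<theta> i - \<mu>) / 2" for i
  have x0: "sum x UNIV = 0" by (simp add: x_def[abs_def] \<mu>_def sum_subtractf flip: sum_divide_distrib)
  let ?E = "rdiag S (\<lambda>i. cis (x i))"
  have E: "?E \<in> SU4" using So x0 by (simp add: SU4_iff unitary_rdiag det_rdiag prod_cis)
  have "sq ?E = rdiag S (\<lambda>i. cis (- \<mu>) * d i)"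
    by (simp add: sq_def transpose_rdiag rdiag_mult[OF So] cis_mult d x_def add.commute)
  then have "sq ?E = scal (cis (- \<mu>)) (sq m)" by (simp add: S scal_rdiag)
  then have "coset m = coset ?E" using E m by (auto simp: coset_eq_iff)
  then show thesis using that S x0 E by blast
qed

text \<open>A geodesic from the first point reaches the second, so the pair is encoded by one vector
  of \<open>pp\<close>. The differential maps it to a vector with the same spectrum up to sign, and
  a rotation between the eigenbases yields \<open>h\<close>.\<close>

theorem isometry_point_pair:
  assumes f: "isometry f" and u: "u \<in> SU4" and v: "v \<in> SU4"
  shows "\<exists>h\<in>SU4. (f (coset u) = coset (h ** u) \<and> f (coset v) = coset (h ** v)) \<or>
    (f (coset u) = coset (h ** cnj_mat u) \<and> f (coset v) = coset (h ** cnj_mat v))"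
proof -
  obtain U F where F: "u \<in> U" "local_lift f U F" using f u unfolding isometry_def smooth_map_def by blast
  define g where "g = F u"
  define \<tau> where "\<tau> X = horizontal (lder F u X)" for X
  have g: "g \<in> SU4" and fu: "f (coset u) = coset g"
    using local_liftD(3,4)[OF F(2,1) u] by (simp_all add: g_def)
  have geo: "f (coset (u ** pexp X t)) = coset (g ** pexp (\<tau> X) t)" if "X \<in> pp" for X t
    unfolding g_def \<tau>_def by (rule isometry_geodesic[OF f F(2) u F(1) that])
  have lin: "linear \<tau>" unfolding \<tau>_def using lder_linear[OF F(2,1)]
    by (auto intro!: linearI simp: linear_add linear_cmul horizontal_linear)
  have \<tau>pp: "\<tau> X \<in> pp" if "X \<in> pp" for X
    unfolding \<tau>_def using horizontal_su4 lder_su4[OF F(2,1) u pp_su4[OF that]] by blast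
  have ip: "ip (\<tau> X) (\<tau> Y) = ip X Y" if "X \<in> pp" "Y \<in> pp" for X Y
    using isometry_ip[OF f F(2,1) u pp_su4[OF that(1)] pp_su4[OF that(2)]] that by (simp add: \<tau>_def horizontal_pp)
  \<comment> \<open>Membership in the stabiliser says that the geodesic has returned to its starting
    point at time 1, which the isometry preserves.\<close>
  have lattice: "\<exists>c. sq (pexp (\<tau> X) 1) = scal c (mat 1)" if X: "X \<in> pp" and c: "sq (pexp X 1) = scal c (mat 1)" for X c
  proof -
    note S = pexp_SU4[OF X, of 1] pexp_SU4[OF \<tau>pp[OF X], of 1]
    have "coset (u ** pexp X 1) = coset (u ** mat 1)"
      using c coset_eq_mat_1_iff[OF S(1)] coset_mult_eq_iff[OF u S(1) SU4_mat_1] by blast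
    then have "coset (g ** pexp (\<tau> X) 1) = coset (g ** mat 1)" using geo[OF X, of 1] fu by simp
    then show ?thesis using coset_eq_mat_1_iff[OF S(2)] coset_mult_eq_iff[OF g S(2) SU4_mat_1] by blast
  qed
  obtain \<epsilon> where \<epsilon>: "\<epsilon> = 1 \<or> \<epsilon> = (-1::real)"
    "\<forall>S x. orthogonal_matrix S \<longrightarrow> sum x UNIV = (0::real) \<longrightarrow>
      (\<exists>R. rotation_matrix R \<and> \<tau> (idiag S x) = idiag R (\<lambda>i. \<epsilon> * x i))"
    by (rule lattice_preserving_spectrum[OF lin \<tau>pp ip lattice]; (assumption | rule that))
  have m: "adj u ** v \<in> SU4" using u v by (simp add: SU4_mult SU4_adj)
  obtain S x where S: "rotation_matrix S" "sum x UNIV = (0::real)"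
    "coset (adj u ** v) = coset (rdiag S (\<lambda>i. cis (x i)))" "rdiag S (\<lambda>i. cis (x i)) \<in> SU4"
    using coset_eq_coset_pexp[OF m] .
  have So: "orthogonal_matrix S" using S by (simp add: rotation_matrix_def)
  let ?E = "rdiag S (\<lambda>i. cis (x i))" and ?X = "idiag S x"
  have X: "?X \<in> pp" by (rule rdiag_pp[OF So S(2)])
  obtain R where R: "rotation_matrix R" "\<tau> ?X = idiag R (\<lambda>i. \<epsilon> * x i)"
    using \<epsilon>(2) So S(2) by blast
  have Ro: "orthogonal_matrix R" using R by (simp add: rotation_matrix_def)
  \<comment> \<open>The rotation carrying the eigenbasis \<open>S\<close> to \<open>R\<close>. As an
    element of the stabiliser it may be inserted on the right without changing cosets.\<close>
  define O' where "O' = R ** transpose S"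
  have O': "rotation_matrix O'" using R S by (simp add: O'_def rotation_matrix_def orthogonal_matrix_mul det_mul)
  then have Oo: "orthogonal_matrix O'" by (simp add: rotation_matrix_def)
  have "R ** (transpose S ** S) = R" using So by (simp add: orthogonal_matrix)
  then have OS: "O' ** S = R" by (simp add: O'_def matrix_mul_assoc)
  have "u ** (adj u ** v) = v" using SU4D[OF u] by (simp add: matrix_mul_assoc)
  then have cv: "coset v = coset (u ** ?E)" using coset_mult_cong[OF m S(4) u S(3)] by simp
  have "pexp ?X 1 = ?E" using pexp_rdiag[OF So S(2), of 1] by simp
  then have "f (coset v) = coset (g ** pexp (\<tau> ?X) 1)" using geo[OF X, of 1] cv by simp
  also have "pexp (\<tau> ?X) 1 = rdiag R (\<lambda>i. cis (\<epsilon> * x i))"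
    using pexp_rdiag[OF Ro, of "\<lambda>i. \<epsilon> * x i" 1] S(2) by (simp add: R flip: sum_distrib_left)
  also have "coset (g ** rdiag R (\<lambda>i. cis (\<epsilon> * x i))) = coset (g ** rdiag R (\<lambda>i. cis (\<epsilon> * x i)) ** of_real_mat O')"
  proof (rule coset_mult_of_real_mat[OF _ O', symmetric])
    have "rdiag R (\<lambda>i. cis (\<epsilon> * x i)) \<in> SU4"
      using S(2) by (simp add: SU4_iff unitary_rdiag[OF Ro] det_rdiag[OF Ro] prod_cis flip: sum_distrib_left)
    then show "g ** rdiag R (\<lambda>i. cis (\<epsilon> * x i)) \<in> SU4" using g by (simp add: SU4_mult)
  qed
  also have "g ** rdiag R (\<lambda>i. cis (\<epsilon> * x i)) ** of_real_mat O' = g ** of_real_mat O' ** rdiag S (\<lambda>i. cis (\<epsilon> * x i))"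
    unfolding OS[symmetric] rdiag_mult_of_real_mat[symmetric]
    by (simp add: matrix_mul_assoc orthogonal_of_real_mat[OF Oo])
  finally have fv: "f (coset v) = coset (g ** of_real_mat O' ** rdiag S (\<lambda>i. cis (\<epsilon> * x i)))" .
  have fu': "f (coset u) = coset (g ** of_real_mat O')" using fu coset_mult_of_real_mat[OF g O'] by simp
  have gO: "g ** of_real_mat O' \<in> SU4" using g O' by (simp add: SU4_mult SU4_of_real_mat)
  from \<epsilon>(1) show ?thesis
  proof
    assume e: "\<epsilon> = 1"
    let ?h = "g ** of_real_mat O' ** adj u"
    have h: "?h \<in> SU4" using gO u by (simp add: SU4_mult SU4_adj)
    have "coset (?h ** v) = coset (?h ** (u ** ?E))"
      using cv u S(4) v h by (intro coset_mult_cong) (auto simp: SU4_mult)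
    then have "f (coset v) = coset (?h ** v)"
      using fv e by (simp add: matrix_mul_assoc SU4D[OF u])
    moreover have "f (coset u) = coset (?h ** u)" using fu' by (simp add: SU4D[OF u])
    ultimately show ?thesis using h by blast
  next
    assume e: "\<epsilon> = -1"
    let ?h = "g ** of_real_mat O' ** adj (cnj_mat u)"
    note U = SU4D[OF SU4_cnj[OF u]]
    have h: "?h \<in> SU4" using gO u by (simp add: SU4_mult SU4_adj SU4_cnj)
    have "coset (cnj_mat v) = coset (cnj_mat (u ** ?E))"
      using cv u S(4) v by (intro coset_cnj_cong) (auto simp: SU4_mult)
    then have "coset (?h ** cnj_mat v) = coset (?h ** cnj_mat (u ** ?E))"
      using u S(4) v h by (intro coset_mult_cong) (auto simp: SU4_mult SU4_cnj)
    \<comment> \<open>Complex conjugation reverses all angles of \<open>?E\<close>, which accounts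
      for the sign -1.\<close>
    also have "?h ** cnj_mat (u ** ?E) = g ** of_real_mat O' ** rdiag S (\<lambda>i. cis (\<epsilon> * x i))"
      by (simp add: cnj_mat_mult cnj_mat_rdiag cis_cnj matrix_mul_assoc U e)
    finally have "f (coset v) = coset (?h ** cnj_mat v)" using fv by simp
    moreover have "f (coset u) = coset (?h ** cnj_mat u)" using fu' by (simp add: U)
    ultimately show ?thesis using h by blast
  qed
qed

subsection \<open>Quotient maps\<close>

text \<open>Products of quotient maps need not be quotient maps, but openness passes to
  products.\<close>

lemma open_map_prod:
  assumes "open_map X X' f" "open_map Y Y' g"
  shows "open_map (prod_topology X Y) (prod_topology X' Y') (\<lambda>(x, y). (f x, g y))"
  unfolding open_map_def
proof (intro allI impI)
  fix W assume W: "openin (prod_topology X Y) W"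
  show "openin (prod_topology X' Y') ((\<lambda>(x, y). (f x, g y)) ` W)"
    unfolding openin_prod_topology_alt
  proof (intro allI impI)
    fix a b assume "(a, b) \<in> (\<lambda>(x, y). (f x, g y)) ` W"
    then obtain x y where xy: "(x, y) \<in> W" "a = f x" "b = g y" by auto
    then obtain U V where "openin X U" "openin Y V" "x \<in> U" "y \<in> V" "U \<times> V \<subseteq> W"
      using W unfolding openin_prod_topology_alt by meson
    then show "\<exists>U V. openin X' U \<and> openin Y' V \<and> a \<in> U \<and> b \<in> V \<and> U \<times> V \<subseteq> (\<lambda>(x, y). (f x, g y)) ` W"
      using assms xy by (intro exI[of _ "f ` U"] exI[of _ "g ` V"]) (force simp: open_map_def)
  qed
qed

text \<open>With equal fibres, each quotient map factors through the other, and the two induced maps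
  are mutually inverse.\<close>

lemma quotient_maps_homeomorphic:
  assumes p: "quotient_map X Y p" and q: "quotient_map X Z q"
    and eq: "\<And>x y. x \<in> topspace X \<Longrightarrow> y \<in> topspace X \<Longrightarrow> p x = p y \<longleftrightarrow> q x = q y"
  shows "\<exists>h. homeomorphic_map Y Z h \<and> (\<forall>x\<in>topspace X. h (p x) = q x)"
proof -
  obtain h where h: "continuous_map Y Z h" "\<And>x. x \<in> topspace X \<Longrightarrow> h (p x) = q x"
    using quotient_map_lift_exists[OF p quotient_imp_continuous_map[OF q]] eq by metis
  obtain k where k: "continuous_map Z Y k" "\<And>x. x \<in> topspace X \<Longrightarrow> k (q x) = p x"
    using quotient_map_lift_exists[OF q quotient_imp_continuous_map[OF p]] eq by metis
  have "homeomorphic_maps Y Z h k"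
    unfolding homeomorphic_maps_def
  proof (intro conjI ballI h k)
    fix y assume "y \<in> topspace Y"
    then obtain x where "x \<in> topspace X" "y = p x" using p by (auto simp: quotient_map_def)
    then show "k (h y) = y" using h k by simp
  next
    fix z assume "z \<in> topspace Z"
    then obtain x where "x \<in> topspace X" "z = q x" using q by (auto simp: quotient_map_def)
    then show "h (k z) = z" using h k by simp
  qed
  then show ?thesis using h homeomorphic_map_maps by blast
qed

lemma equiv_coset_rel: "equiv SU4 coset_rel"
proof (rule equivI)
  show "coset_rel \<subseteq> SU4 \<times> SU4" by (auto simp: coset_rel_def)
  show "refl_on SU4 coset_rel" by (auto simp: refl_on_def coset_rel_def coset_self)
  show "sym coset_rel" by (auto simp: sym_def coset_rel_def simp flip: coset_eq_iff_in)
  show "trans coset_rel" by (auto simp: trans_def coset_rel_def simp flip: coset_eq_iff_in)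
qed

lemma coset_rel_class: "u \<in> SU4 \<Longrightarrow> coset_rel `` {u} = coset u"
  by (auto simp: coset_rel_def in_coset_iff)

lemma topspace_sspace_topology: "topspace sspace_topology = sspace"
  using topspace_quot_topology[of "top_of_set SU4" coset_rel] equiv_coset_rel
  by (auto simp: sspace_topology_def sspace_def quotient_def coset_rel_class)

lemma quotient_map_coset: "quotient_map (top_of_set SU4) sspace_topology coset"
  unfolding sspace_topology_def
  by (rule quotient_map_eq[OF quotient_map_quot_topology]) (simp_all add: equiv_coset_rel coset_rel_class)

text \<open>The saturation of an open set is a union of its preimages under right multiplication by
  stabiliser elements, each of which is open.\<close>

lemma open_map_coset: "open_map (top_of_set SU4) sspace_topology coset"
  unfolding open_map_def
proof (intro allI impI)
  fix W assume W: "openin (top_of_set SU4) W"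
  then have WS: "W \<subseteq> SU4" using openin_subset by fastforce
  have "{u \<in> SU4. coset u \<in> coset ` W} = (\<Union>k\<in>stab_SU4. SU4 \<inter> (\<lambda>u. u ** k) -` W)"
  proof (intro equalityI subsetI)
    fix u assume "u \<in> {u \<in> SU4. coset u \<in> coset ` W}"
    then obtain w where w: "u \<in> SU4" "w \<in> W" "coset u = coset w" by blast
    then have "w \<in> coset u" using WS coset_self by blast
    then obtain k where "k \<in> stab_SU4" "w = u ** k" unfolding coset_def by blast
    then show "u \<in> (\<Union>k\<in>stab_SU4. SU4 \<inter> (\<lambda>u. u ** k) -` W)" using w(1,2) by blast
  next
    fix u assume "u \<in> (\<Union>k\<in>stab_SU4. SU4 \<inter> (\<lambda>u. u ** k) -` W)"
    then obtain k where k: "k \<in> stab_SU4" "u \<in> SU4" "u ** k \<in> W" by auto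
    then have "coset u = coset (u ** k)" using WS by (subst coset_eq_iff_in) (auto simp: coset_def)
    then show "u \<in> {u \<in> SU4. coset u \<in> coset ` W}" using k by blast
  qed
  moreover have "openin (top_of_set SU4) (SU4 \<inter> (\<lambda>u. u ** k) -` W)" if "k \<in> stab_SU4" for k
    using that W by (intro continuous_openin_preimage[where T = SU4])
      (auto intro!: continuous_intros simp: SU4_mult stab_SU4_iff)
  then have "openin (top_of_set SU4) (\<Union>k\<in>stab_SU4. SU4 \<inter> (\<lambda>u. u ** k) -` W)"
    by (intro openin_Union) blast
  ultimately have "openin (top_of_set SU4) {u \<in> SU4. coset u \<in> coset ` W}" by (simp only:)
  moreover have "coset ` W \<subseteq> topspace sspace_topology" using WS by (auto simp: topspace_sspace_topology sspace_def)
  ultimately show "openin sspace_topology (coset ` W)"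
    using quotient_map_coset unfolding quotient_map_def by simp
qed

abbreviation "pairs_topology \<equiv> prod_topology sspace_topology sspace_topology"

lemma quotient_map_coset_pair:
  "quotient_map (top_of_set (SU4 \<times> SU4)) pairs_topology (\<lambda>(u, v). (coset u, coset v))"
proof (rule continuous_open_imp_quotient_map)
  have "continuous_map (top_of_set SU4) sspace_topology coset"
    by (rule quotient_imp_continuous_map[OF quotient_map_coset])
  then show "continuous_map (top_of_set (SU4 \<times> SU4)) pairs_topology (\<lambda>(u, v). (coset u, coset v))"
    unfolding prod_topology_subtopology_eu[symmetric] continuous_map_prod_top by blast
  show "open_map (top_of_set (SU4 \<times> SU4)) pairs_topology (\<lambda>(u, v). (coset u, coset v))"
    using open_map_prod[OF open_map_coset open_map_coset] by simp
  show "(\<lambda>(u, v). (coset u, coset v)) ` topspace (top_of_set (SU4 \<times> SU4)) = topspace pairs_topology"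
    by (auto simp: topspace_sspace_topology sspace_def)
qed

section \<open>Compactness and quotient maps onto the moduli spaces\<close>

lemma compact_SU4: "compact SU4"
proof -
  have "closed {u. adj u ** u = mat 1 \<and> det u = 1}"
    by (intro closed_Collect_conj closed_Collect_eq continuous_intros)
  moreover have "SU4 = {u. adj u ** u = mat 1 \<and> det u = 1}" by (auto simp: SU4_iff unitary_def)
  ultimately have "closed SU4" by (simp only:)
  moreover have "bounded SU4"
  proof (rule boundedI)
    fix u assume "u \<in> SU4"
    then have "trace (adj u ** u) = 4" by (simp add: SU4_iff unitary_def trace_I)
    moreover have "trace (adj u ** u) = complex_of_real (\<Sum>i\<in>UNIV. \<Sum>j\<in>UNIV. (cmod (u $ j $ i))\<^sup>2)"
      by (simp add: trace_def matrix_mult_nth adj_def transpose_nth complex_norm_square mult.commute del: of_real_power)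
    ultimately have "complex_of_real (\<Sum>i\<in>UNIV. \<Sum>j\<in>UNIV. (cmod (u $ j $ i))\<^sup>2) = of_real 4" by simp
    then have "(\<Sum>i\<in>UNIV. \<Sum>j\<in>UNIV. (cmod (u $ j $ i))\<^sup>2) = 4" by (simp only: of_real_eq_iff)
    then have "(\<Sum>j\<in>UNIV. \<Sum>i\<in>UNIV. (cmod (u $ j $ i))\<^sup>2) = 4" by (subst sum.swap)
    then have "(norm u)\<^sup>2 = 2\<^sup>2" by (simp add: norm_vec_def L2_set_def sum_nonneg)
    then show "norm u \<le> 2" by (metis order_refl power2_eq_iff_nonneg norm_ge_zero zero_le_numeral)
  qed
  ultimately show ?thesis by (simp add: compact_eq_bounded_closed)
qed

text \<open>Square roots of the eigenvalues give a unitary root of \<open>L\<close>, which a phase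
  moves into \<open>SU4\<close>.\<close>

lemma sym_unitary_scal_sq:
  assumes "L \<in> sym_unitary" obtains z m where "cmod z = 1" "m \<in> SU4" "L = scal z (sq m)"
proof -
  obtain S d where S: "rotation_matrix S" "L = rdiag S d" "\<And>i. cmod (d i) = 1"
    using sym_unitary_diagonalisation[OF assms] by metis
  have So: "orthogonal_matrix S" using S by (simp add: rotation_matrix_def)
  let ?D = "rdiag S (\<lambda>i. csqrt (d i))"
  have "unitary ?D" by (simp add: unitary_rdiag[OF So] S(3))
  then obtain c where c: "cmod c = 1" "scal c ?D \<in> SU4" using unitary_scal_SU4 by blast
  have "sq ?D = L" by (simp add: S(2) sq_def transpose_rdiag rdiag_mult[OF So] flip: power2_eq_square)
  then have "scal (cnj c * cnj c) (sq (scal c ?D)) = scal ((cnj c * c) * (cnj c * c)) L"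
    by (simp add: sq_scal mult_ac)
  then have "L = scal (cnj c * cnj c) (sq (scal c ?D))"
    using c(1) cnj_mult_self_eq_1[of c] by simp
  moreover have "cmod (cnj c * cnj c) = 1" by (simp add: norm_mult c)
  ultimately show thesis using that c by blast
qed

lemma sym_unitary_scal: "L \<in> sym_unitary \<Longrightarrow> cmod z = 1 \<Longrightarrow> scal z L \<in> sym_unitary"
  by (simp add: sym_unitary_iff transpose_scal unitary_scal)

lemma real_moduli_class_scal:
  assumes "L \<in> sym_unitary" "cmod z = 1"
  shows "real_moduli_rel `` {scal z L} = real_moduli_rel `` {L}"
proof -
  have "(L, scal z L) \<in> real_moduli_rel"
    unfolding real_moduli_rel_iff using assms sym_unitary_scal orthogonal_matrix_id
    by (intro conjI exI[of _ z] exI[of _ "mat 1"]) simp_all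
  then show ?thesis using equiv_class_eq[OF equiv_real_moduli_rel] by metis
qed

lemma topspace_real_moduli_topology: "topspace real_moduli_topology = real_moduli"
  using topspace_quot_topology[of "top_of_set sym_unitary" real_moduli_rel] equiv_real_moduli_rel
  by (simp add: real_moduli_topology_def real_moduli_def)

text \<open>With a phase as additional parameter, \<^const>\<open>pair_matrix\<close> becomes a continuous surjection of
  compact spaces, hence a quotient map.\<close>

lemma quotient_map_pair_matrix:
  "quotient_map (top_of_set (SU4 \<times> SU4)) real_moduli_topology (\<lambda>(u, v). real_moduli_rel `` {pair_matrix u v})"
proof (rule quotient_map_from_composition)
  let ?C = "(SU4 \<times> SU4) \<times> sphere (0::complex) 1"
  let ?P = "\<lambda>((u, v), z). scal z (pair_matrix u v)"
  have cpm: "continuous_on (SU4 \<times> SU4) (\<lambda>(u, v). pair_matrix u v)"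
  proof -
    have "continuous_on (SU4 \<times> SU4) (\<lambda>p. sq (adj (fst p) ** snd p))"
      unfolding sq_def by (intro continuous_intros)
    then show ?thesis
      by (rule continuous_on_eq) (auto simp: pair_matrix_eq)
  qed
  show "continuous_map (top_of_set ?C) (top_of_set (SU4 \<times> SU4)) fst"
    by (auto intro: continuous_intros)
  have q: "quotient_map (top_of_set sym_unitary) real_moduli_topology (\<lambda>L. real_moduli_rel `` {L})"
    unfolding real_moduli_topology_def
    using quotient_map_quot_topology[of "top_of_set sym_unitary" real_moduli_rel] equiv_real_moduli_rel by simp
  have "continuous_map (top_of_set (SU4 \<times> SU4)) (top_of_set sym_unitary) (\<lambda>(u, v). pair_matrix u v)"
    using cpm by (auto simp: pair_matrix_sym_unitary)
  from continuous_map_compose[OF this quotient_imp_continuous_map[OF q]]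
  show "continuous_map (top_of_set (SU4 \<times> SU4)) real_moduli_topology (\<lambda>(u, v). real_moduli_rel `` {pair_matrix u v})"
    by (simp add: o_def case_prod_unfold)
  have "quotient_map (top_of_set ?C) (top_of_set sym_unitary) ?P"
  proof (rule continuous_imp_quotient_map)
    have "continuous_on ?C (\<lambda>x. (\<lambda>(u, v). pair_matrix u v) (fst x))"
      by (rule continuous_on_compose2[OF cpm continuous_on_fst[OF continuous_on_id]]) auto
    then have "continuous_on ?C ?P"
      unfolding case_prod_unfold by (intro continuous_intros)
    then show "continuous_map (top_of_set ?C) (top_of_set sym_unitary) ?P"
      by (auto simp: pair_matrix_sym_unitary sym_unitary_scal)
    show "compact_space (top_of_set ?C)"
      by (intro compact_space_subtopology) (simp add: compact_Times compact_SU4)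
    show "Hausdorff_space (top_of_set sym_unitary)"
      by (intro Hausdorff_space_subtopology Hausdorff_space_euclidean)
    show "?P ` topspace (top_of_set ?C) = topspace (top_of_set sym_unitary)"
    proof (intro equalityI subsetI)
      fix L assume "L \<in> topspace (top_of_set sym_unitary)"
      then obtain z m where z: "cmod z = 1" "m \<in> SU4" "L = scal z (sq m)"
        using sym_unitary_scal_sq by auto
      have "L = ?P ((mat 1, m), z)" using z by (simp add: pair_matrix_eq SU4_mat_1) (simp add: adj_def)
      moreover have "((mat 1, m), z) \<in> ?C" using z SU4_mat_1 by simp
      ultimately show "L \<in> ?P ` topspace (top_of_set ?C)" by (simp only: topspace_euclidean_subtopology) blast
    qed (auto simp: pair_matrix_sym_unitary sym_unitary_scal)
  qed
  \<comment> \<open>The moduli class ignores the extra phase, so the composite factors through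
    \<open>fst\<close>, and the quotient property descends to pairs.\<close>
  from quotient_map_compose[OF this q]
  show "quotient_map (top_of_set ?C) real_moduli_topology ((\<lambda>(u, v). real_moduli_rel `` {pair_matrix u v}) \<circ> fst)"
  proof (rule quotient_map_eq)
    fix x assume "x \<in> topspace (top_of_set ?C)"
    then obtain u v z where "x = ((u, v), z)" "u \<in> SU4" "v \<in> SU4" "cmod z = 1" by auto
    then show "((\<lambda>L. real_moduli_rel `` {L}) \<circ> ?P) x = ((\<lambda>(u, v). real_moduli_rel `` {pair_matrix u v}) \<circ> fst) x"
      using real_moduli_class_scal[OF pair_matrix_sym_unitary] by simp
  qed
qed

lemma quotient_map_unoriented:
  "quotient_map (top_of_set (SU4 \<times> SU4)) unoriented_moduli_topology
     (\<lambda>(u, v). unoriented_rel `` {real_moduli_rel `` {pair_matrix u v}})"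
proof -
  have "quotient_map real_moduli_topology unoriented_moduli_topology (\<lambda>p. unoriented_rel `` {p})"
    unfolding unoriented_moduli_topology_def
    by (rule quotient_map_quot_topology) (simp add: topspace_real_moduli_topology equiv_unoriented_rel)
  from quotient_map_compose[OF quotient_map_pair_matrix this] show ?thesis
    by (simp add: o_def case_prod_unfold)
qed

subsection \<open>Congruence classes of point pairs\<close>

text \<open>Uniform in \<open>G\<close>: that congruence is an equivalence relation is read off from
  its description by equality of \<open>q\<close>, and both spaces are then quotients of
  \<open>SU4 \<times> SU4\<close> with the same fibres.\<close>

lemma congruence_classes_homeomorphic:
  assumes q: "quotient_map (top_of_set (SU4 \<times> SU4)) M (\<lambda>(u, v). q u v)"
    and eq: "\<And>u v u' v'. u \<in> SU4 \<Longrightarrow> v \<in> SU4 \<Longrightarrow> u' \<in> SU4 \<Longrightarrow> v' \<in> SU4 \<Longrightarrow>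
      ((coset u, coset v), (coset u', coset v')) \<in> congruence G \<longleftrightarrow> q u v = q u' v'"
  shows "\<exists>\<Phi>. homeomorphic_map M (point_pairs_topology G) \<Phi> \<and>
    (\<forall>u\<in>SU4. \<forall>v\<in>SU4. \<Phi> (q u v) = congruence G `` {(coset u, coset v)})"
proof -
  have sub: "congruence G \<subseteq> (sspace \<times> sspace) \<times> (sspace \<times> sspace)" by (auto simp: congruence_def)
  have eq': "((x, y), (x', y')) \<in> congruence G \<longleftrightarrow>
    (\<exists>u\<in>SU4. \<exists>v\<in>SU4. \<exists>u'\<in>SU4. \<exists>v'\<in>SU4. x = coset u \<and> y = coset v \<and> x' = coset u' \<and> y' = coset v' \<and> q u v = q u' v')"
    (is "_ \<longleftrightarrow> ?R x y x' y'") for x y x' y'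
  proof
    assume c: "((x, y), (x', y')) \<in> congruence G"
    then have "x \<in> sspace" "y \<in> sspace" "x' \<in> sspace" "y' \<in> sspace" using sub by blast+
    then obtain u v u' v' where uv: "u \<in> SU4" "v \<in> SU4" "u' \<in> SU4" "v' \<in> SU4"
      "x = coset u" "y = coset v" "x' = coset u'" "y' = coset v'" unfolding sspace_def by blast
    with c eq[OF uv(1-4)] show "?R x y x' y'" by blast
  next
    assume "?R x y x' y'"
    then show "((x, y), (x', y')) \<in> congruence G" using eq by blast
  qed
  have wd: "q u v = q u' v'" if "u \<in> SU4" "v \<in> SU4" "u' \<in> SU4" "v' \<in> SU4" "coset u = coset u'" "coset v = coset v'" for u v u' v'
    using eq[OF that(1-4)] eq[OF that(1,2,1,2)] that(5,6) by simp
  have "equiv (sspace \<times> sspace) (congruence G)"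
  proof (rule equivI)
    show "congruence G \<subseteq> (sspace \<times> sspace) \<times> (sspace \<times> sspace)" by (rule sub)
    show "refl_on (sspace \<times> sspace) (congruence G)"
      using eq by (auto simp: refl_on_def sspace_def)
    show "sym (congruence G)"
    proof (rule symI)
      fix a b assume ab: "(a, b) \<in> congruence G"
      obtain x y x' y' where "a = (x, y)" "b = (x', y')" by (metis surj_pair)
      with ab show "(b, a) \<in> congruence G" using eq'[of x y x' y'] eq'[of x' y' x y] by metis
    qed
    show "trans (congruence G)"
    proof (rule transI)
      fix a b c assume ab: "(a, b) \<in> congruence G" and bc: "(b, c) \<in> congruence G"
      obtain x y x' y' x'' y'' where abc: "a = (x, y)" "b = (x', y')" "c = (x'', y'')" by (metis surj_pair)
      from ab obtain u v u' v' where 1: "u \<in> SU4" "v \<in> SU4" "u' \<in> SU4" "v' \<in> SU4"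
        "x = coset u" "y = coset v" "x' = coset u'" "y' = coset v'" "q u v = q u' v'"
        unfolding abc eq' by blast
      from bc obtain w z w' z' where 2: "w \<in> SU4" "z \<in> SU4" "w' \<in> SU4" "z' \<in> SU4"
        "x' = coset w" "y' = coset z" "x'' = coset w'" "y'' = coset z'" "q w z = q w' z'"
        unfolding abc eq' by blast
      \<comment> \<open>The two congruences may represent the middle pair by different matrices;
        \<open>wd\<close> shows that \<open>q\<close> does not notice.\<close>
      have "q u' v' = q w z" by (rule wd) (use 1 2 in simp_all)
      then have "q u v = q w' z'" using 1(9) 2(9) by simp
      then show "(a, c) \<in> congruence G" using eq[OF 1(1,2) 2(3,4)] by (simp add: abc 1(5,6) 2(7,8))
    qed
  qed
  then have E: "equiv (topspace pairs_topology) (congruence G)"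
    by (simp add: topspace_sspace_topology)
  have q2: "quotient_map (top_of_set (SU4 \<times> SU4)) (point_pairs_topology G)
      (\<lambda>(u, v). congruence G `` {(coset u, coset v)})"
    unfolding point_pairs_topology_def
    using quotient_map_compose[OF quotient_map_coset_pair quotient_map_quot_topology[OF E]]
    by (simp add: o_def case_prod_unfold)
  have "\<exists>\<Phi>. homeomorphic_map M (point_pairs_topology G) \<Phi> \<and>
    (\<forall>x\<in>topspace (top_of_set (SU4 \<times> SU4)). \<Phi> ((\<lambda>(u, v). q u v) x) = (\<lambda>(u, v). congruence G `` {(coset u, coset v)}) x)"
  proof (rule quotient_maps_homeomorphic[OF q q2])
    fix a b assume "a \<in> topspace (top_of_set (SU4 \<times> SU4))" "b \<in> topspace (top_of_set (SU4 \<times> SU4))"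
    then obtain u v u' v' where ab: "a = (u, v)" "b = (u', v')" "u \<in> SU4" "v \<in> SU4" "u' \<in> SU4" "v' \<in> SU4" by auto
    then have "(coset u, coset v) \<in> topspace pairs_topology"
      "(coset u', coset v') \<in> topspace pairs_topology"
      by (simp_all add: topspace_sspace_topology sspace_def)
    from eq_equiv_class_iff[OF E this] eq[OF ab(3-6)]
    show "(\<lambda>(u, v). q u v) a = (\<lambda>(u, v). q u v) b \<longleftrightarrow>
      (\<lambda>(u, v). congruence G `` {(coset u, coset v)}) a = (\<lambda>(u, v). congruence G `` {(coset u, coset v)}) b"
      by (simp add: ab)
  qed
  then show ?thesis by auto
qed

lemma congruence_SU4_iff:
  assumes "u \<in> SU4" "v \<in> SU4" "u' \<in> SU4" "v' \<in> SU4"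
  shows "((coset u, coset v), (coset u', coset v')) \<in> congruence (translation ` SU4) \<longleftrightarrow>
    (pair_matrix u v, pair_matrix u' v') \<in> real_moduli_rel"
  using assms by (auto simp: congruence_def sspace_def translation_coset simp flip: congruent_iff_pair_matrix)

text \<open>Translations, alone or preceded by conjugation, realise both alternatives; conversely
  \<open>isometry_point_pair\<close> shows that no isometry produces anything else on a given
  pair.\<close>

lemma congruence_isometry_iff:
  assumes S: "u \<in> SU4" "v \<in> SU4" "u' \<in> SU4" "v' \<in> SU4"
  shows "((coset u, coset v), (coset u', coset v')) \<in> congruence {f. isometry f} \<longleftrightarrow>
    (pair_matrix u v, pair_matrix u' v') \<in> real_moduli_rel \<or> (cnj_mat (pair_matrix u v), pair_matrix u' v') \<in> real_moduli_rel"
proof -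
  have "((coset u, coset v), (coset u', coset v')) \<in> congruence {f. isometry f} \<longleftrightarrow>
    (\<exists>f. isometry f \<and> f (coset u) = coset u' \<and> f (coset v) = coset v')"
    using S by (auto simp: congruence_def sspace_def)
  also have "\<dots> \<longleftrightarrow> (\<exists>h\<in>SU4. coset (h ** u) = coset u' \<and> coset (h ** v) = coset v') \<or>
      (\<exists>h\<in>SU4. coset (h ** cnj_mat u) = coset u' \<and> coset (h ** cnj_mat v) = coset v')" (is "?f \<longleftrightarrow> ?h \<or> ?h'")
  proof
    assume ?f
    then show "?h \<or> ?h'"
      using isometry_point_pair[OF _ S(1,2)] by metis
  next
    assume "?h \<or> ?h'"
    then show ?f
    proof
      assume ?h
      then obtain h where "h \<in> SU4" "coset (h ** u) = coset u'" "coset (h ** v) = coset v'" by blast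
      then show ?thesis using isometry_translation
        by (intro exI[of _ "translation h"]) (simp add: translation_coset)
    next
      assume ?h'
      then obtain h where "h \<in> SU4" "coset (h ** cnj_mat u) = coset u'" "coset (h ** cnj_mat v) = coset v'" by blast
      then show ?thesis using isometry_cnj
        by (intro exI[of _ "\<lambda>x. translation h (cnj_mat ` x)"]) (simp add: cnj_mat_coset translation_coset)
    qed
  qed
  finally show ?thesis
    using S by (simp add: congruent_iff_pair_matrix SU4_cnj pair_matrix_cnj)
qed

theorem proposition1:
  shows "(\<exists>\<Phi>. homeomorphic_map real_moduli_topology (point_pairs_topology (translation ` SU4)) \<Phi> \<and>
            (\<forall>u\<in>SU4. \<forall>v\<in>SU4.
               \<Phi> (real_moduli_rel `` {pair_matrix u v}) =
                 congruence (translation ` SU4) `` {(coset u, coset v)}))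
       \<and> (\<exists>\<Psi>. homeomorphic_map unoriented_moduli_topology (point_pairs_topology {f. isometry f}) \<Psi> \<and>
            (\<forall>u\<in>SU4. \<forall>v\<in>SU4.
               \<Psi> (unoriented_rel `` {real_moduli_rel `` {pair_matrix u v}}) =
                 congruence {f. isometry f} `` {(coset u, coset v)}))"
proof (intro conjI congruence_classes_homeomorphic quotient_map_pair_matrix quotient_map_unoriented)
  fix u v u' v' assume S: "u \<in> SU4" "v \<in> SU4" "u' \<in> SU4" "v' \<in> SU4"
  note P = pair_matrix_sym_unitary[OF S(1,2)] pair_matrix_sym_unitary[OF S(3,4)]
  show "((coset u, coset v), (coset u', coset v')) \<in> congruence (translation ` SU4) \<longleftrightarrow>
    real_moduli_rel `` {pair_matrix u v} = real_moduli_rel `` {pair_matrix u' v'}"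
    using congruence_SU4_iff[OF S] eq_equiv_class_iff[OF equiv_real_moduli_rel P] by simp
  show "((coset u, coset v), (coset u', coset v')) \<in> congruence {f. isometry f} \<longleftrightarrow>
    unoriented_rel `` {real_moduli_rel `` {pair_matrix u v}} = unoriented_rel `` {real_moduli_rel `` {pair_matrix u' v'}}"
    using congruence_isometry_iff[OF S] unoriented_class_eq_iff[OF P] by simp
qed

end
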